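(* Let $V$ be a category with (small) coproducts and let $T$ be a monad on $\mathcal{G}V$ over $\mathbf{Set}$. Then $T$ is of the form $\Gamma E$ for a distributive multitensor $E$ on $V$ (that is, isomorphic to such a $\Gamma E$ as a monad over $\mathbf{Set}$) if and only if $T$ is distributive and path-like; and in this case $E$ is recovered (up to isomorphism of multitensors) as $\overline{T}$.
   Context: Enriched graphs. For a category $V$, a $V$-graph $X$ consists of a set $X_0$ and, for each $(a,b)\in X_0\times X_0$, an object $X(a,b)$ of $V$. A morphism $f:X\to Y$ is a function $f_0:X_0\to Y_0$ with morphisms $f_{a,b}:X(a,b)\to Y(fa,fb)$. These form the category $\mathcal{G}V$, with forgetful functor $(-)_0:\mathcal{G}V\to\mathbf{Set}$. A monad $(T,\eta,\mu)$ on $\mathcal{G}V$ is over $\mathbf{Set}$ when it is a monad on $(-)_0$ in the 2-category $\mathbf{CAT}/\mathbf{Set}$: $(TX)_0=X_0$, $(Tf)_0=f_0$, and components of $\eta,\mu$ are identities on objects. Sequences as graphs. If $V$ has an initial object $\emptyset$, a sequence $(Z_1,\dots,Z_n)$ of objects of $V$ is regarded as the $V$-graph with object set $\{0,\dots,n\}$, hom from $i-1$ to $i$ equal to $Z_i$, and all other homs $\emptyset$. Multitensors. Let $MV=\coprod_nV^n$ be the category of finite sequences of objects of $V$. A multitensor $(E,u,\sigma)$ on $V$ is a functor $E:MV\to V$, $E(X_1,\dots,X_n)=E_iX_i$, unary part $E_1$, with natural families $u_X:X\to E_1X$, $\sigma:E_iE_jX_{ij}\to E_{ij}X_{ij}$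 (target: $E$ of the concatenated sequence) with $\sigma\circ u_{E_iX_i}=1$, $\sigma\circ E_i(u_{X_i})=1$, and the two composites $E_iE_jE_kX_{ijk}\to E_{ijk}X_{ijk}$ of $\sigma$'s equal. It is distributive when each $n$-ary functor $V^n\to V$ preserves coproducts in each variable. Isomorphisms of multitensors are natural isomorphisms compatible with $u$ and $\sigma$. The monad $\Gamma E$ (for $V$ with coproducts, $E$ distributive). $\Gamma E(X)_0=X_0$ and $\Gamma E(X)(a,b)=\coprod_{a=x_0,\dots,x_n=b}E_iX(x_{i-1},x_i)$, coproduct over all $n\in\mathbb N$ and sequences of objects from $a$ to $b$. Unit: identity on objects, hom maps $u_{X(a,b)}$ followed by the inclusion of the summand $(a,b)$. Multiplication: identity on objects; on the summands $E_iE_jX(x_{ij-1},x_{ij})$ of $(\Gamma E)^2(X)(a,b)$ (using distributivity) it is $\sigma$ followed by the coproduct inclusion. The multitensor $\overline{T}$. For a monad $(T,\eta,\mu)$ on $\mathcal{G}V$ over $\mathbf{Set}$: $\overline{T}(Z_1,\dots,Z_n)=T(Z_1,\dots,Z_n)(0,n)$; the unit $\overline{\eta}_Z:Z\to\overline{T}(Z)$ is the hom map of $\eta_{(Z)}$ from $0$ to $1$; for objects $Z_{ij}$ ($1\le i\le k$, $1\le j\le n_i$) let $\tilde{\tau}:(\overline{T}(Z_{11},\dots,Z_{1n_1}),\dots,\overline{T}(Z_{k1},\dots,Z_{kn_k}))\to T(Z_{11},\dots,Z_{kn_k})$ be the graph map sending $0\mapsto 0$, $i\mapsto n_1+\dots+n_i$,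 with hom map from $i-1$ to $i$ the hom map from $0$ to $n_i$ of $T$ applied to the subsequence inclusion $(Z_{i1},\dots,Z_{in_i})\hookrightarrow(Z_{11},\dots,Z_{kn_k})$; the substitution $\overline{\mu}$ is the hom map from $0$ to $k$ of $\mu\circ T(\tilde{\tau})$. (This is a multitensor on $V$ when $V$ has coproducts.) $T$ is distributive when $\overline{T}$ is a distributive multitensor. For $X\in\mathcal{G}V$ and a sequence $x=(x_0,\dots,x_n)$ of objects of $X$, let $\overline{x}:(X(x_0,x_1),\dots,X(x_{n-1},x_n))\to X$ be the map $i\mapsto x_i$ whose hom maps from $i-1$ to $i$ are identities. $T$ is path-like when for all $X$ and $a,b\in X_0$ the map $$\pi_{X,a,b}:\coprod_{a=x_0,\dots,x_n=b}\overline{T}(X(x_0,x_1),\dots,X(x_{n-1},x_n))\to TX(a,b)$$ with components $T(\overline{x})_{0,n}$ is an isomorphism. *)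

theory Defs
  imports Main "HOL-Library.FuncSet"
begin

section \<open>Categories, functors, natural transformations, coproducts\<close>

record ('o, 'm) cat =
  Ob :: "'o set"
  Ar :: "'m set"
  Dom :: "'m \<Rightarrow> 'o"
  Cod :: "'m \<Rightarrow> 'o"
  ident :: "'o \<Rightarrow> 'm"
  cmp :: "'m \<Rightarrow> 'm \<Rightarrow> 'm" (infixr "\<cdot>\<index>" 70)

definition hom :: "('o, 'm) cat \<Rightarrow> 'o \<Rightarrow> 'o \<Rightarrow> 'm set" where
  "hom C a b = {f \<in> Ar C. Dom C f = a \<and> Cod C f = b}"

locale category =
  fixes C :: "('o, 'm) cat" (structure)
  assumes Dom_Ob: "f \<in> Ar C \<Longrightarrow> Dom C f \<in> Ob C"
    and Cod_Ob: "f \<in> Ar C \<Longrightarrow> Cod C f \<in> Ob C"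
    and ident_hom: "a \<in> Ob C \<Longrightarrow> ident C a \<in> hom C a a"
    and cmp_hom: "f \<in> hom C a b \<Longrightarrow> g \<in> hom C b c \<Longrightarrow> g \<cdot> f \<in> hom C a c"
    and ident_left: "f \<in> hom C a b \<Longrightarrow> ident C b \<cdot> f = f"
    and ident_right: "f \<in> hom C a b \<Longrightarrow> f \<cdot> ident C a = f"
    and cmp_assoc:
      "f \<in> hom C a b \<Longrightarrow> g \<in> hom C b c \<Longrightarrow> h \<in> hom C c d \<Longrightarrow> (h \<cdot> g) \<cdot> f = h \<cdot> (g \<cdot> f)"

definition is_iso :: "('o, 'm) cat \<Rightarrow> 'm \<Rightarrow> bool" where
  "is_iso C f \<longleftrightarrow> f \<in> Ar C \<and>
     (\<exists>g \<in> hom C (Cod C f) (Dom C f).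
        g \<cdot>\<^bsub>C\<^esub> f = ident C (Dom C f) \<and> f \<cdot>\<^bsub>C\<^esub> g = ident C (Cod C f))"

definition is_functor ::
  "('o, 'm) cat \<Rightarrow> ('p, 'n) cat \<Rightarrow> ('o \<Rightarrow> 'p) \<Rightarrow> ('m \<Rightarrow> 'n) \<Rightarrow> bool" where
  "is_functor C D F0 F1 \<longleftrightarrow>
     (\<forall>a \<in> Ob C. F0 a \<in> Ob D) \<and>
     (\<forall>f \<in> Ar C. F1 f \<in> hom D (F0 (Dom C f)) (F0 (Cod C f))) \<and>
     (\<forall>a \<in> Ob C. F1 (ident C a) = ident D (F0 a)) \<and>
     (\<forall>f \<in> Ar C. \<forall>g \<in> Ar C. Cod C f = Dom C g \<longrightarrow> F1 (g \<cdot>\<^bsub>C\<^esub> f) = F1 g \<cdot>\<^bsub>D\<^esub> F1 f)"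

definition is_nat_trans ::
  "('o, 'm) cat \<Rightarrow> ('p, 'n) cat \<Rightarrow> ('o \<Rightarrow> 'p) \<Rightarrow> ('m \<Rightarrow> 'n) \<Rightarrow> ('o \<Rightarrow> 'p) \<Rightarrow> ('m \<Rightarrow> 'n) \<Rightarrow>
   ('o \<Rightarrow> 'n) \<Rightarrow> bool" where
  "is_nat_trans C D F0 F1 G0 G1 t \<longleftrightarrow>
     (\<forall>a \<in> Ob C. t a \<in> hom D (F0 a) (G0 a)) \<and>
     (\<forall>f \<in> Ar C. t (Cod C f) \<cdot>\<^bsub>D\<^esub> F1 f = G1 f \<cdot>\<^bsub>D\<^esub> t (Dom C f))"

definition is_initial :: "('o, 'm) cat \<Rightarrow> 'o \<Rightarrow> bool" where
  "is_initial C z \<longleftrightarrow> z \<in> Ob C \<and> (\<forall>d \<in> Ob C. \<exists>!h. h \<in> hom C z d)"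

definition initial :: "('o, 'm) cat \<Rightarrow> 'o" where
  "initial C = (SOME z. is_initial C z)"

definition from_initial :: "('o, 'm) cat \<Rightarrow> 'o \<Rightarrow> 'm" where
  "from_initial C d = (THE h. h \<in> hom C (initial C) d)"

definition is_coproduct ::
  "('o, 'm) cat \<Rightarrow> 'i set \<Rightarrow> ('i \<Rightarrow> 'o) \<Rightarrow> 'o \<Rightarrow> ('i \<Rightarrow> 'm) \<Rightarrow> bool" where
  "is_coproduct C I Z c \<iota> \<longleftrightarrow>
     c \<in> Ob C \<and> (\<forall>i \<in> I. Z i \<in> Ob C \<and> \<iota> i \<in> hom C (Z i) c) \<and>
     (\<forall>d \<in> Ob C. \<forall>g. (\<forall>i \<in> I. g i \<in> hom C (Z i) d) \<longrightarrow>
        (\<exists>!h. h \<in> hom C c d \<and> (\<forall>i \<in> I. h \<cdot>\<^bsub>C\<^esub> \<iota> i = g i)))"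

definition chosen_coproduct :: "('o, 'm) cat \<Rightarrow> 'i set \<Rightarrow> ('i \<Rightarrow> 'o) \<Rightarrow> 'o \<times> ('i \<Rightarrow> 'm)" where
  "chosen_coproduct C I Z = (SOME (c, \<iota>). is_coproduct C I Z c \<iota>)"

definition coprod :: "('o, 'm) cat \<Rightarrow> 'i set \<Rightarrow> ('i \<Rightarrow> 'o) \<Rightarrow> 'o" where
  "coprod C I Z = fst (chosen_coproduct C I Z)"

definition incl :: "('o, 'm) cat \<Rightarrow> 'i set \<Rightarrow> ('i \<Rightarrow> 'o) \<Rightarrow> 'i \<Rightarrow> 'm" where
  "incl C I Z = snd (chosen_coproduct C I Z)"

definition cotuple ::
  "('o, 'm) cat \<Rightarrow> 'i set \<Rightarrow> ('i \<Rightarrow> 'o) \<Rightarrow> 'o \<Rightarrow> ('i \<Rightarrow> 'm) \<Rightarrow> 'm" where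
  "cotuple C I Z d g =
     (THE h. h \<in> hom C (coprod C I Z) d \<and> (\<forall>i \<in> I. h \<cdot>\<^bsub>C\<^esub> incl C I Z i = g i))"

text \<open>
  Small sets are modelled as a class of subsets of a type \<open>'u\<close> with the closure properties below.
  Models are the elements of a Grothendieck universe (with an infinite element), all subsets of an
  infinite type, and the countable subsets of an infinite type.
\<close>

locale smallness =
  fixes small :: "'u set \<Rightarrow> bool"
  assumes ex_infinite: "\<exists>A. small A \<and> infinite A"
    and small_subset: "small A \<Longrightarrow> B \<subseteq> A \<Longrightarrow> small B"
    and small_image: "small A \<Longrightarrow> small (f ` A)"
    and small_UN: "small A \<Longrightarrow> (\<And>a. a \<in> A \<Longrightarrow> small (F a)) \<Longrightarrow> small (\<Union>a \<in> A. F a)"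

definition has_coproducts :: "('u set \<Rightarrow> bool) \<Rightarrow> ('o, 'm) cat \<Rightarrow> bool" where
  "has_coproducts small C \<longleftrightarrow>
     (\<forall>I Z. small I \<and> (\<forall>i \<in> I. Z i \<in> Ob C) \<longrightarrow> (\<exists>c \<iota>. is_coproduct C I Z c \<iota>))"

section \<open>Monads\<close>

record ('o, 'm) monad_data =
  mob :: "'o \<Rightarrow> 'o"
  mar :: "'m \<Rightarrow> 'm"
  eta :: "'o \<Rightarrow> 'm"
  mu :: "'o \<Rightarrow> 'm"

definition is_monad :: "('o, 'm) cat \<Rightarrow> ('o, 'm) monad_data \<Rightarrow> bool" where
  "is_monad C T \<longleftrightarrow>
     is_functor C C (mob T) (mar T) \<and>
     is_nat_trans C C (\<lambda>X. X) (\<lambda>f. f) (mob T) (mar T) (eta T) \<and>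
     is_nat_trans C C (\<lambda>X. mob T (mob T X)) (\<lambda>f. mar T (mar T f)) (mob T) (mar T) (mu T) \<and>
     (\<forall>X \<in> Ob C.
        mu T X \<cdot>\<^bsub>C\<^esub> eta T (mob T X) = ident C (mob T X) \<and>
        mu T X \<cdot>\<^bsub>C\<^esub> mar T (eta T X) = ident C (mob T X) \<and>
        mu T X \<cdot>\<^bsub>C\<^esub> mu T (mob T X) = mu T X \<cdot>\<^bsub>C\<^esub> mar T (mu T X))"

section \<open>Enriched graphs\<close>

text \<open>
  Object maps and families of homs take the value \<^const>\<open>undefined\<close> outside the set of objects, so
  that equality of graphs and of graph maps is the intended one.
\<close>

definition restrict2 :: "'u set \<Rightarrow> ('u \<Rightarrow> 'u \<Rightarrow> 'b) \<Rightarrow> 'u \<Rightarrow> 'u \<Rightarrow> 'b" where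
  "restrict2 A h = (\<lambda>a b. if a \<in> A \<and> b \<in> A then h a b else undefined)"

definition extensional2 :: "'u set \<Rightarrow> ('u \<Rightarrow> 'u \<Rightarrow> 'b) \<Rightarrow> bool" where
  "extensional2 A h \<longleftrightarrow> (\<forall>a b. \<not> (a \<in> A \<and> b \<in> A) \<longrightarrow> h a b = undefined)"

record ('u, 'o) vgraph =
  verts :: "'u set"
  edge :: "'u \<Rightarrow> 'u \<Rightarrow> 'o"

record ('u, 'o, 'm) gmap =
  gsrc :: "('u, 'o) vgraph"
  gtgt :: "('u, 'o) vgraph"
  gobj :: "'u \<Rightarrow> 'u"
  ghom :: "'u \<Rightarrow> 'u \<Rightarrow> 'm"

definition is_vgraph :: "('u set \<Rightarrow> bool) \<Rightarrow> ('o, 'm) cat \<Rightarrow> ('u, 'o) vgraph \<Rightarrow> bool" where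
  "is_vgraph small V X \<longleftrightarrow>
     small (verts X) \<and>
     (\<forall>a \<in> verts X. \<forall>b \<in> verts X. edge X a b \<in> Ob V) \<and>
     extensional2 (verts X) (edge X)"

definition is_gmap :: "('u set \<Rightarrow> bool) \<Rightarrow> ('o, 'm) cat \<Rightarrow> ('u, 'o, 'm) gmap \<Rightarrow> bool" where
  "is_gmap small V f \<longleftrightarrow>
     is_vgraph small V (gsrc f) \<and> is_vgraph small V (gtgt f) \<and>
     gobj f \<in> verts (gsrc f) \<rightarrow>\<^sub>E verts (gtgt f) \<and>
     (\<forall>a \<in> verts (gsrc f). \<forall>b \<in> verts (gsrc f).
        ghom f a b \<in> hom V (edge (gsrc f) a b) (edge (gtgt f) (gobj f a) (gobj f b))) \<and>
     extensional2 (verts (gsrc f)) (ghom f)"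

definition graph_cat ::
  "('u set \<Rightarrow> bool) \<Rightarrow> ('o, 'm) cat \<Rightarrow> (('u, 'o) vgraph, ('u, 'o, 'm) gmap) cat" where
  "graph_cat small V =
     \<lparr>Ob = {X. is_vgraph small V X},
      Ar = {f. is_gmap small V f},
      Dom = gsrc,
      Cod = gtgt,
      ident = (\<lambda>X. \<lparr>gsrc = X, gtgt = X, gobj = (\<lambda>a \<in> verts X. a),
                 ghom = restrict2 (verts X) (\<lambda>a b. ident V (edge X a b))\<rparr>),
      cmp = (\<lambda>g f. \<lparr>gsrc = gsrc f, gtgt = gtgt g,
                 gobj = compose (verts (gsrc f)) (gobj g) (gobj f),
                 ghom = restrict2 (verts (gsrc f))
                   (\<lambda>a b. ghom g (gobj f a) (gobj f b) \<cdot>\<^bsub>V\<^esub> ghom f a b)\<rparr>)\<rparr>"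

definition is_monad_over_Set ::
  "('u set \<Rightarrow> bool) \<Rightarrow> ('o, 'm) cat \<Rightarrow> (('u, 'o) vgraph, ('u, 'o, 'm) gmap) monad_data \<Rightarrow> bool"
  where
  "is_monad_over_Set small V T \<longleftrightarrow>
     is_monad (graph_cat small V) T \<and>
     (\<forall>X. is_vgraph small V X \<longrightarrow>
        verts (mob T X) = verts X \<and>
        gobj (eta T X) = (\<lambda>a \<in> verts X. a) \<and>
        gobj (mu T X) = (\<lambda>a \<in> verts X. a)) \<and>
     (\<forall>f. is_gmap small V f \<longrightarrow> gobj (mar T f) = gobj f)"

definition monads_over_Set_isomorphic ::
  "('u set \<Rightarrow> bool) \<Rightarrow> ('o, 'm) cat \<Rightarrow> (('u, 'o) vgraph, ('u, 'o, 'm) gmap) monad_data \<Rightarrow>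
   (('u, 'o) vgraph, ('u, 'o, 'm) gmap) monad_data \<Rightarrow> bool" where
  "monads_over_Set_isomorphic small V S T \<longleftrightarrow>
     (let G = graph_cat small V in
      \<exists>\<phi>. is_nat_trans G G (mob S) (mar S) (mob T) (mar T) \<phi> \<and>
          (\<forall>X \<in> Ob G.
             is_iso G (\<phi> X) \<and>
             gobj (\<phi> X) = (\<lambda>a \<in> verts X. a) \<and>
             \<phi> X \<cdot>\<^bsub>G\<^esub> eta S X = eta T X \<and>
             \<phi> X \<cdot>\<^bsub>G\<^esub> mu S X = mu T X \<cdot>\<^bsub>G\<^esub> (mar T (\<phi> X) \<cdot>\<^bsub>G\<^esub> \<phi> (mob S X))))"

section \<open>Multitensors\<close>

definition seq_cat :: "('o, 'm) cat \<Rightarrow> ('o list, 'm list) cat" where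
  "seq_cat V =
     \<lparr>Ob = lists (Ob V),
      Ar = lists (Ar V),
      Dom = map (Dom V),
      Cod = map (Cod V),
      ident = map (ident V),
      cmp = map2 (cmp V)\<rparr>"

record ('o, 'm) multitensor_data =
  tob :: "'o list \<Rightarrow> 'o"
  tar :: "'m list \<Rightarrow> 'm"
  tunit :: "'o \<Rightarrow> 'm"
  tsub :: "'o list list \<Rightarrow> 'm"

definition is_multitensor :: "('o, 'm) cat \<Rightarrow> ('o, 'm) multitensor_data \<Rightarrow> bool" where
  "is_multitensor V E \<longleftrightarrow>
     is_functor (seq_cat V) V (tob E) (tar E) \<and>
     is_nat_trans V V (\<lambda>X. X) (\<lambda>f. f) (\<lambda>X. tob E [X]) (\<lambda>f. tar E [f]) (tunit E) \<and>
     is_nat_trans (seq_cat (seq_cat V)) V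
       (\<lambda>Xss. tob E (map (tob E) Xss)) (\<lambda>fss. tar E (map (tar E) fss))
       (\<lambda>Xss. tob E (concat Xss)) (\<lambda>fss. tar E (concat fss)) (tsub E) \<and>
     (\<forall>Xs \<in> lists (Ob V).
        tsub E [Xs] \<cdot>\<^bsub>V\<^esub> tunit E (tob E Xs) = ident V (tob E Xs) \<and>
        tsub E (map (\<lambda>X. [X]) Xs) \<cdot>\<^bsub>V\<^esub> tar E (map (tunit E) Xs) = ident V (tob E Xs)) \<and>
     (\<forall>Xsss \<in> lists (lists (lists (Ob V))).
        tsub E (concat Xsss) \<cdot>\<^bsub>V\<^esub> tsub E (map (map (tob E)) Xsss) =
        tsub E (map concat Xsss) \<cdot>\<^bsub>V\<^esub> tar E (map (tsub E) Xsss))"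

definition is_distributive_multitensor ::
  "('u set \<Rightarrow> bool) \<Rightarrow> ('o, 'm) cat \<Rightarrow> ('o, 'm) multitensor_data \<Rightarrow> bool" where
  "is_distributive_multitensor small V E \<longleftrightarrow>
     is_multitensor V E \<and>
     (\<forall>Xs \<in> lists (Ob V). \<forall>Ys \<in> lists (Ob V). \<forall>(I :: 'u set) Z c \<iota>.
        small I \<and> is_coproduct V I Z c \<iota> \<longrightarrow>
        is_coproduct V I (\<lambda>i. tob E (Xs @ Z i # Ys)) (tob E (Xs @ c # Ys))
          (\<lambda>i. tar E (map (ident V) Xs @ \<iota> i # map (ident V) Ys)))"

definition multitensors_isomorphic ::
  "('o, 'm) cat \<Rightarrow> ('o, 'm) multitensor_data \<Rightarrow> ('o, 'm) multitensor_data \<Rightarrow> bool" where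
  "multitensors_isomorphic V E F \<longleftrightarrow>
     (\<exists>\<phi>. is_nat_trans (seq_cat V) V (tob E) (tar E) (tob F) (tar F) \<phi> \<and>
        (\<forall>Xs \<in> lists (Ob V). is_iso V (\<phi> Xs)) \<and>
        (\<forall>X \<in> Ob V. \<phi> [X] \<cdot>\<^bsub>V\<^esub> tunit E X = tunit F X) \<and>
        (\<forall>Xss \<in> lists (lists (Ob V)).
           \<phi> (concat Xss) \<cdot>\<^bsub>V\<^esub> tsub E Xss =
           tsub F Xss \<cdot>\<^bsub>V\<^esub> (tar F (map \<phi> Xss) \<cdot>\<^bsub>V\<^esub> \<phi> (map (tob E) Xss))))"

section \<open>From multitensors to monads\<close>

definition paths :: "('u, 'o) vgraph \<Rightarrow> 'u \<Rightarrow> 'u \<Rightarrow> 'u list set" where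
  "paths X a b = {xs \<in> lists (verts X). xs \<noteq> [] \<and> hd xs = a \<and> last xs = b}"

text \<open>\<open>along h [x\<^sub>0, \<dots>, x\<^sub>n] = [h x\<^sub>0 x\<^sub>1, \<dots>, h x\<^sub>n\<^sub>-\<^sub>1 x\<^sub>n]\<close>\<close>

definition along :: "('u \<Rightarrow> 'u \<Rightarrow> 'b) \<Rightarrow> 'u list \<Rightarrow> 'b list" where
  "along h xs = map2 h (butlast xs) (tl xs)"

definition path_tensor ::
  "('o, 'm) multitensor_data \<Rightarrow> ('u, 'o) vgraph \<Rightarrow> 'u list \<Rightarrow> 'o" where
  "path_tensor E X xs = tob E (along (edge X) xs)"

definition Gamma_ob ::
  "('o, 'm) cat \<Rightarrow> ('o, 'm) multitensor_data \<Rightarrow> ('u, 'o) vgraph \<Rightarrow> ('u, 'o) vgraph" where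
  "Gamma_ob V E X =
     \<lparr>verts = verts X,
      edge = restrict2 (verts X) (\<lambda>a b. coprod V (paths X a b) (path_tensor E X))\<rparr>"

definition Gamma_incl ::
  "('o, 'm) cat \<Rightarrow> ('o, 'm) multitensor_data \<Rightarrow> ('u, 'o) vgraph \<Rightarrow> 'u list \<Rightarrow> 'm" where
  "Gamma_incl V E X xs = incl V (paths X (hd xs) (last xs)) (path_tensor E X) xs"

definition Gamma_ar ::
  "('o, 'm) cat \<Rightarrow> ('o, 'm) multitensor_data \<Rightarrow> ('u, 'o, 'm) gmap \<Rightarrow> ('u, 'o, 'm) gmap" where
  "Gamma_ar V E f =
     \<lparr>gsrc = Gamma_ob V E (gsrc f),
      gtgt = Gamma_ob V E (gtgt f),
      gobj = gobj f,
      ghom = restrict2 (verts (gsrc f)) (\<lambda>a b.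
        cotuple V (paths (gsrc f) a b) (path_tensor E (gsrc f))
          (edge (Gamma_ob V E (gtgt f)) (gobj f a) (gobj f b))
          (\<lambda>xs. Gamma_incl V E (gtgt f) (map (gobj f) xs) \<cdot>\<^bsub>V\<^esub> tar E (along (ghom f) xs)))\<rparr>"

definition Gamma_eta ::
  "('o, 'm) cat \<Rightarrow> ('o, 'm) multitensor_data \<Rightarrow> ('u, 'o) vgraph \<Rightarrow> ('u, 'o, 'm) gmap" where
  "Gamma_eta V E X =
     \<lparr>gsrc = X,
      gtgt = Gamma_ob V E X,
      gobj = (\<lambda>a \<in> verts X. a),
      ghom = restrict2 (verts X) (\<lambda>a b. Gamma_incl V E X [a, b] \<cdot>\<^bsub>V\<^esub> tunit E (edge X a b))\<rparr>"

text \<open>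
  A summand of the two-fold construct is given by a path \<open>ys = [y\<^sub>0, \<dots>, y\<^sub>k]\<close> and a list \<open>ps\<close> of
  paths, the one in position \<open>i\<close> leading from \<open>ys ! i\<close> to \<open>ys ! Suc i\<close>. By distributivity the maps
  \<open>Gamma_incl V E (Gamma_ob V E X) ys \<cdot> tar E (map (Gamma_incl V E X) ps)\<close> form a coproduct cocone,
  so that the description below determines a unique map.
\<close>

definition path_families :: "('u, 'o) vgraph \<Rightarrow> 'u list \<Rightarrow> 'u list list set" where
  "path_families X ys =
     {ps. Suc (length ps) = length ys \<and> (\<forall>i < length ps. ps ! i \<in> paths X (ys ! i) (ys ! Suc i))}"

definition Gamma_mu ::
  "('o, 'm) cat \<Rightarrow> ('o, 'm) multitensor_data \<Rightarrow> ('u, 'o) vgraph \<Rightarrow> ('u, 'o, 'm) gmap" where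
  "Gamma_mu V E X =
     \<lparr>gsrc = Gamma_ob V E (Gamma_ob V E X),
      gtgt = Gamma_ob V E X,
      gobj = (\<lambda>a \<in> verts X. a),
      ghom = restrict2 (verts X) (\<lambda>a b.
        THE h. h \<in> hom V (edge (Gamma_ob V E (Gamma_ob V E X)) a b) (edge (Gamma_ob V E X) a b) \<and>
          (\<forall>ys \<in> paths X a b. \<forall>ps \<in> path_families X ys.
             h \<cdot>\<^bsub>V\<^esub> (Gamma_incl V E (Gamma_ob V E X) ys \<cdot>\<^bsub>V\<^esub> tar E (map (Gamma_incl V E X) ps)) =
             Gamma_incl V E X (a # concat (map tl ps)) \<cdot>\<^bsub>V\<^esub> tsub E (map (along (edge X)) ps)))\<rparr>"

definition Gamma ::
  "('o, 'm) cat \<Rightarrow> ('o, 'm) multitensor_data \<Rightarrow> (('u, 'o) vgraph, ('u, 'o, 'm) gmap) monad_data"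
  where
  "Gamma V E =
     \<lparr>mob = Gamma_ob V E, mar = Gamma_ar V E, eta = Gamma_eta V E, mu = Gamma_mu V E\<rparr>"

section \<open>From monads to multitensors\<close>

text \<open>The objects \<open>0, 1, \<dots>\<close> of sequence graphs have to be elements of the type \<open>'u\<close>.\<close>

definition vertex :: "nat \<Rightarrow> 'u" where
  "vertex = (SOME v. inj v)"

definition seq_graph :: "('o, 'm) cat \<Rightarrow> 'o list \<Rightarrow> ('u, 'o) vgraph" where
  "seq_graph V Zs =
     \<lparr>verts = vertex ` {0..length Zs},
      edge = restrict2 (vertex ` {0..length Zs}) (\<lambda>a b.
        let i = inv vertex a; j = inv vertex b in if j = Suc i then Zs ! i else initial V)\<rparr>"

text \<open>
  The graph map out of \<open>seq_graph V Zs\<close> that sends \<open>vertex i\<close> to \<open>p i\<close> and has hom map \<open>gs ! i\<close>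
  from \<open>vertex i\<close> to \<open>vertex (Suc i)\<close>; the other hom maps have initial source.
\<close>

definition seq_map ::
  "('o, 'm) cat \<Rightarrow> 'o list \<Rightarrow> ('u, 'o) vgraph \<Rightarrow> (nat \<Rightarrow> 'u) \<Rightarrow> 'm list \<Rightarrow> ('u, 'o, 'm) gmap" where
  "seq_map V Zs Y p gs =
     \<lparr>gsrc = seq_graph V Zs,
      gtgt = Y,
      gobj = (\<lambda>a \<in> vertex ` {0..length Zs}. p (inv vertex a)),
      ghom = restrict2 (vertex ` {0..length Zs}) (\<lambda>a b.
        let i = inv vertex a; j = inv vertex b
        in if j = Suc i then gs ! i else from_initial V (edge Y (p i) (p j)))\<rparr>"

definition bar_ob ::
  "('o, 'm) cat \<Rightarrow> (('u, 'o) vgraph, ('u, 'o, 'm) gmap) monad_data \<Rightarrow> 'o list \<Rightarrow> 'o" where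
  "bar_ob V T Zs = edge (mob T (seq_graph V Zs)) (vertex 0) (vertex (length Zs))"

definition bar_ar ::
  "('o, 'm) cat \<Rightarrow> (('u, 'o) vgraph, ('u, 'o, 'm) gmap) monad_data \<Rightarrow> 'm list \<Rightarrow> 'm" where
  "bar_ar V T fs =
     ghom (mar T (seq_map V (map (Dom V) fs) (seq_graph V (map (Cod V) fs)) vertex fs))
       (vertex 0) (vertex (length fs))"

definition bar_unit ::
  "('o, 'm) cat \<Rightarrow> (('u, 'o) vgraph, ('u, 'o, 'm) gmap) monad_data \<Rightarrow> 'o \<Rightarrow> 'm" where
  "bar_unit V T Z = ghom (eta T (seq_graph V [Z])) (vertex 0) (vertex 1)"

definition offset :: "'o list list \<Rightarrow> nat \<Rightarrow> nat" where
  "offset Zss i = length (concat (take i Zss))"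

definition subseq_map :: "('o, 'm) cat \<Rightarrow> 'o list list \<Rightarrow> nat \<Rightarrow> ('u, 'o, 'm) gmap" where
  "subseq_map V Zss i =
     seq_map V (Zss ! i) (seq_graph V (concat Zss)) (\<lambda>j. vertex (offset Zss i + j))
       (map (ident V) (Zss ! i))"

definition tau_map ::
  "('o, 'm) cat \<Rightarrow> (('u, 'o) vgraph, ('u, 'o, 'm) gmap) monad_data \<Rightarrow> 'o list list \<Rightarrow>
   ('u, 'o, 'm) gmap" where
  "tau_map V T Zss =
     seq_map V (map (bar_ob V T) Zss) (mob T (seq_graph V (concat Zss)))
       (\<lambda>i. vertex (offset Zss i))
       (map (\<lambda>i. ghom (mar T (subseq_map V Zss i)) (vertex 0) (vertex (length (Zss ! i))))
          [0..<length Zss])"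

definition bar_sub ::
  "('u set \<Rightarrow> bool) \<Rightarrow> ('o, 'm) cat \<Rightarrow> (('u, 'o) vgraph, ('u, 'o, 'm) gmap) monad_data \<Rightarrow>
   'o list list \<Rightarrow> 'm" where
  "bar_sub small V T Zss =
     ghom (mu T (seq_graph V (concat Zss)) \<cdot>\<^bsub>graph_cat small V\<^esub> mar T (tau_map V T Zss))
       (vertex 0) (vertex (length Zss))"

definition bar ::
  "('u set \<Rightarrow> bool) \<Rightarrow> ('o, 'm) cat \<Rightarrow> (('u, 'o) vgraph, ('u, 'o, 'm) gmap) monad_data \<Rightarrow>
   ('o, 'm) multitensor_data" where
  "bar small V T =
     \<lparr>tob = bar_ob V T, tar = bar_ar V T, tunit = bar_unit V T, tsub = bar_sub small V T\<rparr>"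

definition is_distributive_monad ::
  "('u set \<Rightarrow> bool) \<Rightarrow> ('o, 'm) cat \<Rightarrow> (('u, 'o) vgraph, ('u, 'o, 'm) gmap) monad_data \<Rightarrow> bool"
  where
  "is_distributive_monad small V T \<longleftrightarrow> is_distributive_multitensor small V (bar small V T)"

definition path_map ::
  "('o, 'm) cat \<Rightarrow> ('u, 'o) vgraph \<Rightarrow> 'u list \<Rightarrow> ('u, 'o, 'm) gmap" where
  "path_map V X xs =
     seq_map V (along (edge X) xs) X (\<lambda>i. xs ! i) (map (ident V) (along (edge X) xs))"

definition pi_map ::
  "('o, 'm) cat \<Rightarrow> (('u, 'o) vgraph, ('u, 'o, 'm) gmap) monad_data \<Rightarrow>
   ('u, 'o) vgraph \<Rightarrow> 'u \<Rightarrow> 'u \<Rightarrow> 'm" where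
  "pi_map V T X a b =
     cotuple V (paths X a b) (\<lambda>xs. bar_ob V T (along (edge X) xs)) (edge (mob T X) a b)
       (\<lambda>xs. ghom (mar T (path_map V X xs)) (vertex 0) (vertex (length xs - 1)))"

definition is_path_like ::
  "('u set \<Rightarrow> bool) \<Rightarrow> ('o, 'm) cat \<Rightarrow> (('u, 'o) vgraph, ('u, 'o, 'm) gmap) monad_data \<Rightarrow> bool"
  where
  "is_path_like small V T \<longleftrightarrow>
     (\<forall>X. is_vgraph small V X \<longrightarrow>
        (\<forall>a \<in> verts X. \<forall>b \<in> verts X. is_iso V (pi_map V T X a b)))"

end

theory Submission imports Defs
begin

text \<open>
  For a path \<open>x\<close> from \<open>a\<close> to \<open>b\<close> in \<open>X\<close> let \<open>t\<^sub>x\<close> be the component at \<open>x\<close> of \<open>\<pi>\<close>. A graph map out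
  of a sequence is determined by its values on vertices and on consecutive homs; comparing such maps
  gives \<open>T f \<circ> t\<^sub>x = t\<^sub>f\<^sub>x \<circ> bar T (f)\<close> and, by naturality of \<open>\<mu>\<close>, for a path \<open>y\<close> and paths \<open>x\<^sub>i\<close> between
  consecutive vertices of \<open>y\<close>, with concatenation \<open>x\<close>, \<open>\<mu> \<circ> t\<^sub>y \<circ> bar T (t\<^sub>x\<^sub>i) = t\<^sub>x \<circ> bar \<mu>\<close>. So \<open>\<pi>\<close>
  respects the monad structures, and it is an isomorphism \<open>\<Gamma> (bar T) \<cong> T\<close> if \<open>T\<close> is distributive and
  path-like.

  Conversely let \<open>\<psi> : \<Gamma> E \<cong> T\<close>. In a sequence \<open>Z\<close> every path from \<open>0\<close> to \<open>n\<close> other than \<open>0, 1, \<dots>, n\<close> has a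
  step with initial hom, so distributivity makes \<open>E Z \<rightarrow> \<Gamma> E Z (0, n)\<close> invertible, and composing
  with \<open>\<psi>\<close> yields \<open>\<theta> : E \<cong> bar T\<close>. The identities above show that \<open>\<theta>\<close> respects units and
  substitutions, so the multitensor axioms and distributivity pass from \<open>E\<close> to \<open>bar T\<close>. Finally
  \<open>\<psi>\<close> after the inclusion at \<open>x\<close> is \<open>t\<^sub>x \<circ> \<theta>\<close>, so the \<open>t\<^sub>x\<close> form a coproduct cocone and \<open>T\<close> is
  path-like.
\<close>

section \<open>Categories and coproducts\<close>

text \<open>Paths are lists of vertices, whereas \<open>has_coproducts\<close> and distributivity
  speak only of index sets of type \<open>'u set\<close>. Every coproduct over paths is therefore
  reindexed along an injection of lists over a small set into \<open>'u\<close>, which exists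
  because an infinite set is equipotent with its square. The multitensor axioms for
  \<open>bar small V T\<close> are not derived from the monad axioms: in one direction they are
  contained in \<open>is_distributive_monad\<close>, in the other they are carried over from
  \<open>E\<close> along the invertible \<theta>. Likewise \<open>Gamma V E\<close> enters only
  through the typing of its data and its values on summands. The maps that can be computed on
  summands go from Gamma to \<open>T\<close>, against the direction of
  \<open>monads_over_Set_isomorphic small V T (Gamma V E)\<close>, so both implications invert an
  isomorphism of monads, and functoriality of \<open>T\<close> alone has to suffice for
  that.\<close>

lemma homD: "f \<in> hom C a b \<Longrightarrow> f \<in> Ar C \<and> Dom C f = a \<and> Cod C f = b"
  by (simp add: hom_def)

lemma homI: "f \<in> Ar C \<Longrightarrow> Dom C f = a \<Longrightarrow> Cod C f = b \<Longrightarrow> f \<in> hom C a b"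
  by (simp add: hom_def)

context category
begin

lemma Ar_hom: "f \<in> Ar C \<Longrightarrow> f \<in> hom C (Dom C f) (Cod C f)"
  by (simp add: hom_def)

lemma hom_Ob: "f \<in> hom C a b \<Longrightarrow> a \<in> Ob C \<and> b \<in> Ob C"
  using Dom_Ob Cod_Ob by (auto simp: hom_def)

lemma cmp_Ar:
  assumes "f \<in> Ar C" "g \<in> Ar C" "Dom C g = Cod C f"
  shows "g \<cdot> f \<in> Ar C" and "Dom C (g \<cdot> f) = Dom C f" and "Cod C (g \<cdot> f) = Cod C g"
  using cmp_hom[of f "Dom C f" "Cod C f" g "Cod C g"] assms by (auto simp: hom_def)

lemma cmp_assoc_Ar:
  assumes "f \<in> Ar C" "g \<in> Ar C" "h \<in> Ar C" "Dom C g = Cod C f" "Dom C h = Cod C g"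
  shows "(h \<cdot> g) \<cdot> f = h \<cdot> (g \<cdot> f)"
  using assms by (intro cmp_assoc) (auto simp: hom_def)

lemma ident_Ar:
  assumes "a \<in> Ob C"
  shows "ident C a \<in> Ar C" and "Dom C (ident C a) = a" and "Cod C (ident C a) = a"
  using ident_hom[OF assms] by (auto simp: hom_def)

lemma ident_left_Ar: "f \<in> Ar C \<Longrightarrow> Cod C f = b \<Longrightarrow> ident C b \<cdot> f = f"
  using ident_left[of f "Dom C f" b] by (auto simp: hom_def)

lemma ident_right_Ar: "f \<in> Ar C \<Longrightarrow> Dom C f = a \<Longrightarrow> f \<cdot> ident C a = f"
  using ident_right[of f a "Cod C f"] by (auto simp: hom_def)

text \<open>Associativity is oriented to the right and typing is expressed by equations for
  \<open>Dom\<close> and \<open>Cod\<close>, so the simplifier can discharge all side conditions.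
  Each diagram chase below collects the typings of its arrows in a fact \<open>H\<close> and
  supplies \<open>H[THEN homD]\<close>.\<close>

lemmas Ar_simps = cmp_Ar cmp_assoc_Ar Dom_Ob Cod_Ob ident_Ar ident_left_Ar ident_right_Ar

text \<open>In a right-associated composite \<open>g \<cdot> f\<close> is no longer a subterm once
  further factors follow \<open>f\<close>. This form lets a law about two composable arrows rewrite
  the middle of a longer chain.\<close>

lemma cmp_chain:
  assumes "g \<cdot> f = h" "f \<in> Ar C" "g \<in> Ar C" "k \<in> Ar C" "Dom C g = Cod C f" "Dom C f = Cod C k"
  shows "g \<cdot> (f \<cdot> k) = h \<cdot> k"
  using cmp_assoc_Ar[of k f g] assms by simp

lemma is_isoI:
  assumes "f \<in> hom C a b" "g \<in> hom C b a" "g \<cdot> f = ident C a" "f \<cdot> g = ident C b"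
  shows "is_iso C f"
  using assms by (auto simp: is_iso_def hom_def)

lemma is_isoE:
  assumes "is_iso C f" "f \<in> hom C a b"
  obtains g where "g \<in> hom C b a" "g \<cdot> f = ident C a" "f \<cdot> g = ident C b"
  using assms by (auto simp: is_iso_def hom_def)

lemma iso_cancel_right:
  assumes "is_iso C f" "f \<in> hom C a b" "g \<in> hom C b c" "h \<in> hom C b c" "g \<cdot> f = h \<cdot> f"
  shows "g = h"
proof -
  obtain k where k: "k \<in> hom C b a" "f \<cdot> k = ident C b" using assms(1,2) is_isoE by blast
  have "g \<cdot> (f \<cdot> k) = h \<cdot> (f \<cdot> k)"
    using cmp_assoc[OF k(1) assms(2)] assms(3,4,5) by metis
  then show ?thesis using k assms by (simp add: ident_right)
qed

lemma iso_cancel_left: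
  assumes "is_iso C f" "f \<in> hom C b c" "g \<in> hom C a b" "h \<in> hom C a b" "f \<cdot> g = f \<cdot> h"
  shows "g = h"
proof -
  obtain k where k: "k \<in> hom C c b" "k \<cdot> f = ident C b" using assms(1,2) is_isoE by blast
  have "(k \<cdot> f) \<cdot> g = (k \<cdot> f) \<cdot> h"
    using cmp_assoc[OF _ assms(2) k(1)] assms(3,4,5) by metis
  then show ?thesis using k assms by (simp add: ident_left)
qed

lemma iso_cmp:
  assumes "is_iso C f" "f \<in> hom C a b" "is_iso C g" "g \<in> hom C b c"
  shows "is_iso C (g \<cdot> f)"
proof -
  obtain f' where f': "f' \<in> hom C b a" "f' \<cdot> f = ident C a" "f \<cdot> f' = ident C b"
    using assms(1,2) is_isoE by blast
  obtain g' where g': "g' \<in> hom C c b" "g' \<cdot> g = ident C b" "g \<cdot> g' = ident C c"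
    using assms(3,4) is_isoE by blast
  note H = assms(2) assms(4) f'(1) g'(1)
  show ?thesis
  proof (rule is_isoI)
    show "g \<cdot> f \<in> hom C a c" "f' \<cdot> g' \<in> hom C c a" using assms f' g' cmp_hom by auto
    show "(f' \<cdot> g') \<cdot> (g \<cdot> f) = ident C a"
      using H[THEN homD] by (simp add: Ar_simps f' cmp_chain[OF g'(2)])
    show "(g \<cdot> f) \<cdot> (f' \<cdot> g') = ident C c"
      using H[THEN homD] by (simp add: Ar_simps g' cmp_chain[OF f'(3)])
  qed
qed

section \<open>Coproduct cocones: testing maps, reindexing, nesting, transport along
  isomorphisms\<close>

lemma coproduct_hom:
  assumes "is_coproduct C I Z c \<iota>"
  shows "c \<in> Ob C" "i \<in> I \<Longrightarrow> \<iota> i \<in> hom C (Z i) c" "i \<in> I \<Longrightarrow> Z i \<in> Ob C"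
  using assms by (auto simp: is_coproduct_def)

lemma coproduct_ex1:
  assumes "is_coproduct C I Z c \<iota>" "d \<in> Ob C" "\<And>i. i \<in> I \<Longrightarrow> g i \<in> hom C (Z i) d"
  shows "\<exists>!h. h \<in> hom C c d \<and> (\<forall>i \<in> I. h \<cdot> \<iota> i = g i)"
  using assms unfolding is_coproduct_def by blast

lemma coproduct_ex:
  assumes "is_coproduct C I Z c \<iota>" "d \<in> Ob C" "\<And>i. i \<in> I \<Longrightarrow> g i \<in> hom C (Z i) d"
  obtains h where "h \<in> hom C c d" "\<And>i. i \<in> I \<Longrightarrow> h \<cdot> \<iota> i = g i"
  using coproduct_ex1[OF assms] by blast

lemma coproduct_eqI:
  assumes c: "is_coproduct C I Z c \<iota>" and h: "h \<in> hom C c d" "h' \<in> hom C c d"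
    and "\<And>i. i \<in> I \<Longrightarrow> h \<cdot> \<iota> i = h' \<cdot> \<iota> i"
  shows "h = h'"
proof -
  have "\<exists>!k. k \<in> hom C c d \<and> (\<forall>i\<in>I. k \<cdot> \<iota> i = h \<cdot> \<iota> i)"
    using h(1) hom_Ob by (intro coproduct_ex1[OF c] cmp_hom[OF coproduct_hom(2)[OF c]]) auto
  then show ?thesis using assms(2-4) by metis
qed

lemma is_coproductI:
  assumes "c \<in> Ob C" "\<And>i. i \<in> I \<Longrightarrow> \<iota> i \<in> hom C (Z i) c"
    and "\<And>d g. d \<in> Ob C \<Longrightarrow> (\<And>i. i \<in> I \<Longrightarrow> g i \<in> hom C (Z i) d) \<Longrightarrow>
      \<exists>h \<in> hom C c d. \<forall>i \<in> I. h \<cdot> \<iota> i = g i"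
    and "\<And>d h h'. h \<in> hom C c d \<Longrightarrow> h' \<in> hom C c d \<Longrightarrow>
      (\<And>i. i \<in> I \<Longrightarrow> h \<cdot> \<iota> i = h' \<cdot> \<iota> i) \<Longrightarrow> h = h'"
  shows "is_coproduct C I Z c \<iota>"
  unfolding is_coproduct_def
proof (intro conjI ballI allI impI)
  show "c \<in> Ob C" by fact
  show "Z i \<in> Ob C" "\<iota> i \<in> hom C (Z i) c" if "i \<in> I" for i
    using assms(2)[OF that] hom_Ob by auto
  fix d g assume d: "d \<in> Ob C" and g: "\<forall>i\<in>I. g i \<in> hom C (Z i) d"
  obtain h where h: "h \<in> hom C c d" "\<forall>i \<in> I. h \<cdot> \<iota> i = g i" using assms(3)[OF d, of g] g by blast
  show "\<exists>!h. h \<in> hom C c d \<and> (\<forall>i\<in>I. h \<cdot> \<iota> i = g i)"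
  proof (rule ex1I[of _ h])
    fix k assume k: "k \<in> hom C c d \<and> (\<forall>i\<in>I. k \<cdot> \<iota> i = g i)"
    show "k = h" by (rule assms(4)[of k d h]) (use h k in simp_all)
  qed (use h in blast)
qed

lemma is_coproduct_cong:
  assumes "is_coproduct C I Z c \<iota>" "\<And>i. i \<in> I \<Longrightarrow> Z' i = Z i" "\<And>i. i \<in> I \<Longrightarrow> \<iota>' i = \<iota> i"
  shows "is_coproduct C I Z' c \<iota>'"
  using assms unfolding is_coproduct_def by simp

text \<open>This is the passage between coproducts indexed by lists of vertices and coproducts
  indexed by elements of \<open>'u\<close>.\<close>

lemma is_coproduct_reindex:
  assumes "is_coproduct C I Z c \<iota>" "bij_betw f J I"
  shows "is_coproduct C J (\<lambda>j. Z (f j)) c (\<lambda>j. \<iota> (f j))"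
proof (rule is_coproductI)
  have f: "f j \<in> I" if "j \<in> J" for j using assms(2) that by (auto simp: bij_betw_def)
  have inv: "the_inv_into J f i \<in> J" "f (the_inv_into J f i) = i" if "i \<in> I" for i
    using assms(2) that by (auto simp: bij_betw_def the_inv_into_into f_the_inv_into_f)
  have inv': "the_inv_into J f (f j) = j" if "j \<in> J" for j
    using assms(2) that by (auto simp: bij_betw_def the_inv_into_f_f)
  show "c \<in> Ob C" and "\<And>j. j \<in> J \<Longrightarrow> \<iota> (f j) \<in> hom C (Z (f j)) c"
    using coproduct_hom[OF assms(1)] f by auto
  show "\<exists>h\<in>hom C c d. \<forall>j\<in>J. h \<cdot> \<iota> (f j) = g j"
    if "d \<in> Ob C" "\<And>j. j \<in> J \<Longrightarrow> g j \<in> hom C (Z (f j)) d" for d g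
  proof -
    have "g (the_inv_into J f i) \<in> hom C (Z i) d" if "i \<in> I" for i
      using \<open>\<And>j. j \<in> J \<Longrightarrow> g j \<in> _\<close>[OF inv(1)[OF that]] inv(2)[OF that] by simp
    then obtain h where "h \<in> hom C c d" "\<And>i. i \<in> I \<Longrightarrow> h \<cdot> \<iota> i = g (the_inv_into J f i)"
      using coproduct_ex[OF assms(1) \<open>d \<in> Ob C\<close>, of "\<lambda>i. g (the_inv_into J f i)"] by auto
    then show ?thesis using f inv' by (intro bexI[of _ h]) auto
  qed
  show "h = h'" if "h \<in> hom C c d" "h' \<in> hom C c d" "\<And>j. j \<in> J \<Longrightarrow> h \<cdot> \<iota> (f j) = h' \<cdot> \<iota> (f j)"
    for d h h'
    using coproduct_eqI[OF assms(1) that(1,2)] that(3) inv by metis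
qed

text \<open>A map out of \<open>c\<close> is a family of maps out of the \<open>Z i\<close>, and
  each of these is a family of maps out of the \<open>W i j\<close>. The inner index set may depend
  on the outer index, as for families of paths lying over a path.\<close>

lemma is_coproduct_Sigma:
  assumes c: "is_coproduct C I Z c \<iota>"
    and Z: "\<And>i. i \<in> I \<Longrightarrow> is_coproduct C (J i) (W i) (Z i) (\<kappa> i)"
  shows "is_coproduct C (Sigma I J) (\<lambda>(i, j). W i j) c (\<lambda>(i, j). \<iota> i \<cdot> \<kappa> i j)"
proof (rule is_coproductI)
  show "c \<in> Ob C" using coproduct_hom[OF c] by simp
  show "(case p of (i, j) \<Rightarrow> \<iota> i \<cdot> \<kappa> i j) \<in> hom C (case p of (i, j) \<Rightarrow> W i j) c"
    if "p \<in> Sigma I J" for p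
    using that coproduct_hom(2)[OF c] coproduct_hom(2)[OF Z] cmp_hom by fastforce
  show "\<exists>h\<in>hom C c d. \<forall>p\<in>Sigma I J. h \<cdot> (case p of (i, j) \<Rightarrow> \<iota> i \<cdot> \<kappa> i j) = g p"
    if d: "d \<in> Ob C" and g: "\<And>p. p \<in> Sigma I J \<Longrightarrow> g p \<in> hom C (case p of (i, j) \<Rightarrow> W i j) d" for d g
  proof -
    have "\<exists>k. k \<in> hom C (Z i) d \<and> (\<forall>j \<in> J i. k \<cdot> \<kappa> i j = g (i, j))" if "i \<in> I" for i
    proof -
      have "g (i, j) \<in> hom C (W i j) d" if "j \<in> J i" for j using g[of "(i, j)"] that \<open>i \<in> I\<close> by auto
      then show ?thesis using coproduct_ex[OF Z[OF that] d, of "\<lambda>j. g (i, j)"] by metis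
    qed
    then obtain k where k: "\<And>i. i \<in> I \<Longrightarrow> k i \<in> hom C (Z i) d"
      "\<And>i j. i \<in> I \<Longrightarrow> j \<in> J i \<Longrightarrow> k i \<cdot> \<kappa> i j = g (i, j)" by metis
    obtain h where h: "h \<in> hom C c d" "\<And>i. i \<in> I \<Longrightarrow> h \<cdot> \<iota> i = k i"
      using coproduct_ex[OF c d, of k] k(1) by auto
    have "h \<cdot> (\<iota> i \<cdot> \<kappa> i j) = g (i, j)" if "i \<in> I" "j \<in> J i" for i j
      using cmp_assoc[OF coproduct_hom(2)[OF Z] coproduct_hom(2)[OF c] h(1)] that h(2) k(2) by metis
    then show ?thesis using h(1) by (intro bexI[of _ h]) auto
  qed
  show "h = h'" if h: "h \<in> hom C c d" "h' \<in> hom C c d"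
    and eq: "\<And>p. p \<in> Sigma I J \<Longrightarrow> h \<cdot> (case p of (i, j) \<Rightarrow> \<iota> i \<cdot> \<kappa> i j) = h' \<cdot> (case p of (i, j) \<Rightarrow> \<iota> i \<cdot> \<kappa> i j)"
    for d h h'
  proof (rule coproduct_eqI[OF c h])
    fix i assume i: "i \<in> I"
    note \<iota>i = coproduct_hom(2)[OF c i]
    show "h \<cdot> \<iota> i = h' \<cdot> \<iota> i"
    proof (rule coproduct_eqI[OF Z[OF i] cmp_hom[OF \<iota>i h(1)] cmp_hom[OF \<iota>i h(2)]])
      fix j assume j: "j \<in> J i"
      show "(h \<cdot> \<iota> i) \<cdot> \<kappa> i j = (h' \<cdot> \<iota> i) \<cdot> \<kappa> i j"
        using eq[of "(i, j)"] i j h \<iota>i coproduct_hom(2)[OF Z[OF i] j] by (simp add: cmp_assoc)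
    qed
  qed
qed

text \<open>Induced maps are obtained by conjugating with the isomorphisms \<open>k i\<close> and
  \<open>f\<close>. Distributivity of the induced multitensor and path-likeness are both derived by
  carrying a known cocone over in this way.\<close>

lemma is_coproduct_iso:
  assumes c: "is_coproduct C I Z c \<iota>" and f: "is_iso C f" "f \<in> hom C c c'"
    and k: "\<And>i. i \<in> I \<Longrightarrow> is_iso C (k i)" "\<And>i. i \<in> I \<Longrightarrow> k i \<in> hom C (Z i) (Z' i)"
    and \<iota>': "\<And>i. i \<in> I \<Longrightarrow> \<iota>' i \<in> hom C (Z' i) c'" "\<And>i. i \<in> I \<Longrightarrow> \<iota>' i \<cdot> k i = f \<cdot> \<iota> i"
  shows "is_coproduct C I Z' c' \<iota>'"
proof (rule is_coproductI)
  obtain f' where f': "f' \<in> hom C c' c" "f' \<cdot> f = ident C c" "f \<cdot> f' = ident C c'"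
    using f is_isoE by blast
  show "c' \<in> Ob C" "\<And>i. i \<in> I \<Longrightarrow> \<iota>' i \<in> hom C (Z' i) c'" using \<iota>' f hom_Ob by auto
  show "\<exists>h\<in>hom C c' d. \<forall>i\<in>I. h \<cdot> \<iota>' i = g i"
    if d: "d \<in> Ob C" and g: "\<And>i. i \<in> I \<Longrightarrow> g i \<in> hom C (Z' i) d" for d g
  proof -
    obtain h where h: "h \<in> hom C c d" "\<And>i. i \<in> I \<Longrightarrow> h \<cdot> \<iota> i = g i \<cdot> k i"
      using coproduct_ex[OF c d, of "\<lambda>i. g i \<cdot> k i"] g k(2) cmp_hom by metis
    have hf: "h \<cdot> f' \<in> hom C c' d" using h f' cmp_hom by blast
    have "(h \<cdot> f') \<cdot> \<iota>' i = g i" if i: "i \<in> I" for i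
    proof (rule iso_cancel_right[OF k(1,2)[OF i] cmp_hom[OF \<iota>'(1)[OF i] hf] g[OF i]])
      note H = h(1) f(2) f'(1) k(2)[OF i] \<iota>'(1)[OF i] coproduct_hom(2)[OF c i]
      show "((h \<cdot> f') \<cdot> \<iota>' i) \<cdot> k i = g i \<cdot> k i"
        using H[THEN homD] by (simp add: Ar_simps \<iota>'(2)[OF i] cmp_chain[OF f'(2)] h(2)[OF i])
    qed
    then show ?thesis using hf by blast
  qed
  show "h = h'" if h: "h \<in> hom C c' d" "h' \<in> hom C c' d"
    and eq: "\<And>i. i \<in> I \<Longrightarrow> h \<cdot> \<iota>' i = h' \<cdot> \<iota>' i" for d h h'
  proof (rule iso_cancel_right[OF f h])
    show "h \<cdot> f = h' \<cdot> f"
    proof (rule coproduct_eqI[OF c cmp_hom[OF f(2) h(1)] cmp_hom[OF f(2) h(2)]])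
      fix i assume i: "i \<in> I"
      note \<iota>i = coproduct_hom(2)[OF c i]
      have "(h \<cdot> f) \<cdot> \<iota> i = (h \<cdot> \<iota>' i) \<cdot> k i" "(h' \<cdot> f) \<cdot> \<iota> i = (h' \<cdot> \<iota>' i) \<cdot> k i"
        using cmp_assoc[OF \<iota>i f(2) h(1)] cmp_assoc[OF \<iota>i f(2) h(2)] \<iota>'(2)[OF i]
          cmp_assoc[OF k(2)[OF i] \<iota>'(1)[OF i] h(1)] cmp_assoc[OF k(2)[OF i] \<iota>'(1)[OF i] h(2)] by auto
      then show "(h \<cdot> f) \<cdot> \<iota> i = (h' \<cdot> f) \<cdot> \<iota> i" using eq[OF i] by simp
    qed
  qed
qed

text \<open>Serves as the case of no variables when distributivity is applied to all variables of a
  tensor.\<close>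

lemma is_coproduct_ident:
  assumes "Z i0 = c" "\<iota> i0 = ident C c" "c \<in> Ob C"
  shows "is_coproduct C {i0} Z c \<iota>"
proof (rule is_coproductI)
  show "c \<in> Ob C" by fact
  show "\<iota> i \<in> hom C (Z i) c" if "i \<in> {i0}" for i using that assms ident_hom by simp
  show "\<exists>h\<in>hom C c d. \<forall>i\<in>{i0}. h \<cdot> \<iota> i = g i" if "\<And>i. i \<in> {i0} \<Longrightarrow> g i \<in> hom C (Z i) d" for d g
    using that[of i0] assms by (intro bexI[of _ "g i0"]) (simp_all add: ident_right)
  show "h = h'" if "h \<in> hom C c d" "h' \<in> hom C c d" "\<And>i. i \<in> {i0} \<Longrightarrow> h \<cdot> \<iota> i = h' \<cdot> \<iota> i" for d h h'
    using that(3)[of i0] that(1,2) assms by (simp add: ident_right)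
qed

lemma initial_eqI: "is_initial C z \<Longrightarrow> f \<in> hom C z d \<Longrightarrow> g \<in> hom C z d \<Longrightarrow> f = g"
  using hom_Ob unfolding is_initial_def by blast

text \<open>Through this reading, preservation of coproducts in one variable includes preservation
  of initial objects; over the empty index set \<open>Z\<close> and \<open>\<iota>\<close> are
  arbitrary.\<close>

lemma is_initial_iff_coproduct: "is_initial C c \<longleftrightarrow> is_coproduct C {} Z c \<iota>"
  by (simp add: is_initial_def is_coproduct_def)

text \<open>The inverse \<open>h\<close> is induced by the identity on \<open>Z i0\<close> and by
  the maps out of the initial summands. That \<open>\<iota> i0 \<cdot> h\<close> is the identity is
  tested on summands: on \<open>i0\<close> by construction, elsewhere because the source is
  initial.\<close>

lemma coproduct_incl_iso:
  assumes c: "is_coproduct C I Z c \<iota>" and i0: "i0 \<in> I"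
    and other: "\<And>i. i \<in> I \<Longrightarrow> i \<noteq> i0 \<Longrightarrow> is_initial C (Z i)"
  shows "is_iso C (\<iota> i0)"
proof -
  note \<iota> = coproduct_hom[OF c]
  define g where "g i = (if i = i0 then ident C (Z i0) else (SOME k. k \<in> hom C (Z i) (Z i0)))" for i
  have "g i \<in> hom C (Z i) (Z i0)" if "i \<in> I" for i
  proof (cases "i = i0")
    case False
    then have "\<exists>k. k \<in> hom C (Z i) (Z i0)" using other[OF that] \<iota>(3)[OF i0] unfolding is_initial_def by blast
    then show ?thesis using False by (simp add: g_def) (erule someI_ex)
  qed (use \<iota>(3) i0 ident_hom in \<open>simp add: g_def\<close>)
  then obtain h where h: "h \<in> hom C c (Z i0)" "\<And>i. i \<in> I \<Longrightarrow> h \<cdot> \<iota> i = g i"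
    using coproduct_ex[OF c \<iota>(3)[OF i0], of g] by auto
  have "\<iota> i0 \<cdot> h = ident C c"
  proof (rule coproduct_eqI[OF c cmp_hom[OF h(1) \<iota>(2)[OF i0]] ident_hom[OF \<iota>(1)]])
    fix i assume i: "i \<in> I"
    show "(\<iota> i0 \<cdot> h) \<cdot> \<iota> i = ident C c \<cdot> \<iota> i"
    proof (cases "i = i0")
      case True
      then show ?thesis using cmp_assoc[OF \<iota>(2)[OF i] h(1) \<iota>(2)[OF i0]] h(2)[OF i0]
          ident_left[OF \<iota>(2)[OF i0]] ident_right[OF \<iota>(2)[OF i0]]
        by (simp add: g_def)
    next
      case False
      then show ?thesis
        using cmp_hom[OF \<iota>(2)[OF i] cmp_hom[OF h(1) \<iota>(2)[OF i0]]] cmp_hom[OF \<iota>(2)[OF i] ident_hom[OF \<iota>(1)]]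
        by (rule initial_eqI[OF other[OF i]])
    qed
  qed
  then show ?thesis using is_isoI[OF \<iota>(2)[OF i0] h(1)] h(2)[OF i0] by (simp add: g_def)
qed

end

section \<open>Small index sets\<close>

context smallness
begin

text \<open>A small infinite set has subsets of every finite cardinality, and images of small sets
  are small.\<close>

lemma small_finite: assumes "finite A" shows "small A"
proof -
  obtain B where B: "small B" "infinite B" using ex_infinite by blast
  then obtain B' where "B' \<subseteq> B" "finite B'" "card B' = card A"
    using infinite_arbitrarily_large[of B "card A"] by blast
  then obtain f where "f ` B' = A"
    using assms finite_same_card_bij[of B' A] by (auto simp: bij_betw_def)
  then show ?thesis using small_image[OF small_subset[OF B(1) \<open>B' \<subseteq> B\<close>], of f] by simp
qed

lemma infinite_UNIV: "infinite (UNIV :: 'u set)"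
  using ex_infinite finite_subset[OF subset_UNIV] by blast

text \<open>A binary union is a union over a two-element index set, realised inside
  \<open>'u\<close> as \<open>{u, undefined}\<close>.\<close>

lemma small_Un: assumes "small A" "small B" shows "small (A \<union> B)"
proof -
  obtain u :: 'u where "u \<noteq> undefined" using ex_new_if_finite[OF infinite_UNIV, of "{undefined}"] by auto
  then have "A \<union> B = \<Union> ((\<lambda>w. if w = u then A else B) ` {u, undefined})" by (simp add: Un_commute)
  moreover have "small (\<Union> ((\<lambda>w. if w = u then A else B) ` {u, undefined}))"
    using assms by (intro small_UN small_finite[of "{u, undefined}"]) simp_all
  ultimately show ?thesis by (simp only:)
qed

end

text \<open>Iterating a bijection of \<open>C \<times> C\<close> with \<open>C\<close> codes the
  lists of any one length injectively, but the code \<open>e\<close> may identify lists of different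
  lengths. The length is therefore recorded in a separate component, as an element
  \<open>s n\<close> of a countable subset of \<open>C\<close>.\<close>

lemma infinite_lists_inj:
  assumes "infinite (C :: 'a set)"
  obtains e :: "'a list \<Rightarrow> 'a" where "inj_on e (lists C)" "e ` lists C \<subseteq> C"
proof -
  obtain p :: "'a \<times> 'a \<Rightarrow> 'a" where p: "bij_betw p (C \<times> C) C"
    using card_of_Times_same_infinite[OF assms] card_of_ordIso by blast
  obtain s :: "nat \<Rightarrow> 'a" where s: "inj s" "range s \<subseteq> C"
    using infinite_countable_subset[OF assms] by blast
  have pC: "p (x, y) \<in> C" if "x \<in> C" "y \<in> C" for x y
    using p that by (auto simp: bij_betw_def)
  have p_inj: "x = x' \<and> y = y'" if "p (x, y) = p (x', y')" "x \<in> C" "y \<in> C" "x' \<in> C" "y' \<in> C"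
    for x y x' y'
    using p that by (auto simp: bij_betw_def inj_on_def)
  define e where "e = rec_list (s 0) (\<lambda>x _ y. p (x, y))"
  have e: "e [] = s 0" "e (x # xs) = p (x, e xs)" for x xs by (simp_all add: e_def)
  have eC: "e xs \<in> C" if "xs \<in> lists C" for xs using that s by (induction xs) (auto simp: e pC)
  have e_inj: "xs = ys" if "length xs = length ys" "e xs = e ys" "xs \<in> lists C" "ys \<in> lists C" for xs ys
    using that
  proof (induction rule: list_induct2)
    case (Cons x xs y ys)
    then have "x = y \<and> e xs = e ys" by (intro p_inj) (simp_all add: e eC)
    then show ?case using Cons by simp
  qed simp
  show ?thesis
  proof (rule that[of "\<lambda>xs. p (s (length xs), e xs)"])
    show "inj_on (\<lambda>xs. p (s (length xs), e xs)) (lists C)"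
    proof (rule inj_onI)
      fix xs ys assume H: "xs \<in> lists C" "ys \<in> lists C" "p (s (length xs), e xs) = p (s (length ys), e ys)"
      then have "s (length xs) = s (length ys) \<and> e xs = e ys" using s eC by (intro p_inj) auto
      then show "xs = ys" using e_inj H s by (auto dest: injD)
    qed
    show "(\<lambda>xs. p (s (length xs), e xs)) ` lists C \<subseteq> C" using s by (auto intro!: pC eC)
  qed
qed

text \<open>The set \<open>A\<close> may be finite while \<open>P\<close> is infinite, so a small
  infinite set \<open>B\<close> is adjoined before lists are coded; the code then lands in the small
  set \<open>A \<union> B\<close>.\<close>

lemma (in smallness) small_lists_bij:
  assumes "small A" "P \<subseteq> lists A"
  obtains e :: "'u list \<Rightarrow> 'u" where "bij_betw e P (e ` P)" "small (e ` P)"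
proof -
  obtain B where B: "small B" "infinite B" using ex_infinite by blast
  obtain e where e: "inj_on e (lists (A \<union> B))" "e ` lists (A \<union> B) \<subseteq> A \<union> B"
    using infinite_lists_inj[of "A \<union> B"] B by auto
  have P: "P \<subseteq> lists (A \<union> B)" by (rule order_trans[OF assms(2) lists_mono]) simp
  show ?thesis
  proof (rule that[of e])
    show "bij_betw e P (e ` P)" using inj_on_subset[OF e(1) P] by (simp add: bij_betw_def)
    show "small (e ` P)"
      by (rule small_subset[OF small_Un[OF assms(1) B(1)] order_trans[OF image_mono[OF P] e(2)]])
  qed
qed

section \<open>The category of enriched graphs\<close>

locale coproduct_category = category V + smallness small
  for V :: "('o, 'm) cat" (structure) and small :: "'u set \<Rightarrow> bool" +
  assumes coproducts: "has_coproducts small V"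
begin

abbreviation G :: "(('u, 'o) vgraph, ('u, 'o, 'm) gmap) cat" where
  "G \<equiv> graph_cat small V"

abbreviation graph_cmp :: "('u, 'o, 'm) gmap \<Rightarrow> ('u, 'o, 'm) gmap \<Rightarrow> ('u, 'o, 'm) gmap" (infixr "\<star>" 70) where
  "g \<star> f \<equiv> g \<cdot>\<^bsub>G\<^esub> f"

abbreviation vgraph :: "('u, 'o) vgraph \<Rightarrow> bool" where
  "vgraph \<equiv> is_vgraph small V"

lemma graph_hom_iff:
  "f \<in> hom G X Y \<longleftrightarrow> vgraph X \<and> vgraph Y \<and> gsrc f = X \<and> gtgt f = Y \<and>
     gobj f \<in> verts X \<rightarrow>\<^sub>E verts Y \<and>
     (\<forall>a \<in> verts X. \<forall>b \<in> verts X. ghom f a b \<in> hom V (edge X a b) (edge Y (gobj f a) (gobj f b))) \<and>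
     extensional2 (verts X) (ghom f)"
  unfolding hom_def[of G] by (auto simp: graph_cat_def is_gmap_def)

lemma Ob_G [simp]: "X \<in> Ob G \<longleftrightarrow> vgraph X"
  by (simp add: graph_cat_def)

lemma graph_homD:
  assumes "f \<in> hom G X Y"
  shows "vgraph X" "vgraph Y" "gsrc f = X" "gtgt f = Y"
    "a \<in> verts X \<Longrightarrow> gobj f a \<in> verts Y"
    "a \<in> verts X \<Longrightarrow> b \<in> verts X \<Longrightarrow> ghom f a b \<in> hom V (edge X a b) (edge Y (gobj f a) (gobj f b))"
  using assms by (auto simp: graph_hom_iff PiE_iff)

lemma vgraph_small: "vgraph X \<Longrightarrow> small (verts X)"
  by (simp add: is_vgraph_def)

lemma edge_Ob: "vgraph X \<Longrightarrow> a \<in> verts X \<Longrightarrow> b \<in> verts X \<Longrightarrow> edge X a b \<in> Ob V"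
  by (simp add: is_vgraph_def)

lemma gmap_eqI:
  assumes "f \<in> hom G X Y" "g \<in> hom G X Y" "\<And>a. a \<in> verts X \<Longrightarrow> gobj f a = gobj g a"
    and "\<And>a b. a \<in> verts X \<Longrightarrow> b \<in> verts X \<Longrightarrow> ghom f a b = ghom g a b"
  shows "f = g"
proof -
  have exts: "extensional2 (verts X) (ghom f)" "extensional2 (verts X) (ghom g)"
    and "gobj f \<in> verts X \<rightarrow>\<^sub>E verts Y" "gobj g \<in> verts X \<rightarrow>\<^sub>E verts Y"
    using assms(1,2) by (simp_all add: graph_hom_iff)
  then have "gobj f = gobj g" using assms(3) by (intro PiE_ext[of _ "verts X"])
  moreover have "ghom f = ghom g"
  proof (intro ext)
    fix a b
    show "ghom f a b = ghom g a b"
      using assms(4) exts by (cases "a \<in> verts X \<and> b \<in> verts X") (simp_all add: extensional2_def)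
  qed
  ultimately show ?thesis using graph_homD(3,4)[OF assms(1)] graph_homD(3,4)[OF assms(2)] by simp
qed

lemma ghom_G_cmp:
  assumes "f \<in> hom G X Y" "a \<in> verts X"
  shows "gobj (g \<star> f) a = gobj g (gobj f a)"
    and "b \<in> verts X \<Longrightarrow> ghom (g \<star> f) a b = ghom g (gobj f a) (gobj f b) \<cdot> ghom f a b"
  using graph_homD(3)[OF assms(1)] assms(2) by (simp_all add: graph_cat_def compose_def restrict2_def)

lemma ghom_G_ident:
  assumes "a \<in> verts X"
  shows "gobj (ident G X) a = a" and "b \<in> verts X \<Longrightarrow> ghom (ident G X) a b = ident V (edge X a b)"
  using assms by (auto simp: graph_cat_def restrict2_def)

lemma graph_homI:
  assumes "vgraph X" "vgraph Y" "gsrc f = X" "gtgt f = Y"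
    and "gobj f \<in> extensional (verts X)" "\<And>a. a \<in> verts X \<Longrightarrow> gobj f a \<in> verts Y"
    and "\<And>a b. a \<in> verts X \<Longrightarrow> b \<in> verts X \<Longrightarrow> ghom f a b \<in> hom V (edge X a b) (edge Y (gobj f a) (gobj f b))"
    and "extensional2 (verts X) (ghom f)"
  shows "f \<in> hom G X Y"
  using assms by (auto simp: graph_hom_iff PiE_def)

lemma extensional2_restrict2: "extensional2 A (restrict2 A h)"
  by (simp add: extensional2_def restrict2_def)

lemma restrict2_in: "a \<in> A \<Longrightarrow> b \<in> A \<Longrightarrow> restrict2 A h a b = h a b"
  by (simp add: restrict2_def)

sublocale G: category "graph_cat small V"
proof
  show ident: "ident G X \<in> hom G X X" if "X \<in> Ob G" for X
    using that by (intro graph_homI)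
      (auto simp: graph_cat_def restrict2_in extensional2_restrict2 intro: ident_hom edge_Ob)
  show cmp: "g \<star> f \<in> hom G X Z" if "f \<in> hom G X Y" "g \<in> hom G Y Z" for f g X Y Z
  proof (rule graph_homI)
    show "vgraph X" "vgraph Z" using that graph_homD by auto
    show "gsrc (g \<star> f) = X" "gtgt (g \<star> f) = Z"
      using graph_homD(3)[OF that(1)] graph_homD(4)[OF that(2)] by (simp_all add: graph_cat_def)
    show "gobj (g \<star> f) \<in> extensional (verts X)" "extensional2 (verts X) (ghom (g \<star> f))"
      using graph_homD(3)[OF that(1)] by (simp_all add: graph_cat_def extensional2_restrict2)
    show "gobj (g \<star> f) a \<in> verts Z" if "a \<in> verts X" for a
      using that graph_homD(5)[OF \<open>f \<in> _\<close>] graph_homD(5)[OF \<open>g \<in> _\<close>] by (simp add: ghom_G_cmp[OF \<open>f \<in> _\<close>])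
    show "ghom (g \<star> f) a b \<in> hom V (edge X a b) (edge Z (gobj (g \<star> f) a) (gobj (g \<star> f) b))"
      if "a \<in> verts X" "b \<in> verts X" for a b
      using cmp_hom[OF graph_homD(6)[OF \<open>f \<in> _\<close> that] graph_homD(6)[OF \<open>g \<in> _\<close>]] that
        graph_homD(5)[OF \<open>f \<in> _\<close>] by (simp add: ghom_G_cmp[OF \<open>f \<in> _\<close>])
  qed
  show "ident G Y \<star> f = f" if "f \<in> hom G X Y" for f X Y
    using graph_homD[OF that]
    by (intro gmap_eqI[OF cmp[OF that ident]] that)
      (auto simp: ghom_G_cmp[OF that] ghom_G_ident intro!: ident_left)
  show "f \<star> ident G X = f" if "f \<in> hom G X Y" for f X Y
    using graph_homD[OF that]
    by (intro gmap_eqI[OF cmp[OF ident that]] that)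
      (auto simp: ghom_G_cmp[OF ident] ghom_G_ident intro!: ident_right)
  show "(h \<star> g) \<star> f = h \<star> (g \<star> f)"
    if f: "f \<in> hom G X Y" and g: "g \<in> hom G Y Z" and h: "h \<in> hom G Z W" for f g h X Y Z W
  proof (rule gmap_eqI[OF cmp[OF f cmp[OF g h]] cmp[OF cmp[OF f g] h]])
    note simps = ghom_G_cmp[OF f] ghom_G_cmp[OF g] ghom_G_cmp[OF cmp[OF f g]] graph_homD(5)[OF f] graph_homD(5)[OF g]
    show "gobj ((h \<star> g) \<star> f) a = gobj (h \<star> (g \<star> f)) a" if "a \<in> verts X" for a
      using that by (simp add: simps)
    show "ghom ((h \<star> g) \<star> f) a b = ghom (h \<star> (g \<star> f)) a b"
      if "a \<in> verts X" "b \<in> verts X" for a b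
      using that by (simp add: simps cmp_assoc[OF graph_homD(6)[OF f] graph_homD(6)[OF g] graph_homD(6)[OF h]])
  qed
  show "Dom G f \<in> Ob G" "Cod G f \<in> Ob G" if "f \<in> Ar G" for f
    using that by (auto simp: graph_cat_def is_gmap_def)
qed

text \<open>Evaluating \<open>g \<star> f\<close> on vertices shows that an inverse \<open>g\<close>
  is again the identity on objects, so its hom maps invert those of \<open>f\<close>; conversely
  pointwise inverses assemble to a graph map. This links path-likeness, a condition on single homs,
  to invertibility in the category of graphs.\<close>

lemma graph_iso_over_Set_iff:
  assumes f: "f \<in> hom G X Y" and "gobj f = (\<lambda>a \<in> verts X. a)" "verts Y = verts X"
  shows "is_iso G f \<longleftrightarrow> (\<forall>a \<in> verts X. \<forall>b \<in> verts X. is_iso V (ghom f a b))"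
proof
  have obj: "gobj f a = a" if "a \<in> verts X" for a using that assms by simp
  note F = graph_homD[OF f]
  have hom_f: "ghom f a b \<in> hom V (edge X a b) (edge Y a b)" if "a \<in> verts X" "b \<in> verts X" for a b
    using F(6)[OF that] obj that by simp
  show "\<forall>a \<in> verts X. \<forall>b \<in> verts X. is_iso V (ghom f a b)" if iso: "is_iso G f"
  proof (intro ballI)
    fix a b assume ab: "a \<in> verts X" "b \<in> verts X"
    obtain g where g: "g \<in> hom G Y X" "g \<star> f = ident G X" "f \<star> g = ident G Y"
      using G.is_isoE[OF iso f] by blast
    have obj_g: "gobj g a = a" if "a \<in> verts X" for a
      using ghom_G_cmp(1)[OF f that, of g] ghom_G_ident(1)[OF that] g(2) obj that by simp
    show "is_iso V (ghom f a b)"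
    proof (rule is_isoI[OF hom_f[OF ab]])
      show "ghom g a b \<in> hom V (edge Y a b) (edge X a b)"
        using graph_homD(6)[OF g(1), of a b] obj_g assms(3) ab by simp
      show "ghom g a b \<cdot> ghom f a b = ident V (edge X a b)"
        using ghom_G_cmp(2)[OF f ab, of g] ghom_G_ident(2)[OF ab] g(2) obj ab by simp
      show "ghom f a b \<cdot> ghom g a b = ident V (edge Y a b)"
        using ghom_G_cmp(2)[OF g(1), of a b f] ghom_G_ident(2)[of a Y b] g(3) obj_g ab assms(3) by simp
    qed
  qed
  show "is_iso G f" if iso: "\<forall>a \<in> verts X. \<forall>b \<in> verts X. is_iso V (ghom f a b)"
  proof -
    have "\<exists>k. k \<in> hom V (edge Y a b) (edge X a b) \<and> k \<cdot> ghom f a b = ident V (edge X a b) \<and>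
        ghom f a b \<cdot> k = ident V (edge Y a b)" if "a \<in> verts X" "b \<in> verts X" for a b
      using is_isoE[OF _ hom_f[OF that]] iso that by metis
    then obtain k where k: "k a b \<in> hom V (edge Y a b) (edge X a b)"
      "k a b \<cdot> ghom f a b = ident V (edge X a b)" "ghom f a b \<cdot> k a b = ident V (edge Y a b)"
      if "a \<in> verts X" "b \<in> verts X" for a b by metis
    define g where "g = \<lparr>gsrc = Y, gtgt = X, gobj = (\<lambda>a \<in> verts X. a), ghom = restrict2 (verts X) k\<rparr>"
    have g: "g \<in> hom G Y X"
      using F k(1) assms(3) by (intro graph_homI) (auto simp: g_def restrict2_in extensional2_restrict2)
    have obj_g: "gobj g a = a" "b \<in> verts X \<Longrightarrow> ghom g a b = k a b" if "a \<in> verts X" for a b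
      using that by (auto simp: g_def restrict2_in)
    show ?thesis
    proof (rule G.is_isoI[OF f g])
      show "g \<star> f = ident G X"
        using F by (intro gmap_eqI[OF G.cmp_hom[OF f g] G.ident_hom])
          (auto simp: ghom_G_cmp[OF f] ghom_G_ident obj obj_g k)
      show "f \<star> g = ident G Y"
        using F by (intro gmap_eqI[OF G.cmp_hom[OF g f] G.ident_hom])
          (auto simp: ghom_G_cmp[OF g] ghom_G_ident assms(3) obj obj_g k)
    qed
  qed
qed

section \<open>Chosen coproducts over sets of lists and the chosen initial object\<close>

lemma is_coproduct_chosen:
  assumes "small A" "P \<subseteq> lists A" "\<And>p. p \<in> P \<Longrightarrow> Z p \<in> Ob V"
  shows "is_coproduct V P Z (coprod V P Z) (incl V P Z)"
proof -
  obtain e :: "'u list \<Rightarrow> 'u" where e: "bij_betw e P (e ` P)" "small (e ` P)"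
    using small_lists_bij[OF assms(1,2)] by blast
  have inv: "the_inv_into P e (e p) = p" if "p \<in> P" for p
    using e(1) that by (auto simp: bij_betw_def the_inv_into_f_f)
  have "\<forall>i \<in> e ` P. Z (the_inv_into P e i) \<in> Ob V" using inv assms(3) by auto
  then obtain c \<iota> where "is_coproduct V (e ` P) (\<lambda>i. Z (the_inv_into P e i)) c \<iota>"
    using coproducts e(2) unfolding has_coproducts_def by meson
  from is_coproduct_reindex[OF this e(1)]
  have "is_coproduct V P Z c (\<lambda>p. \<iota> (e p))"
    by (rule is_coproduct_cong) (simp_all add: inv)
  then have "case (c, \<lambda>p. \<iota> (e p)) of (c, \<iota>) \<Rightarrow> is_coproduct V P Z c \<iota>" by simp
  then have "case chosen_coproduct V P Z of (c, \<iota>) \<Rightarrow> is_coproduct V P Z c \<iota>"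
    unfolding chosen_coproduct_def by (rule someI)
  then show ?thesis by (simp add: coprod_def incl_def case_prod_unfold)
qed

lemma cotuple:
  assumes c: "is_coproduct V I Z (coprod V I Z) (incl V I Z)"
    and "d \<in> Ob V" "\<And>i. i \<in> I \<Longrightarrow> g i \<in> hom V (Z i) d"
  shows "cotuple V I Z d g \<in> hom V (coprod V I Z) d"
    and "i \<in> I \<Longrightarrow> cotuple V I Z d g \<cdot> incl V I Z i = g i"
  using theI'[OF coproduct_ex1[OF assms]] by (auto simp: cotuple_def)

lemma initial: "is_initial V (initial V)"
proof -
  have "small ({} :: 'u set)" by (simp add: small_finite)
  then obtain c \<iota> where "is_coproduct V ({} :: 'u set) undefined c \<iota>"
    using coproducts unfolding has_coproducts_def by blast
  then have "is_initial V c" by (simp add: is_initial_def is_coproduct_def)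
  then show ?thesis unfolding initial_def by (rule someI)
qed

lemma from_initial_hom: "d \<in> Ob V \<Longrightarrow> from_initial V d \<in> hom V (initial V) d"
  using initial unfolding is_initial_def from_initial_def by (metis theI')

section \<open>Sequences as graphs\<close>

text \<open>The choice in \<open>vertex\<close> succeeds because \<open>'u\<close> is infinite, a
  consequence of having a small infinite set.\<close>

lemma vertex_eq_iff [simp]: "(vertex i :: 'u) = vertex j \<longleftrightarrow> i = j"
proof -
  obtain s :: "nat \<Rightarrow> 'u" where "inj s" using infinite_countable_subset[OF infinite_UNIV] by blast
  then have "inj (vertex :: nat \<Rightarrow> 'u)" unfolding vertex_def by (rule someI[of inj])
  then show ?thesis by (simp add: inj_eq)
qed

lemma inv_vertex [simp]: "inv vertex (vertex i :: 'u) = i"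
  by (intro inv_f_f injI) simp

abbreviation sg :: "'o list \<Rightarrow> ('u, 'o) vgraph" where "sg \<equiv> seq_graph V"

lemma verts_seq_graph: "verts (sg Zs) = vertex ` {0..length Zs}"
  by (simp add: seq_graph_def)

lemma vertex_in [simp]: "vertex i \<in> verts (sg Zs) \<longleftrightarrow> i \<le> length Zs"
  by (auto simp: verts_seq_graph)

lemma seq_graph_vertsE:
  assumes "a \<in> verts (sg Zs)"
  obtains i where "a = vertex i" "i \<le> length Zs"
  using assms unfolding verts_seq_graph by (metis atLeastAtMost_iff imageE)

lemma edge_seq_graph:
  "i \<le> length Zs \<Longrightarrow> j \<le> length Zs \<Longrightarrow>
    edge (sg Zs) (vertex i) (vertex j) = (if j = Suc i then Zs ! i else initial V)"
  by (simp add: seq_graph_def restrict2_in Let_def)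

lemma edge_seq_graph_Suc [simp]: "i < length Zs \<Longrightarrow> edge (sg Zs) (vertex i) (vertex (Suc i)) = Zs ! i"
  by (simp add: edge_seq_graph)

lemma seq_graph_vgraph: assumes "Zs \<in> lists (Ob V)" shows "vgraph (sg Zs)"
  unfolding is_vgraph_def
proof (intro conjI ballI)
  show "small (verts (sg Zs))" by (simp add: verts_seq_graph small_finite)
  show "edge (sg Zs) a b \<in> Ob V" if ab: "a \<in> verts (sg Zs)" "b \<in> verts (sg Zs)" for a b
  proof -
    obtain i j where "a = vertex i" "b = vertex j" "i \<le> length Zs" "j \<le> length Zs"
      using ab by (metis seq_graph_vertsE)
    then show ?thesis using assms initial by (auto simp: edge_seq_graph is_initial_def in_lists_conv_set)
  qed
  show "extensional2 (verts (sg Zs)) (edge (sg Zs))"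
    by (simp add: seq_graph_def extensional2_restrict2)
qed

lemma seq_map_simps:
  fixes Y :: "('u, 'o) vgraph"
  shows "i \<le> length Zs \<Longrightarrow> gobj (seq_map V Zs Y p gs) (vertex i) = p i"
    and "i < length Zs \<Longrightarrow> ghom (seq_map V Zs Y p gs) (vertex i) (vertex (Suc i)) = gs ! i"
  by (simp_all add: seq_map_def restrict2_in Let_def)

text \<open>Data are required on consecutive vertices only: every other hom has initial source,
  where \<open>from_initial\<close> has the right type for any target.\<close>

lemma seq_map_hom:
  assumes "Zs \<in> lists (Ob V)" "vgraph Y" "\<And>i. i \<le> length Zs \<Longrightarrow> p i \<in> verts Y"
    and "\<And>i. i < length Zs \<Longrightarrow> gs ! i \<in> hom V (Zs ! i) (edge Y (p i) (p (Suc i)))"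
  shows "seq_map V Zs Y p gs \<in> hom G (sg Zs) Y"
proof (rule graph_homI)
  let ?f = "seq_map V Zs Y p gs"
  show "vgraph (sg Zs)" "vgraph Y" using assms seq_graph_vgraph by auto
  show "gsrc ?f = sg Zs" "gtgt ?f = Y" "gobj ?f \<in> extensional (verts (sg Zs))"
    "extensional2 (verts (sg Zs)) (ghom ?f)"
    by (simp_all add: seq_map_def verts_seq_graph extensional2_restrict2)
  show "gobj ?f a \<in> verts Y" if "a \<in> verts (sg Zs)" for a
    using that assms(3) by (auto simp: verts_seq_graph seq_map_simps)
  show "ghom ?f a b \<in> hom V (edge (sg Zs) a b) (edge Y (gobj ?f a) (gobj ?f b))"
    if ab: "a \<in> verts (sg Zs)" "b \<in> verts (sg Zs)" for a b
  proof -
    obtain i j where ij: "a = vertex i" "b = vertex j" "i \<le> length Zs" "j \<le> length Zs"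
      using ab by (metis seq_graph_vertsE)
    show ?thesis
    proof (cases "j = Suc i")
      case True
      then show ?thesis using ij assms(4) by (simp add: seq_map_simps)
    next
      case False
      then show ?thesis using ij edge_Ob[OF assms(2,3,3)]
        by (simp add: seq_map_simps edge_seq_graph) (simp add: seq_map_def restrict2_in Let_def from_initial_hom)
    qed
  qed
qed

text \<open>The hom maps between non-consecutive vertices have initial source.\<close>

lemma seq_graph_map_eqI:
  assumes f: "f \<in> hom G (sg Zs) Y" and g: "g \<in> hom G (sg Zs) Y"
    and obj: "\<And>i. i \<le> length Zs \<Longrightarrow> gobj f (vertex i) = gobj g (vertex i)"
    and hom: "\<And>i. i < length Zs \<Longrightarrow> ghom f (vertex i) (vertex (Suc i)) = ghom g (vertex i) (vertex (Suc i))"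
  shows "f = g"
proof (rule gmap_eqI[OF f g])
  show "gobj f a = gobj g a" if "a \<in> verts (sg Zs)" for a
    using that obj by (auto simp: verts_seq_graph)
  show "ghom f a b = ghom g a b" if ab: "a \<in> verts (sg Zs)" "b \<in> verts (sg Zs)" for a b
  proof -
    obtain i j where ij: "a = vertex i" "b = vertex j" "i \<le> length Zs" "j \<le> length Zs"
      using ab by (metis seq_graph_vertsE)
    show ?thesis
    proof (cases "j = Suc i")
      case True
      then show ?thesis using ij hom by simp
    next
      case False
      then show ?thesis
        using initial_eqI[OF initial] graph_homD(6)[OF f that] graph_homD(6)[OF g that] ij obj
        by (simp add: edge_seq_graph)
    qed
  qed
qed

end

section \<open>Paths in a graph and the graph maps that they determine\<close>

lemma length_along [simp]: "length (along h xs) = length xs - 1"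
  by (simp add: along_def)

lemma along_nth [simp]: "i < length xs - 1 \<Longrightarrow> along h xs ! i = h (xs ! i) (xs ! Suc i)"
  by (simp add: along_def nth_butlast nth_tl)

lemma along_Cons: "along h [x] = []" "xs \<noteq> [] \<Longrightarrow> along h (x # xs) = h x (hd xs) # along h xs"
  by (auto simp: along_def neq_Nil_conv)

lemma lists_nth: "xs \<in> lists A \<Longrightarrow> i < length xs \<Longrightarrow> xs ! i \<in> A"
  by (simp add: in_lists_conv_set)

lemma lists_nthI: "(\<And>i. i < length xs \<Longrightarrow> xs ! i \<in> A) \<Longrightarrow> xs \<in> lists A"
  by (auto simp: in_lists_conv_set in_set_conv_nth)

lemma paths_iff: "xs \<in> paths X a b \<longleftrightarrow> xs \<in> lists (verts X) \<and> xs \<noteq> [] \<and> hd xs = a \<and> last xs = b"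
  by (simp add: paths_def)

lemma paths_ends: assumes "xs \<in> paths X a b" shows "a \<in> verts X" "b \<in> verts X"
  using assms by (auto simp: paths_iff in_lists_conv_set)

context coproduct_category
begin

lemma along_edge_Ob: "vgraph X \<Longrightarrow> xs \<in> lists (verts X) \<Longrightarrow> along (edge X) xs \<in> lists (Ob V)"
  by (rule lists_nthI) (auto intro!: edge_Ob lists_nth)

lemma path_map_hom:
  assumes "vgraph X" "xs \<in> lists (verts X)" "xs \<noteq> []"
  shows "path_map V X xs \<in> hom G (sg (along (edge X) xs)) X"
  unfolding path_map_def using assms
  by (intro seq_map_hom along_edge_Ob) (auto intro!: ident_hom edge_Ob lists_nth simp: neq_Nil_conv)

lemma path_map_simps:
  fixes X :: "('u, 'o) vgraph"
  shows "xs \<noteq> [] \<Longrightarrow> i < length xs \<Longrightarrow> gobj (path_map V X xs) (vertex i) = xs ! i"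
    and "i < length xs - 1 \<Longrightarrow> ghom (path_map V X xs) (vertex i) (vertex (Suc i)) = ident V (edge X (xs ! i) (xs ! Suc i))"
  by (simp_all add: path_map_def seq_map_simps)

end

section \<open>Concatenating paths\<close>

lemma along_append: "xs \<noteq> [] \<Longrightarrow> along h (xs @ ys) = along h xs @ along h (last xs # ys)"
proof (induction xs)
  case (Cons x xs)
  then show ?case by (cases "xs = []") (simp_all add: along_Cons)
qed simp

lemma offset_0 [simp]: "offset xss 0 = 0"
  by (simp add: offset_def)

lemma offset_Cons_Suc [simp]: "offset (xs # xss) (Suc i) = length xs + offset xss i"
  by (simp add: offset_def)

lemma offset_Suc: "i < length xss \<Longrightarrow> offset xss (Suc i) = offset xss i + length (xss ! i)"
  by (simp add: offset_def take_Suc_conv_app_nth)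

lemma offset_length: "offset xss (length xss) = length (concat xss)"
  by (simp add: offset_def)

lemma offset_mono: "i \<le> j \<Longrightarrow> offset xss i \<le> offset xss j"
proof -
  assume "i \<le> j"
  then have "take j xss = take i xss @ take (j - i) (drop i xss)" by (metis le_add_diff_inverse take_add)
  then show ?thesis by (simp add: offset_def)
qed

lemma offset_le: "offset xss i \<le> length (concat xss)"
  using offset_mono[of i "max i (length xss)" xss] by (simp add: offset_def max_def split: if_splits)

lemma offset_add_le: "i < length xss \<Longrightarrow> j \<le> length (xss ! i) \<Longrightarrow> offset xss i + j \<le> length (concat xss)"
  using offset_Suc[of i xss] offset_le[of xss "Suc i"] by simp

lemma concat_nth_offset:
  "i < length xss \<Longrightarrow> j < length (xss ! i) \<Longrightarrow> concat xss ! (offset xss i + j) = xss ! i ! j"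
proof (induction xss arbitrary: i)
  case (Cons xs xss)
  then show ?case by (cases i) (simp_all add: nth_append add.assoc)
qed simp

lemma path_families_single: "ps \<in> path_families X [y] \<longleftrightarrow> ps = []"
  by (auto simp: path_families_def)

lemma path_families_Cons:
  "ps \<in> path_families X (y # y' # ys) \<longleftrightarrow>
    (\<exists>p ps'. ps = p # ps' \<and> p \<in> paths X y y' \<and> ps' \<in> path_families X (y' # ys))"
proof (cases ps)
  case (Cons p ps')
  then show ?thesis by (simp add: path_families_def All_less_Suc2) blast
qed (simp add: path_families_def)

lemma path_families_paths:
  "ps \<in> path_families X ys \<Longrightarrow> p \<in> set ps \<Longrightarrow> p \<in> lists (verts X) \<and> p \<noteq> []"
  by (auto simp: path_families_def in_set_conv_nth paths_iff)

text \<open>Path and family are peeled off together, one step of \<open>ys\<close> against one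
  member of \<open>ps\<close>. The base case is a single vertex with the empty family, since paths
  are nonempty lists.\<close>

lemma path_families_induct [consumes 2, case_names single Cons]:
  assumes "ps \<in> path_families X ys" "ys \<noteq> []"
    and "\<And>y. P [] [y]"
    and "\<And>p ps y y' ys. p \<in> paths X y y' \<Longrightarrow> ps \<in> path_families X (y' # ys) \<Longrightarrow> P ps (y' # ys) \<Longrightarrow>
      P (p # ps) (y # y' # ys)"
  shows "P ps ys"
  using assms(1,2)
proof (induction ys arbitrary: ps)
  case (Cons y ys)
  then show ?case
    by (cases ys) (auto simp: path_families_single path_families_Cons assms(3) intro!: assms(4))
qed simp

text \<open>Consecutive members of \<open>ps\<close> share an endpoint. Taking tails removes each
  shared vertex once, and only the very first vertex, \<open>hd ys\<close>, has to be put back; no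
  step is lost, so the lists of steps simply concatenate.\<close>

lemma concat_path_along:
  assumes "ps \<in> path_families X ys" "ys \<noteq> []"
  shows "along h (hd ys # concat (map tl ps)) = concat (map (along h) ps)"
  using assms
proof (induction rule: path_families_induct)
  case (Cons p ps y y' ys)
  then have "p = y # tl p" "last p = y'" "p \<noteq> []" by (auto simp: paths_iff)
  then show ?case using along_append[of p h "concat (map tl ps)"] Cons.IH by (metis append_Cons concat.simps(2) list.map(2) list.sel(1))
qed (simp add: along_Cons)

lemma concat_path_in:
  assumes "ps \<in> path_families X ys" "ys \<in> paths X a b"
  shows "hd ys # concat (map tl ps) \<in> paths X a b"
proof -
  have "ys \<noteq> []" using assms(2) by (simp add: paths_iff)
  have "last (hd ys # concat (map tl ps)) = last ys"
    using assms(1) \<open>ys \<noteq> []\<close>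
  proof (induction rule: path_families_induct)
    case (Cons p ps y y' ys)
    then have "p = y # tl p" "last p = y'" by (auto simp: paths_iff)
    \<comment> \<open>This includes empty \<open>zs\<close>: then the left side is the last vertex
      of \<open>p\<close>, which is \<open>y'\<close>.\<close>
    then have "last (y # tl p @ zs) = last (y' # zs)" for zs
      by (metis append_Cons append_Nil2 last.simps last_append)
    then have "last (hd (y # y' # ys) # concat (map tl (p # ps))) = last (y' # concat (map tl ps))"
      by (simp only: list.sel list.map concat.simps)
    also have "\<dots> = last (y' # ys)" using Cons.IH by (simp only: list.sel)
    also have "\<dots> = last (y # y' # ys)" by simp
    finally show ?case .
  qed simp
  moreover have "x \<in> verts X" if "p \<in> set ps" "x \<in> set (tl p)" for p x
    using path_families_paths[OF assms(1) that(1)] that(2) by (auto simp: in_lists_conv_set dest: list.set_sel(2))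
  ultimately show ?thesis using assms(2) paths_ends[OF assms(2)] by (auto simp: paths_iff)
qed

text \<open>Positions are counted by the offsets of \<open>map (along h) ps\<close>, whose entries
  are one shorter than the paths, so shared vertices count once. The second claim also covers the
  final vertex, at \<open>i = length ps\<close>, which the first does not reach and which is present
  even if \<open>ps\<close> is empty.\<close>

lemma concat_path_nth:
  assumes "ps \<in> path_families X ys" "ys \<noteq> []"
  shows "i < length ps \<Longrightarrow> j < length (ps ! i) \<Longrightarrow>
      (hd ys # concat (map tl ps)) ! (offset (map (along h) ps) i + j) = ps ! i ! j"
    and "i < length ys \<Longrightarrow> (hd ys # concat (map tl ps)) ! offset (map (along h) ps) i = ys ! i"
  using assms
proof (induction arbitrary: i and i rule: path_families_induct)
  case (Cons p ps y y' ys)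
  then have p: "p = y # tl p" "last p = y'" "p \<noteq> []" by (auto simp: paths_iff)
  define zs where "zs = concat (map tl ps)"
  have p_zs: "hd (y # y' # ys) # concat (map tl (p # ps)) = p @ zs"
    using p(1) by (metis append_Cons concat.simps(2) list.map(2) list.sel(1) zs_def)
  \<comment> \<open>The last vertex of \<open>p\<close> is the first vertex \<open>y'\<close> of
    what follows; reading from there on is reading the concatenated path of the remaining
    family.\<close>
  have nth: "(p @ zs) ! (length p - 1 + k) = (y' # zs) ! k" for k
  proof (cases k)
    case 0
    then show ?thesis using p(2,3) by (simp add: nth_append last_conv_nth)
  next
    case (Suc m)
    then have "length p - 1 + k = length p + m" using p(3) by (cases p) auto
    then show ?thesis using Suc by (simp only: nth_append_length_plus nth_Cons_Suc)
  qed
  {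
    case 1
    then show ?case
    proof (cases i)
      case 0
      then show ?thesis using 1 unfolding p_zs by (simp add: nth_append)
    next
      case (Suc k)
      then show ?thesis using 1 Cons.IH(1)[of k] nth[of "offset (map (along h) ps) k + j"]
        unfolding p_zs by (simp add: zs_def add.assoc)
    qed
  next
    case 2
    then show ?case
    proof (cases i)
      case 0
      then show ?thesis by simp
    next
      case (Suc k)
      then show ?thesis using 2 Cons.IH(2)[of k] nth[of "offset (map (along h) ps) k"]
        unfolding p_zs by (simp add: zs_def)
    qed
  }
qed auto

section \<open>Functors on sequences\<close>

lemma seq_hom_iff:
  "fs \<in> hom (seq_cat V) Xs Ys \<longleftrightarrow> fs \<in> lists (Ar V) \<and> map (Dom V) fs = Xs \<and> map (Cod V) fs = Ys"
  by (simp add: hom_def seq_cat_def)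

lemma seq_homI:
  assumes "length fs = length Xs" "length Ys = length Xs"
    and "\<And>i. i < length Xs \<Longrightarrow> fs ! i \<in> hom V (Xs ! i) (Ys ! i)"
  shows "fs \<in> hom (seq_cat V) Xs Ys"
  unfolding seq_hom_iff
proof (intro conjI)
  show "fs \<in> lists (Ar V)" using assms by (intro lists_nthI) (auto simp: hom_def)
  show "map (Dom V) fs = Xs" "map (Cod V) fs = Ys"
    using assms by (auto intro!: nth_equalityI simp: hom_def)
qed

lemma seq_homD:
  assumes "fs \<in> hom (seq_cat V) Xs Ys"
  shows "length fs = length Xs" "length Ys = length Xs"
    and "i < length Xs \<Longrightarrow> fs ! i \<in> hom V (Xs ! i) (Ys ! i)"
  using assms unfolding seq_hom_iff by (auto simp: hom_def)

lemma seq_hom_map: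
  assumes "\<And>x. x \<in> set xs \<Longrightarrow> f x \<in> hom V (A x) (B x)"
  shows "map f xs \<in> hom (seq_cat V) (map A xs) (map B xs)"
  using assms by (intro seq_homI) auto

lemma seq_hom_append:
  "fs \<in> hom (seq_cat V) Xs Ys \<Longrightarrow> gs \<in> hom (seq_cat V) Xs' Ys' \<Longrightarrow>
    fs @ gs \<in> hom (seq_cat V) (Xs @ Xs') (Ys @ Ys')"
  by (auto simp: seq_hom_iff)

lemma seq_hom_Cons:
  "f \<in> hom V X Y \<Longrightarrow> gs \<in> hom (seq_cat V) Xs Ys \<Longrightarrow> f # gs \<in> hom (seq_cat V) (X # Xs) (Y # Ys)"
  unfolding seq_hom_iff by (auto simp: hom_def)

context category
begin

lemma seq_hom_ident: "Xs \<in> lists (Ob C) \<Longrightarrow> map (ident C) Xs \<in> hom (seq_cat C) Xs Xs"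
  using seq_hom_map[of Xs "ident C" C "\<lambda>x. x" "\<lambda>x. x"] ident_hom by (auto simp: in_lists_conv_set)

lemma seq_hom_cmp:
  "fs \<in> hom (seq_cat C) Xs Ys \<Longrightarrow> gs \<in> hom (seq_cat C) Ys Zs \<Longrightarrow> map2 (\<cdot>) gs fs \<in> hom (seq_cat C) Xs Zs"
  by (intro seq_homI) (auto simp: seq_homD intro!: cmp_hom[OF seq_homD(3) seq_homD(3)])

lemma seq_hom_Ob: "fs \<in> hom (seq_cat C) Xs Ys \<Longrightarrow> Xs \<in> lists (Ob C) \<and> Ys \<in> lists (Ob C)"
  using Dom_Ob Cod_Ob by (auto simp: seq_hom_iff)

lemma seq_functorI:
  assumes "\<And>Xs. Xs \<in> lists (Ob C) \<Longrightarrow> F0 Xs \<in> Ob C"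
    and "\<And>fs Xs Ys. fs \<in> hom (seq_cat C) Xs Ys \<Longrightarrow> F1 fs \<in> hom C (F0 Xs) (F0 Ys)"
    and "\<And>Xs. Xs \<in> lists (Ob C) \<Longrightarrow> F1 (map (ident C) Xs) = ident C (F0 Xs)"
    and "\<And>fs gs Xs Ys Zs. fs \<in> hom (seq_cat C) Xs Ys \<Longrightarrow> gs \<in> hom (seq_cat C) Ys Zs \<Longrightarrow>
      F1 (map2 (\<cdot>) gs fs) = F1 gs \<cdot> F1 fs"
  shows "is_functor (seq_cat C) C F0 F1"
  unfolding is_functor_def
proof (intro conjI ballI impI)
  show "F0 Xs \<in> Ob C" "F1 (ident (seq_cat C) Xs) = ident C (F0 Xs)" if "Xs \<in> Ob (seq_cat C)" for Xs
    using that assms(1,3) by (simp_all add: seq_cat_def)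
  show "F1 f \<in> hom C (F0 (Dom (seq_cat C) f)) (F0 (Cod (seq_cat C) f))" if "f \<in> Ar (seq_cat C)" for f
    using that by (intro assms(2)) (simp add: hom_def)
  show "F1 (g \<cdot>\<^bsub>seq_cat C\<^esub> f) = F1 g \<cdot> F1 f"
    if "f \<in> Ar (seq_cat C)" "g \<in> Ar (seq_cat C)" "Cod (seq_cat C) f = Dom (seq_cat C) g" for f g
    using assms(4)[OF homI[OF that(1) refl refl] homI[OF that(2) _ refl]] that(3) by (simp add: seq_cat_def)
qed

lemma seq_functorD:
  assumes "is_functor (seq_cat C) C F0 F1"
  shows "Xs \<in> lists (Ob C) \<Longrightarrow> F0 Xs \<in> Ob C"
    and "fs \<in> hom (seq_cat C) Xs Ys \<Longrightarrow> F1 fs \<in> hom C (F0 Xs) (F0 Ys)"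
    and "Xs \<in> lists (Ob C) \<Longrightarrow> F1 (map (ident C) Xs) = ident C (F0 Xs)"
    and "fs \<in> hom (seq_cat C) Xs Ys \<Longrightarrow> gs \<in> hom (seq_cat C) Ys Zs \<Longrightarrow>
      F1 (map2 (\<cdot>) gs fs) = F1 gs \<cdot> F1 fs"
proof -
  have cmp: "map2 (\<cdot>) gs fs = gs \<cdot>\<^bsub>seq_cat C\<^esub> fs" and ident: "map (ident C) Xs = ident (seq_cat C) Xs"
    and Ob: "lists (Ob C) = Ob (seq_cat C)" by (simp_all add: seq_cat_def)
  show "Xs \<in> lists (Ob C) \<Longrightarrow> F0 Xs \<in> Ob C" "Xs \<in> lists (Ob C) \<Longrightarrow> F1 (map (ident C) Xs) = ident C (F0 Xs)"
    unfolding ident Ob using assms by (auto simp: is_functor_def)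
  show "fs \<in> hom (seq_cat C) Xs Ys \<Longrightarrow> F1 fs \<in> hom C (F0 Xs) (F0 Ys)"
    using assms homD[of fs "seq_cat C" Xs Ys] by (auto simp: is_functor_def)
  show "F1 (map2 (\<cdot>) gs fs) = F1 gs \<cdot> F1 fs" if "fs \<in> hom (seq_cat C) Xs Ys" "gs \<in> hom (seq_cat C) Ys Zs"
    unfolding cmp using assms homD[OF that(1)] homD[OF that(2)] by (simp add: is_functor_def)
qed

end

context coproduct_category
begin

text \<open>The index \<open>(ys, ps)\<close> of a summand of the twofold construct is analysed once
  here. Since \<open>hd ys = a\<close>, the concatenated path can be written with head
  \<open>a\<close>, as in \<open>Gamma_mu\<close>.\<close>

lemma path_family:
  assumes X: "vgraph X" and ys: "ys \<in> paths X a b" and ps: "ps \<in> path_families X ys"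
  shows "ys \<in> lists (verts X)" "ys \<noteq> []" "hd ys = a" "last ys = b" "length ys = Suc (length ps)"
    and "i < length ps \<Longrightarrow> ps ! i \<in> paths X (ys ! i) (ys ! Suc i)"
    and "a # concat (map tl ps) \<in> paths X a b"
    and "along h (a # concat (map tl ps)) = concat (map (along h) ps)"
    and "map (along (edge X)) ps \<in> lists (lists (Ob V))"
proof -
  show ys': "ys \<in> lists (verts X)" "ys \<noteq> []" "hd ys = a" "last ys = b" using ys by (auto simp: paths_iff)
  show "length ys = Suc (length ps)" "i < length ps \<Longrightarrow> ps ! i \<in> paths X (ys ! i) (ys ! Suc i)"
    using ps by (simp_all add: path_families_def)
  show "a # concat (map tl ps) \<in> paths X a b" using concat_path_in[OF ps ys] ys' by simp
  show "along h (a # concat (map tl ps)) = concat (map (along h) ps)"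
    using concat_path_along[OF ps ys'(2)] ys'(3) by simp
  show "map (along (edge X)) ps \<in> lists (lists (Ob V))"
    by (rule lists_nthI) (simp only: length_map nth_map,
        rule along_edge_Ob[OF X conjunct1[OF path_families_paths[OF ps nth_mem]]])
qed

lemma along_ghom:
  assumes f: "f \<in> hom G X Y" and "xs \<in> lists (verts X)"
  shows "along (ghom f) xs \<in> hom (seq_cat V) (along (edge X) xs) (along (edge Y) (map (gobj f) xs))"
  using assms by (intro seq_homI) (auto intro!: graph_homD(6)[OF f] lists_nth)

end

section \<open>The multitensor of a monad over Set\<close>

locale graph_monad = coproduct_category V small
  for V :: "('o, 'm) cat" (structure) and small :: "'u set \<Rightarrow> bool" +
  fixes T :: "(('u, 'o) vgraph, ('u, 'o, 'm) gmap) monad_data"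
  assumes monad: "is_monad_over_Set small V T"
begin

lemma mob_vgraph: "vgraph X \<Longrightarrow> vgraph (mob T X)"
  using monad by (simp add: is_monad_over_Set_def is_monad_def is_functor_def)

lemma verts_mob: "vgraph X \<Longrightarrow> verts (mob T X) = verts X"
  using monad by (simp add: is_monad_over_Set_def)

lemma mar_hom:
  assumes "f \<in> hom G X Y"
  shows "mar T f \<in> hom G (mob T X) (mob T Y)" and "gobj (mar T f) = gobj f"
proof -
  have f: "f \<in> Ar G" "Dom G f = X" "Cod G f = Y" using assms by (auto simp: hom_def)
  then show "mar T f \<in> hom G (mob T X) (mob T Y)"
    using monad by (auto simp: is_monad_over_Set_def is_monad_def is_functor_def)
  have "is_gmap small V f" using f(1) by (simp add: graph_cat_def)
  then show "gobj (mar T f) = gobj f" using monad by (simp add: is_monad_over_Set_def)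
qed

lemma mar_ident: "vgraph X \<Longrightarrow> mar T (ident G X) = ident G (mob T X)"
  using monad by (simp add: is_monad_over_Set_def is_monad_def is_functor_def)

lemma mar_cmp:
  assumes "f \<in> hom G X Y" "g \<in> hom G Y Z"
  shows "mar T (g \<star> f) = mar T g \<star> mar T f"
  using monad homD[OF assms(1)] homD[OF assms(2)]
  by (simp add: is_monad_over_Set_def is_monad_def is_functor_def)

lemma eta_hom:
  assumes "vgraph X"
  shows "eta T X \<in> hom G X (mob T X)" and "a \<in> verts X \<Longrightarrow> gobj (eta T X) a = a"
  using monad assms by (simp_all add: is_monad_over_Set_def is_monad_def is_nat_trans_def)

lemma mu_hom:
  assumes "vgraph X"
  shows "mu T X \<in> hom G (mob T (mob T X)) (mob T X)" and "a \<in> verts X \<Longrightarrow> gobj (mu T X) a = a"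
  using monad assms by (simp_all add: is_monad_over_Set_def is_monad_def is_nat_trans_def)

lemma eta_nat: "f \<in> hom G X Y \<Longrightarrow> eta T Y \<star> f = mar T f \<star> eta T X"
  using monad homD[of f G X Y] by (auto simp: is_monad_over_Set_def is_monad_def is_nat_trans_def)

lemma mu_nat: "f \<in> hom G X Y \<Longrightarrow> mu T Y \<star> mar T (mar T f) = mar T f \<star> mu T X"
  using monad homD[of f G X Y] by (auto simp: is_monad_over_Set_def is_monad_def is_nat_trans_def)

lemma ghom_mar_hom:
  "f \<in> hom G X Y \<Longrightarrow> a \<in> verts X \<Longrightarrow> b \<in> verts X \<Longrightarrow>
    ghom (mar T f) a b \<in> hom V (edge (mob T X) a b) (edge (mob T Y) (gobj f a) (gobj f b))"
  using graph_homD(1,6)[OF mar_hom(1)] mar_hom(2) verts_mob graph_homD(1) by metis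

lemma ghom_mar_cmp:
  assumes "f \<in> hom G X Y" "g \<in> hom G Y Z" "a \<in> verts X" "b \<in> verts X"
  shows "ghom (mar T (g \<star> f)) a b = ghom (mar T g) (gobj f a) (gobj f b) \<cdot> ghom (mar T f) a b"
  using ghom_G_cmp(2)[OF mar_hom(1)[OF assms(1)], of a b "mar T g"] assms verts_mob[OF graph_homD(1)[OF assms(1)]]
  by (simp add: mar_cmp[OF assms(1,2)] mar_hom(2)[OF assms(1)])

abbreviation seq_arrow :: "'o list \<Rightarrow> 'o list \<Rightarrow> 'm list \<Rightarrow> ('u, 'o, 'm) gmap" where
  "seq_arrow Xs Ys fs \<equiv> seq_map V Xs (sg Ys) vertex fs"

lemma seq_arrow_hom:
  assumes "fs \<in> hom (seq_cat V) Xs Ys"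
  shows "seq_arrow Xs Ys fs \<in> hom G (sg Xs) (sg Ys)"
  using seq_homD[OF assms] seq_hom_Ob[OF assms] by (intro seq_map_hom) (auto intro: seq_graph_vgraph)

lemma bar_ar_eq: "fs \<in> hom (seq_cat V) Xs Ys \<Longrightarrow>
    bar_ar V T fs = ghom (mar T (seq_arrow Xs Ys fs)) (vertex 0) (vertex (length Xs))"
  using seq_homD(1)[of fs V Xs Ys] by (auto simp: bar_ar_def seq_hom_iff)

lemma bar_ar_hom: "fs \<in> hom (seq_cat V) Xs Ys \<Longrightarrow> bar_ar V T fs \<in> hom V (bar_ob V T Xs) (bar_ob V T Ys)"
  using ghom_mar_hom[OF seq_arrow_hom, of fs Xs Ys "vertex 0" "vertex (length Xs)"]
  by (simp add: bar_ar_eq bar_ob_def seq_map_simps seq_homD(2))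

lemma bar_ob_Ob: "Xs \<in> lists (Ob V) \<Longrightarrow> bar_ob V T Xs \<in> Ob V"
  unfolding bar_ob_def
  by (intro edge_Ob mob_vgraph seq_graph_vgraph) (auto simp: verts_mob seq_graph_vgraph)

text \<open>\<open>seq_arrow\<close> turns componentwise identities and composites of sequences into
  those of graph maps and fixes the names of vertices. Functoriality of \<open>T\<close>, evaluated
  at the hom from the first to the last vertex, does the rest.\<close>

lemma bar_functor: "is_functor (seq_cat V) V (bar_ob V T) (bar_ar V T)"
proof (rule seq_functorI)
  fix Xs assume Xs: "Xs \<in> lists (Ob V)"
  show "bar_ob V T Xs \<in> Ob V" using Xs by (rule bar_ob_Ob)
  have X: "vgraph (sg Xs)" using Xs by (rule seq_graph_vgraph)
  have "seq_arrow Xs Xs (map (ident V) Xs) = ident G (sg Xs)"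
    using X by (intro seq_graph_map_eqI[OF seq_arrow_hom[OF seq_hom_ident[OF Xs]] G.ident_hom])
      (simp_all add: seq_map_simps ghom_G_ident)
  then show "bar_ar V T (map (ident V) Xs) = ident V (bar_ob V T Xs)"
    using X by (simp add: bar_ar_eq[OF seq_hom_ident[OF Xs]] mar_ident ghom_G_ident verts_mob bar_ob_def)
next
  show "bar_ar V T fs \<in> hom V (bar_ob V T Xs) (bar_ob V T Ys)" if "fs \<in> hom (seq_cat V) Xs Ys" for fs Xs Ys
    using that by (rule bar_ar_hom)
  show "bar_ar V T (map2 (\<cdot>) gs fs) = bar_ar V T gs \<cdot> bar_ar V T fs"
    if fs: "fs \<in> hom (seq_cat V) Xs Ys" and gs: "gs \<in> hom (seq_cat V) Ys Zs" for fs gs Xs Ys Zs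
  proof -
    note F = seq_arrow_hom[OF fs] and G = seq_arrow_hom[OF gs]
    have "seq_arrow Xs Zs (map2 (\<cdot>) gs fs) = seq_arrow Ys Zs gs \<star> seq_arrow Xs Ys fs"
      using seq_homD(1,2)[OF fs] seq_homD(1,2)[OF gs]
      by (intro seq_graph_map_eqI[OF seq_arrow_hom[OF seq_hom_cmp[OF fs gs]] G.cmp_hom[OF F G]])
        (simp_all add: seq_map_simps ghom_G_cmp[OF F])
    then show ?thesis
      using seq_homD(1,2)[OF fs] ghom_mar_cmp[OF F G, of "vertex 0" "vertex (length Xs)"]
      by (simp add: bar_ar_eq[OF fs] bar_ar_eq[OF gs] bar_ar_eq[OF seq_hom_cmp[OF fs gs]] seq_map_simps)
  qed
qed

text \<open>These are the components called \<open>t\<close> in the overview. A path with n steps is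
  a list of n + 1 vertices, hence the end vertex \<open>length xs - 1\<close>.\<close>

definition path_comp :: "('u, 'o) vgraph \<Rightarrow> 'u list \<Rightarrow> 'm" where
  "path_comp X xs = ghom (mar T (path_map V X xs)) (vertex 0) (vertex (length xs - 1))"

lemma path_comp_hom:
  assumes "vgraph X" "xs \<in> paths X a b"
  shows "path_comp X xs \<in> hom V (bar_ob V T (along (edge X) xs)) (edge (mob T X) a b)"
proof -
  have xs: "xs \<in> lists (verts X)" "xs \<noteq> []" "hd xs = a" "last xs = b" using assms(2) by (auto simp: paths_iff)
  show ?thesis
    using ghom_mar_hom[OF path_map_hom[OF assms(1) xs(1,2)], of "vertex 0" "vertex (length xs - 1)"] xs
    by (simp add: path_comp_def bar_ob_def path_map_simps hd_conv_nth last_conv_nth)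
qed

lemma path_comp_nat:
  assumes f: "f \<in> hom G X Y" and "xs \<in> paths X a b"
  shows "ghom (mar T f) a b \<cdot> path_comp X xs =
    path_comp Y (map (gobj f) xs) \<cdot> bar_ar V T (along (ghom f) xs)"
proof -
  have xs: "xs \<in> lists (verts X)" "xs \<noteq> []" "hd xs = a" "last xs = b" using assms(2) by (auto simp: paths_iff)
  note X = graph_homD(1)[OF f] and Y = graph_homD(2)[OF f]
  have fxs: "map (gobj f) xs \<in> lists (verts Y)" "map (gobj f) xs \<noteq> []"
    using xs graph_homD(5)[OF f] by (auto simp: in_lists_conv_set)
  note p = path_map_hom[OF X xs(1,2)] and q = path_map_hom[OF Y fxs] and A = along_ghom[OF f xs(1)]
  note s = seq_arrow_hom[OF A]
  have nth: "i < length xs \<Longrightarrow> xs ! i \<in> verts X" for i using lists_nth[OF xs(1)] by blast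
  \<comment> \<open>Both sides send \<open>vertex i\<close> to the image of \<open>xs ! i\<close>
    and act on step \<open>i\<close> by \<open>ghom f\<close>, because the hom maps of a path map
    are identities. Applying \<open>T\<close> and evaluating at the end vertices gives the
    claim.\<close>
  have "f \<star> path_map V X xs = path_map V Y (map (gobj f) xs) \<star>
      seq_arrow (along (edge X) xs) (along (edge Y) (map (gobj f) xs)) (along (ghom f) xs)"
  proof (rule seq_graph_map_eqI[OF G.cmp_hom[OF p f] G.cmp_hom[OF s q]])
    fix i assume i: "i < length (along (edge X) xs)"
    have h: "ghom f (xs ! i) (xs ! Suc i) \<in>
        hom V (edge X (xs ! i) (xs ! Suc i)) (edge Y (gobj f (xs ! i)) (gobj f (xs ! Suc i)))"
      using i nth by (intro graph_homD(6)[OF f]) auto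
    show "ghom (f \<star> path_map V X xs) (vertex i) (vertex (Suc i)) =
      ghom (path_map V Y (map (gobj f) xs) \<star>
        seq_arrow (along (edge X) xs) (along (edge Y) (map (gobj f) xs)) (along (ghom f) xs)) (vertex i) (vertex (Suc i))"
      using i xs(2) ident_left[OF h] ident_right[OF h]
      by (simp add: ghom_G_cmp[OF p] ghom_G_cmp[OF s] path_map_simps seq_map_simps)
  next
    fix i assume "i \<le> length (along (edge X) xs)"
    then have i: "i \<le> length xs - 1" "i < length xs" using xs(2) by (cases xs; simp)+
    show "gobj (f \<star> path_map V X xs) (vertex i) =
      gobj (path_map V Y (map (gobj f) xs) \<star>
        seq_arrow (along (edge X) xs) (along (edge Y) (map (gobj f) xs)) (along (ghom f) xs)) (vertex i)"
      using i xs(2) by (simp add: ghom_G_cmp[OF p] ghom_G_cmp[OF s] path_map_simps seq_map_simps)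
  qed
  then show ?thesis
    using ghom_mar_cmp[OF p f, of "vertex 0" "vertex (length xs - 1)"]
      ghom_mar_cmp[OF s q, of "vertex 0" "vertex (length xs - 1)"] xs
    by (simp add: path_comp_def bar_ar_eq[OF A] path_map_simps seq_map_simps hd_conv_nth last_conv_nth)
qed

definition seq_path :: "'o list \<Rightarrow> 'u list" where
  "seq_path Zs = map vertex [0..<Suc (length Zs)]"

lemma seq_path_simps [simp]:
  "length (seq_path Zs) = Suc (length Zs)" "i \<le> length Zs \<Longrightarrow> seq_path Zs ! i = vertex i" "seq_path Zs \<noteq> []"
  by (simp_all add: seq_path_def del: upt_Suc)

lemma seq_path_in: "seq_path Zs \<in> paths (sg Zs) (vertex 0) (vertex (length Zs))"
  by (auto simp: paths_iff hd_conv_nth last_conv_nth intro!: lists_nthI)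

lemma along_seq_path [simp]: "along (edge (sg Zs)) (seq_path Zs) = Zs"
  by (rule nth_equalityI) simp_all

text \<open>The path map of \<open>0, 1, \<dots>, n\<close> in its own sequence graph is the
  identity. This allows an equation prefixed by a path component to be freed of the prefix.\<close>

lemma path_comp_seq_path:
  assumes "Zs \<in> lists (Ob V)"
  shows "path_comp (sg Zs) (seq_path Zs) = ident V (bar_ob V T Zs)"
proof -
  have Z: "vgraph (sg Zs)" using assms by (rule seq_graph_vgraph)
  have "seq_path Zs \<in> lists (verts (sg Zs))" using seq_path_in by (simp add: paths_iff)
  from path_map_hom[OF Z this] have "path_map V (sg Zs) (seq_path Zs) = ident G (sg Zs)"
    using Z by (intro seq_graph_map_eqI[OF _ G.ident_hom]) (simp_all add: path_map_simps ghom_G_ident)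
  then show ?thesis using Z by (simp add: path_comp_def mar_ident ghom_G_ident verts_mob bar_ob_def)
qed

text \<open>Naturality of \<eta> at the graph map that picks out the single hom from
  \<open>a\<close> to \<open>b\<close>.\<close>

lemma eta_path_comp:
  assumes X: "vgraph X" and ab: "a \<in> verts X" "b \<in> verts X"
  shows "ghom (eta T X) a b = path_comp X [a, b] \<cdot> bar_unit V T (edge X a b)"
proof -
  have Z: "[edge X a b] \<in> lists (Ob V)" using edge_Ob[OF X ab] by simp
  have along: "along (edge X) [a, b] = [edge X a b]" by (simp add: along_def)
  have p: "path_map V X [a, b] \<in> hom G (sg [edge X a b]) X"
    using path_map_hom[OF X, of "[a, b]"] ab by (simp add: along)
  note e = eta_hom[OF seq_graph_vgraph[OF Z]]
  have obj: "gobj (path_map V X [a, b]) (vertex 0) = a" "gobj (path_map V X [a, b]) (vertex (Suc 0)) = b"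
    by (simp_all add: path_map_simps)
  have "ghom (path_map V X [a, b]) (vertex 0) (vertex 1) = ident V (edge X a b)"
    using path_map_simps(2)[of 0 "[a, b]" X] by simp
  then have "ghom (eta T X \<star> path_map V X [a, b]) (vertex 0) (vertex 1) = ghom (eta T X) a b"
    using ident_right[OF graph_homD(6)[OF eta_hom(1)[OF X] ab]]
    by (simp add: ghom_G_cmp[OF p] obj)
  then show ?thesis
    using ghom_G_cmp(2)[OF e(1), of "vertex 0" "vertex 1" "mar T (path_map V X [a, b])"]
    by (simp add: eta_nat[OF p] e path_comp_def bar_unit_def)
qed

section \<open>Substitution for sequences of sequences and the multiplication of the monad\<close>

lemma subseq_map_simps:
  "j \<le> length (Zss ! i) \<Longrightarrow> gobj (subseq_map V Zss i) (vertex j :: 'u) = vertex (offset Zss i + j)"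
  "j < length (Zss ! i) \<Longrightarrow> ghom (subseq_map V Zss i) (vertex j :: 'u) (vertex (Suc j)) = ident V (Zss ! i ! j)"
  by (simp_all add: subseq_map_def seq_map_simps)

lemma tau_map_simps:
  "i \<le> length Zss \<Longrightarrow> gobj (tau_map V T Zss) (vertex i) = vertex (offset Zss i)"
  "i < length Zss \<Longrightarrow> ghom (tau_map V T Zss) (vertex i) (vertex (Suc i)) =
    ghom (mar T (subseq_map V Zss i)) (vertex 0) (vertex (length (Zss ! i)))"
  by (simp_all add: tau_map_def seq_map_simps)

context
  fixes Zss :: "'o list list"
  assumes Zss: "Zss \<in> lists (lists (Ob V))"
begin

lemma concat_Ob: "concat Zss \<in> lists (Ob V)"
  using Zss by (auto simp: in_lists_conv_set)

lemma subseq_map_hom: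
  "i < length Zss \<Longrightarrow> subseq_map V Zss i \<in> hom G (sg (Zss ! i)) (sg (concat Zss))"
  unfolding subseq_map_def
proof (rule seq_map_hom)
  assume i: "i < length Zss"
  show Zi: "Zss ! i \<in> lists (Ob V)" using lists_nth[OF Zss i] .
  show "map (ident V) (Zss ! i) ! j \<in> hom V (Zss ! i ! j)
      (edge (sg (concat Zss)) (vertex (offset Zss i + j)) (vertex (offset Zss i + Suc j)))"
    if "j < length (Zss ! i)" for j
    using i that offset_add_le[of i Zss "Suc j"] concat_nth_offset[of i Zss j] ident_hom[OF lists_nth[OF Zi that]]
    by (simp add: edge_seq_graph)
  show "vertex (offset Zss i + j) \<in> verts (sg (concat Zss))" if "j \<le> length (Zss ! i)" for j
    using offset_add_le[OF i that] by simp
qed (rule seq_graph_vgraph[OF concat_Ob])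

lemma tau_map_hom: "tau_map V T Zss \<in> hom G (sg (map (bar_ob V T) Zss)) (mob T (sg (concat Zss)))"
  unfolding tau_map_def
proof (rule seq_map_hom)
  note Z = seq_graph_vgraph[OF concat_Ob]
  show "map (bar_ob V T) Zss \<in> lists (Ob V)" using Zss by (auto intro: bar_ob_Ob simp: in_lists_conv_set)
  show "vgraph (mob T (sg (concat Zss)))" using Z by (rule mob_vgraph)
  show "vertex (offset Zss i) \<in> verts (mob T (sg (concat Zss)))" for i
    using offset_le by (simp add: verts_mob[OF Z])
  show "map (\<lambda>i. ghom (mar T (subseq_map V Zss i)) (vertex 0) (vertex (length (Zss ! i)))) [0..<length Zss] ! i
      \<in> hom V (map (bar_ob V T) Zss ! i)
        (edge (mob T (sg (concat Zss))) (vertex (offset Zss i)) (vertex (offset Zss (Suc i))))"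
    if "i < length (map (bar_ob V T) Zss)" for i
    using that ghom_mar_hom[OF subseq_map_hom, of i "vertex 0" "vertex (length (Zss ! i))"]
    by (simp add: bar_ob_def subseq_map_simps offset_Suc)
qed

lemma bar_sub_hom: "bar_sub small V T Zss \<in> hom V (bar_ob V T (map (bar_ob V T) Zss)) (bar_ob V T (concat Zss))"
proof -
  have Z: "vgraph (sg (concat Zss))" by (intro seq_graph_vgraph concat_Ob)
  have W: "vgraph (sg (map (bar_ob V T) Zss))" using graph_homD(1)[OF tau_map_hom] .
  note t = mar_hom[OF tau_map_hom]
  show ?thesis
    using graph_homD(6)[OF G.cmp_hom[OF t(1) mu_hom(1)[OF Z]], of "vertex 0" "vertex (length Zss)"]
    by (simp add: bar_sub_def bar_ob_def verts_mob[OF W] ghom_G_cmp[OF t(1)] t(2) tau_map_simps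
        mu_hom(2)[OF Z] offset_le offset_length)
qed

end

text \<open>Naturality of \<open>\<mu>\<close> at the path map \<open>p\<close> of the concatenated path reduces this to
  \<open>T p \<star> \<tau> = path_map V (T X) ys \<star> s\<close>, an equality of maps out of a sequence.\<close>

lemma mu_path_comp:
  assumes X: "vgraph X" and ys: "ys \<in> paths X a b" and ps: "ps \<in> path_families X ys"
  shows "ghom (mu T X) a b \<cdot> (path_comp (mob T X) ys \<cdot> bar_ar V T (map (path_comp X) ps)) =
    path_comp X (a # concat (map tl ps)) \<cdot> bar_sub small V T (map (along (edge X)) ps)"
proof -
  note D = path_family[OF X ys ps]
  note ys' = D(1-4) and len = D(5) and psi = D(6)
  define xs where "xs = a # concat (map tl ps)"
  define Zss where "Zss = map (along (edge X)) ps"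
  note xs = D(7)[folded xs_def] and along_xs = D(8)[of "edge X", folded xs_def Zss_def] and Zss = D(9)[folded Zss_def]
  have xs': "xs \<in> lists (verts X)" "xs \<noteq> []" using xs by (auto simp: paths_iff)
  have "length (concat Zss) = length xs - 1" using length_along[of "edge X" xs] by (simp only: along_xs)
  then have len_xs: "length xs = Suc (length (concat Zss))" using xs'(2) by (cases xs) simp_all
  note nth1 = concat_path_nth(1)[OF ps ys'(2), where h = "edge X", folded Zss_def, unfolded ys'(3), folded xs_def]
    and nth2 = concat_path_nth(2)[OF ps ys'(2), where h = "edge X", folded Zss_def, unfolded ys'(3), folded xs_def]
  define Z where "Z = (sg (concat Zss) :: ('u, 'o) vgraph)"
  have Z: "vgraph Z" unfolding Z_def using Zss by (intro seq_graph_vgraph concat_Ob)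
  define p where "p = path_map V X xs"
  have p: "p \<in> hom G Z X" using path_map_hom[OF X xs'] by (simp add: p_def Z_def along_xs)
  have p_obj: "gobj p (vertex i) = xs ! i" if "i \<le> length (concat Zss)" for i
    using that xs'(2) len_xs by (simp add: p_def path_map_simps)
  have p_hom: "ghom p (vertex i) (vertex (Suc i)) = ident V (edge X (xs ! i) (xs ! Suc i))"
    if "i < length (concat Zss)" for i
    using that len_xs by (simp add: p_def path_map_simps)
  have len_Zss: "length Zss = length ps" "i < length ps \<Longrightarrow> length (Zss ! i) = length (ps ! i) - 1" for i
    by (simp_all add: Zss_def)
  \<comment> \<open>Restricted to block \<open>i\<close>, the path map of the concatenated path is
    the path map of the block. Under \<open>T\<close> this identifies the hom maps of
    \<open>mar T p \<star> \<tau>\<close> with the components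
    \<open>path_comp X (ps ! i)\<close>.\<close>
  have sub: "p \<star> subseq_map V Zss i = path_map V X (ps ! i)" if i: "i < length ps" for i
  proof -
    have s: "subseq_map V Zss i \<in> hom G (sg (Zss ! i)) Z"
      using subseq_map_hom[OF Zss] i len_Zss by (simp add: Z_def)
    have pi: "ps ! i \<in> lists (verts X)" "ps ! i \<noteq> []" using psi[OF i] by (auto simp: paths_iff)
    have q: "path_map V X (ps ! i) \<in> hom G (sg (Zss ! i)) X"
      using path_map_hom[OF X pi] i by (simp add: Zss_def)
    show ?thesis
    proof (rule seq_graph_map_eqI[OF G.cmp_hom[OF s p] q])
      fix j assume j: "j \<le> length (Zss ! i)"
      then have "j < length (ps ! i)" using len_Zss(2)[OF i] pi(2) by (cases "ps ! i") auto
      then show "gobj (p \<star> subseq_map V Zss i) (vertex j) = gobj (path_map V X (ps ! i)) (vertex j)"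
        using j i pi(2) offset_add_le[of i Zss j] nth1[OF i] len_Zss(1)
        by (simp add: ghom_G_cmp(1)[OF s] subseq_map_simps p_obj path_map_simps)
    next
      fix j assume j: "j < length (Zss ! i)"
      have e: "edge X (ps ! i ! j) (ps ! i ! Suc j) \<in> Ob V"
        using j pi(1) len_Zss(2)[OF i] by (intro edge_Ob[OF X] lists_nth[OF pi(1)]) simp_all
      have "Zss ! i ! j = edge X (ps ! i ! j) (ps ! i ! Suc j)" using i j by (simp add: Zss_def)
      then show "ghom (p \<star> subseq_map V Zss i) (vertex j) (vertex (Suc j)) =
          ghom (path_map V X (ps ! i)) (vertex j) (vertex (Suc j))"
        using j i offset_add_le[of i Zss "Suc j"] nth1[OF i, of j] nth1[OF i, of "Suc j"] len_Zss(1) len_Zss(2)[OF i]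
          ident_left[OF ident_hom[OF e]]
        by (simp add: ghom_G_cmp(2)[OF s] subseq_map_simps p_hom path_map_simps)
    qed
  qed
  \<comment> \<open>These are the hom maps of \<open>mar T p \<star> \<tau>\<close> on consecutive
    vertices, which the sequence map \<open>s\<close> below is built from.\<close>
  define ts where "ts = map (path_comp X) ps"
  have ts: "ts \<in> hom (seq_cat V) (map (bar_ob V T) Zss) (along (edge (mob T X)) ys)"
    using len psi by (intro seq_homI) (auto simp: ts_def Zss_def intro!: path_comp_hom[OF X])
  define \<tau> where "\<tau> = tau_map V T Zss"
  define W where "W = (sg (map (bar_ob V T) Zss) :: ('u, 'o) vgraph)"
  have \<tau>: "\<tau> \<in> hom G W (mob T Z)" using tau_map_hom[OF Zss] by (simp add: \<tau>_def W_def Z_def)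
  have W: "vgraph W" using graph_homD(1)[OF \<tau>] .
  have TX: "vgraph (mob T X)" using X by (rule mob_vgraph)
  have ysT: "ys \<in> lists (verts (mob T X))" using ys' by (simp add: verts_mob[OF X])
  note q = path_map_hom[OF TX ysT ys'(2)]
  define s where "s = seq_arrow (map (bar_ob V T) Zss) (along (edge (mob T X)) ys) ts"
  have s: "s \<in> hom G W (sg (along (edge (mob T X)) ys))" unfolding s_def W_def by (rule seq_arrow_hom[OF ts])
  note Tp = mar_hom[OF p]
  have vW0: "vertex i \<in> verts W" if "i \<le> length ps" for i using that len_Zss by (simp add: W_def)
  have \<tau>_obj: "gobj \<tau> (vertex i) = vertex (offset Zss i)"
    and s_obj: "gobj s (vertex i) = vertex i" if "i \<le> length ps" for i
    using that len_Zss by (simp_all add: \<tau>_def tau_map_simps s_def seq_map_simps)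
  have Tp\<tau>: "mar T p \<star> \<tau> = path_map V (mob T X) ys \<star> s"
  proof (rule seq_graph_map_eqI[OF G.cmp_hom[OF \<tau> Tp(1), unfolded W_def] G.cmp_hom[OF s q, unfolded W_def]])
    fix i assume "i \<le> length (map (bar_ob V T) Zss)"
    then show "gobj (mar T p \<star> \<tau>) (vertex i) = gobj (path_map V (mob T X) ys \<star> s) (vertex i)"
      using len ys'(2) len_Zss(1) nth2[of i] vW0[of i]
      by (simp add: ghom_G_cmp(1)[OF \<tau>] ghom_G_cmp(1)[OF s] Tp(2) \<tau>_obj s_obj p_obj offset_le path_map_simps)
  next
    fix i assume "i < length (map (bar_ob V T) Zss)"
    then have i: "i < length ps" using len_Zss by simp
    have s': "subseq_map V Zss i \<in> hom G (sg (Zss ! i)) Z"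
      using subseq_map_hom[OF Zss] i len_Zss by (simp add: Z_def)
    have "ghom (mar T p) (vertex (offset Zss i)) (vertex (offset Zss (Suc i))) \<cdot>
        ghom (mar T (subseq_map V Zss i)) (vertex 0) (vertex (length (Zss ! i))) = path_comp X (ps ! i)"
      using ghom_mar_cmp[OF s' p, of "vertex 0" "vertex (length (Zss ! i))"] i len_Zss
      by (simp add: sub[OF i] path_comp_def subseq_map_simps offset_Suc)
    moreover have "ident V (edge (mob T X) (ys ! i) (ys ! Suc i)) \<cdot> path_comp X (ps ! i) = path_comp X (ps ! i)"
      using path_comp_hom[OF X psi[OF i]] by (rule ident_left)
    ultimately show "ghom (mar T p \<star> \<tau>) (vertex i) (vertex (Suc i)) =
        ghom (path_map V (mob T X) ys \<star> s) (vertex i) (vertex (Suc i))"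
      using i len len_Zss vW0[of i] vW0[of "Suc i"]
      by (simp add: ghom_G_cmp(2)[OF \<tau>] ghom_G_cmp(2)[OF s] \<tau>_obj s_obj path_map_simps)
        (simp add: \<tau>_def tau_map_simps s_def seq_map_simps ts_def)
  qed
  note T\<tau> = mar_hom[OF \<tau>] and Ts = mar_hom[OF s] and Tq = mar_hom[OF q] and \<mu>Z = mu_hom[OF Z] and \<mu>X = mu_hom[OF X]
  have vW: "vertex i \<in> verts (mob T W)" if "i \<le> length ps" for i
    using vW0[OF that] by (simp add: verts_mob[OF W])
  have "mar T p \<star> (mu T Z \<star> mar T \<tau>) = (mu T X \<star> mar T (mar T p)) \<star> mar T \<tau>"
    using G.cmp_assoc[OF T\<tau>(1) \<mu>Z(1) Tp(1)] by (simp add: mu_nat[OF p])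
  also have "\<dots> = mu T X \<star> (mar T (mar T p) \<star> mar T \<tau>)"
    by (rule G.cmp_assoc[OF T\<tau>(1) mar_hom(1)[OF Tp(1)] \<mu>X(1)])
  also have "\<dots> = mu T X \<star> (mar T (path_map V (mob T X) ys) \<star> mar T s)"
    using mar_cmp[OF \<tau> Tp(1)] mar_cmp[OF s q] Tp\<tau> by simp
  finally have eq: "ghom (mar T p \<star> (mu T Z \<star> mar T \<tau>)) (vertex 0) (vertex (length ps)) =
      ghom (mu T X \<star> (mar T (path_map V (mob T X) ys) \<star> mar T s)) (vertex 0) (vertex (length ps))"
    by simp
  have Z_v: "vertex i \<in> verts Z \<longleftrightarrow> i \<le> length (concat Zss)" for i by (simp add: Z_def)
  have "offset Zss (length ps) = length (concat Zss)" using offset_length[of Zss] len_Zss by simp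
  then have "ghom (mar T p \<star> (mu T Z \<star> mar T \<tau>)) (vertex 0) (vertex (length ps)) =
      path_comp X xs \<cdot> bar_sub small V T Zss"
    using vW len_xs len_Zss \<mu>Z(2)
    by (simp add: ghom_G_cmp[OF G.cmp_hom[OF T\<tau>(1) \<mu>Z(1)]] ghom_G_cmp(1)[OF T\<tau>(1)] T\<tau>(2) \<tau>_obj Z_v)
      (simp add: path_comp_def bar_sub_def Z_def \<tau>_def p_def)
  moreover have "ghom (mu T X \<star> (mar T (path_map V (mob T X) ys) \<star> mar T s)) (vertex 0) (vertex (length ps)) =
      ghom (mu T X) a b \<cdot> (path_comp (mob T X) ys \<cdot> bar_ar V T ts)"
  proof -
    have qo: "gobj (path_map V (mob T X) ys) (vertex 0) = a"
      "gobj (path_map V (mob T X) ys) (vertex (length ps)) = b"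
      using len ys' by (simp_all add: path_map_simps hd_conv_nth last_conv_nth)
    have "bar_ar V T ts = ghom (mar T s) (vertex 0) (vertex (length ps))"
      using bar_ar_eq[OF ts] len_Zss by (simp add: s_def)
    then show ?thesis
      using vW len
      by (simp add: ghom_G_cmp[OF G.cmp_hom[OF Ts(1) Tq(1)]] ghom_G_cmp[OF Ts(1)] Ts(2) Tq(2) s_obj qo path_comp_def)
  qed
  ultimately show ?thesis using eq by (simp add: xs_def Zss_def ts_def)
qed

end

section \<open>The monad of a distributive multitensor\<close>

lemma (in category)
  assumes E: "is_multitensor C E"
  shows tob_Ob: "Xs \<in> lists (Ob C) \<Longrightarrow> tob E Xs \<in> Ob C"
    and tar_hom: "fs \<in> hom (seq_cat C) Xs Ys \<Longrightarrow> tar E fs \<in> hom C (tob E Xs) (tob E Ys)"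
    and tar_ident: "Xs \<in> lists (Ob C) \<Longrightarrow> tar E (map (ident C) Xs) = ident C (tob E Xs)"
    and tar_cmp: "fs \<in> hom (seq_cat C) Xs Ys \<Longrightarrow> gs \<in> hom (seq_cat C) Ys Zs \<Longrightarrow>
      tar E (map2 (\<cdot>) gs fs) = tar E gs \<cdot> tar E fs"
    and tunit_hom: "X \<in> Ob C \<Longrightarrow> tunit E X \<in> hom C X (tob E [X])"
    and tunit_nat: "f \<in> hom C X Y \<Longrightarrow> tunit E Y \<cdot> f = tar E [f] \<cdot> tunit E X"
    and tsub_hom: "Xss \<in> lists (lists (Ob C)) \<Longrightarrow>
      tsub E Xss \<in> hom C (tob E (map (tob E) Xss)) (tob E (concat Xss))"
    and tsub_nat: "fss \<in> hom (seq_cat (seq_cat C)) Xss Yss \<Longrightarrow>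
      tsub E Yss \<cdot> tar E (map (tar E) fss) = tar E (concat fss) \<cdot> tsub E Xss"
proof -
  have F: "is_functor (seq_cat C) C (tob E) (tar E)" using E by (simp add: is_multitensor_def)
  show "Xs \<in> lists (Ob C) \<Longrightarrow> tob E Xs \<in> Ob C"
    "fs \<in> hom (seq_cat C) Xs Ys \<Longrightarrow> tar E fs \<in> hom C (tob E Xs) (tob E Ys)"
    "Xs \<in> lists (Ob C) \<Longrightarrow> tar E (map (ident C) Xs) = ident C (tob E Xs)"
    "fs \<in> hom (seq_cat C) Xs Ys \<Longrightarrow> gs \<in> hom (seq_cat C) Ys Zs \<Longrightarrow>
      tar E (map2 (\<cdot>) gs fs) = tar E gs \<cdot> tar E fs"
    using seq_functorD[OF F] by blast+
  show "X \<in> Ob C \<Longrightarrow> tunit E X \<in> hom C X (tob E [X])"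
    using E by (simp add: is_multitensor_def is_nat_trans_def)
  show "f \<in> hom C X Y \<Longrightarrow> tunit E Y \<cdot> f = tar E [f] \<cdot> tunit E X"
    using E homD[of f C X Y] by (auto simp: is_multitensor_def is_nat_trans_def)
  have N: "is_nat_trans (seq_cat (seq_cat C)) C
       (\<lambda>Xss. tob E (map (tob E) Xss)) (\<lambda>fss. tar E (map (tar E) fss))
       (\<lambda>Xss. tob E (concat Xss)) (\<lambda>fss. tar E (concat fss)) (tsub E)"
    using E by (simp add: is_multitensor_def)
  have "Ob (seq_cat (seq_cat C)) = lists (lists (Ob C))" by (simp add: seq_cat_def)
  then show "Xss \<in> lists (lists (Ob C)) \<Longrightarrow>
      tsub E Xss \<in> hom C (tob E (map (tob E) Xss)) (tob E (concat Xss))"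
    using N by (simp add: is_nat_trans_def)
  show "fss \<in> hom (seq_cat (seq_cat C)) Xss Yss \<Longrightarrow>
      tsub E Yss \<cdot> tar E (map (tar E) fss) = tar E (concat fss) \<cdot> tsub E Xss"
    using N homD[of fss "seq_cat (seq_cat C)" Xss Yss] by (auto simp: is_nat_trans_def)
qed

locale distributive_multitensor = coproduct_category V small
  for V :: "('o, 'm) cat" (structure) and small :: "'u set \<Rightarrow> bool" +
  fixes E :: "('o, 'm) multitensor_data"
  assumes distributive: "is_distributive_multitensor small V E"
begin

lemma multitensor: "is_multitensor V E"
  using distributive by (simp add: is_distributive_multitensor_def)

lemmas E_Ob = tob_Ob[OF multitensor] and E_hom = tar_hom[OF multitensor]
  and E_ident = tar_ident[OF multitensor] and E_cmp = tar_cmp[OF multitensor]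
  and E_unit_hom = tunit_hom[OF multitensor] and E_sub_hom = tsub_hom[OF multitensor]

text \<open>Distributivity is postulated for index sets inside \<open>'u\<close>. The coproduct over
  lists is moved there along the inverse of a coding \<open>e\<close>, tensored, and moved back
  along \<open>e\<close>.\<close>

lemma tensor_coproduct:
  assumes "small A" "P \<subseteq> lists A" and c: "is_coproduct V P Z c \<iota>"
    and "Xs \<in> lists (Ob V)" "Ys \<in> lists (Ob V)"
  shows "is_coproduct V P (\<lambda>i. tob E (Xs @ Z i # Ys)) (tob E (Xs @ c # Ys))
    (\<lambda>i. tar E (map (ident V) Xs @ \<iota> i # map (ident V) Ys))"
proof -
  obtain e :: "'u list \<Rightarrow> 'u" where e: "bij_betw e P (e ` P)" "small (e ` P)"
    using small_lists_bij[OF assms(1,2)] by blast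
  let ?d = "the_inv_into P e"
  have d: "?d (e p) = p" if "p \<in> P" for p using e(1) that by (auto simp: bij_betw_def the_inv_into_f_f)
  from is_coproduct_reindex[OF c bij_betw_the_inv_into[OF e(1)]]
  have "is_coproduct V (e ` P) (\<lambda>i. tob E (Xs @ Z (?d i) # Ys)) (tob E (Xs @ c # Ys))
      (\<lambda>i. tar E (map (ident V) Xs @ \<iota> (?d i) # map (ident V) Ys))"
    using distributive assms(4,5) e(2) unfolding is_distributive_multitensor_def by blast
  from is_coproduct_reindex[OF this e(1)] show ?thesis
    by (rule is_coproduct_cong) (simp_all add: d)
qed

lemma tensor_initial:
  assumes "Xs \<in> lists (Ob V)" "i < length Xs" "is_initial V (Xs ! i)"
  shows "is_initial V (tob E Xs)"
proof -
  \<comment> \<open>The empty cocone needs some family of objects and arrows; the values are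
    immaterial, the types select lists as indices.\<close>
  define Z :: "'u list \<Rightarrow> 'o" where "Z = undefined"
  define \<iota> :: "'u list \<Rightarrow> 'm" where "\<iota> = undefined"
  have "is_coproduct V {} Z (Xs ! i) \<iota>" using assms(3) is_initial_iff_coproduct by blast
  moreover have "take i Xs \<in> lists (Ob V)" "drop (Suc i) Xs \<in> lists (Ob V)"
    using assms(1) by (auto simp: in_lists_conv_set dest: in_set_takeD in_set_dropD)
  ultimately show ?thesis
    using tensor_coproduct[of "{}" "{}" Z "Xs ! i" \<iota> "take i Xs" "drop (Suc i) Xs"] assms(2)
    by (simp add: small_finite id_take_nth_drop[symmetric] is_initial_iff_coproduct[symmetric])
qed

text \<open>Applying distributivity in one variable after the other. The prefix \<open>Xs\<close> collects the
  variables that are kept fixed.\<close>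

lemma tensor_coproducts:
  assumes "\<And>q. q \<in> set qs \<Longrightarrow> is_coproduct V (J q) Z (c q) \<iota>"
    and A: "small A" "\<And>q. q \<in> set qs \<Longrightarrow> J q \<subseteq> lists A"
    and "Xs \<in> lists (Ob V)"
  shows "is_coproduct V {ps. list_all2 (\<lambda>p q. p \<in> J q) ps qs} (\<lambda>ps. tob E (Xs @ map Z ps))
    (tob E (Xs @ map c qs)) (\<lambda>ps. tar E (map (ident V) Xs @ map \<iota> ps))"
  using assms
proof (induction qs arbitrary: Xs)
  case Nil
  then show ?case
    using is_coproduct_ident[of "\<lambda>ps. tob E (Xs @ map Z ps)" "[]" "tob E Xs" "\<lambda>ps. tar E (map (ident V) Xs @ map \<iota> ps)"]
    by (simp add: E_Ob E_ident)
next
  case (Cons q qs)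
  have q: "is_coproduct V (J q) Z (c q) \<iota>" and Jq: "J q \<subseteq> lists A" using Cons.prems(1,3) by auto
  have XsO: "Xs \<in> lists (Ob V)" by fact
  have cq: "c q \<in> Ob V" and \<iota>q: "\<And>p. p \<in> J q \<Longrightarrow> \<iota> p \<in> hom V (Z p) (c q)" "\<And>p. p \<in> J q \<Longrightarrow> Z p \<in> Ob V"
    using coproduct_hom[OF q] by auto
  let ?P = "{ps. list_all2 (\<lambda>p q. p \<in> J q) ps qs}"
  have ps: "map Z ps \<in> lists (Ob V)" "map \<iota> ps \<in> hom (seq_cat V) (map Z ps) (map c qs)" if "ps \<in> ?P" for ps
  proof -
    have l: "length ps = length qs" "\<And>i. i < length qs \<Longrightarrow> ps ! i \<in> J (qs ! i)"
      using that by (auto simp: list_all2_conv_all_nth)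
    show "map \<iota> ps \<in> hom (seq_cat V) (map Z ps) (map c qs)"
      using l coproduct_hom(2)[OF Cons.prems(1)] by (intro seq_homI) auto
    then show "map Z ps \<in> lists (Ob V)" using seq_hom_Ob by blast
  qed
  \<comment> \<open>The variables after \<open>q\<close> are expanded while \<open>c q\<close> is
    kept fixed in the prefix; the variable \<open>q\<close> itself is expanded inside each resulting
    summand. The nested index is therefore the pair of tail and head.\<close>
  have "is_coproduct V ?P (\<lambda>ps. tob E ((Xs @ [c q]) @ map Z ps)) (tob E ((Xs @ [c q]) @ map c qs))
      (\<lambda>ps. tar E (map (ident V) (Xs @ [c q]) @ map \<iota> ps))"
    using Cons.prems XsO cq by (intro Cons.IH) auto
  moreover have "is_coproduct V (J q) (\<lambda>p. tob E (Xs @ Z p # map Z ps)) (tob E ((Xs @ [c q]) @ map Z ps))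
      (\<lambda>p. tar E (map (ident V) Xs @ \<iota> p # map (ident V) (map Z ps)))" if "ps \<in> ?P" for ps
    using tensor_coproduct[OF A(1) Jq q XsO ps(1)[OF that]] by simp
  ultimately have sig: "is_coproduct V (Sigma ?P (\<lambda>_. J q)) (\<lambda>(ps, p). tob E (Xs @ Z p # map Z ps))
      (tob E ((Xs @ [c q]) @ map c qs))
      (\<lambda>(ps, p). tar E (map (ident V) (Xs @ [c q]) @ map \<iota> ps) \<cdot>
        tar E (map (ident V) Xs @ \<iota> p # map (ident V) (map Z ps)))"
    by (rule is_coproduct_Sigma[where W = "\<lambda>ps p. tob E (Xs @ Z p # map Z ps)"])
  have bij: "bij_betw (\<lambda>ps. (tl ps, hd ps)) {ps. list_all2 (\<lambda>p q. p \<in> J q) ps (q # qs)} (Sigma ?P (\<lambda>_. J q))"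
    by (rule bij_betw_byWitness[where f' = "\<lambda>(ps, p). p # ps"]) (auto simp: list_all2_Cons2)
  \<comment> \<open>By functoriality the two successive inclusions merge into one: in each position
    one of the two factors is an identity.\<close>
  have cmp: "tar E (map (ident V) (Xs @ [c q]) @ map \<iota> ps) \<cdot>
        tar E (map (ident V) Xs @ \<iota> p # map (ident V) (map Z ps)) = tar E (map (ident V) Xs @ \<iota> p # map \<iota> ps)"
    if "ps \<in> ?P" "p \<in> J q" for ps p
  proof -
    have f: "map (ident V) Xs @ \<iota> p # map (ident V) (map Z ps) \<in>
        hom (seq_cat V) (Xs @ Z p # map Z ps) (Xs @ c q # map Z ps)"
      using ps[OF that(1)] XsO \<iota>q[OF that(2)] by (intro seq_hom_append seq_hom_Cons seq_hom_ident)
    have g: "map (ident V) (Xs @ [c q]) @ map \<iota> ps \<in> hom (seq_cat V) (Xs @ c q # map Z ps) (Xs @ c q # map c qs)"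
      using seq_hom_append[OF seq_hom_ident[of "Xs @ [c q]"] ps(2)[OF that(1)]] XsO cq by simp
    have 1: "map2 (\<cdot>) (map (ident V) Xs) (map (ident V) Xs) = map (ident V) Xs"
      using XsO by (auto simp: map2_map_map in_lists_conv_set ident_left[OF ident_hom])
    have 2: "map2 (\<cdot>) (map \<iota> ps) (map (ident V) (map Z ps)) = map \<iota> ps"
    proof (rule nth_equalityI)
      fix i assume "i < length (map2 (\<cdot>) (map \<iota> ps) (map (ident V) (map Z ps)))"
      then have "i < length ps" by simp
      then have "ps ! i \<in> J (qs ! i)" "qs ! i \<in> set (q # qs)"
        using that(1) by (auto simp: list_all2_conv_all_nth)
      then show "map2 (\<cdot>) (map \<iota> ps) (map (ident V) (map Z ps)) ! i = map \<iota> ps ! i"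
        using ident_right[OF coproduct_hom(2)[OF Cons.prems(1)]] \<open>i < length ps\<close> by simp
    qed simp
    show ?thesis
      using E_cmp[OF f g] 1 2 ident_left[OF \<iota>q(1)[OF that(2)]] by simp
  qed
  show ?case
  proof (rule is_coproduct_cong)
    show "is_coproduct V {ps. list_all2 (\<lambda>p q. p \<in> J q) ps (q # qs)}
        (\<lambda>ps. case (tl ps, hd ps) of (ps, p) \<Rightarrow> tob E (Xs @ Z p # map Z ps)) (tob E (Xs @ map c (q # qs)))
        (\<lambda>ps. case (tl ps, hd ps) of (ps, p) \<Rightarrow> tar E (map (ident V) (Xs @ [c q]) @ map \<iota> ps) \<cdot>
          tar E (map (ident V) Xs @ \<iota> p # map (ident V) (map Z ps)))"
      using is_coproduct_reindex[OF sig bij] by simp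
  qed (auto simp: list_all2_Cons2 cmp simp del: map_append map_map)
qed

section \<open>The Gamma construction evaluated on summands\<close>

lemma path_tensor_Ob: "vgraph X \<Longrightarrow> xs \<in> lists (verts X) \<Longrightarrow> path_tensor E X xs \<in> Ob V"
  unfolding path_tensor_def by (intro E_Ob along_edge_Ob)

lemma paths_subset: "paths X a b \<subseteq> lists (verts X)"
  by (auto simp: paths_def)

lemma verts_Gamma [simp]: "verts (Gamma_ob V E X) = verts X"
  by (simp add: Gamma_ob_def)

lemma paths_coproduct:
  assumes "vgraph X"
  shows "is_coproduct V (paths X a b) (path_tensor E X) (coprod V (paths X a b) (path_tensor E X))
    (incl V (paths X a b) (path_tensor E X))"
  by (rule is_coproduct_chosen[OF vgraph_small[OF assms] paths_subset])
    (rule path_tensor_Ob[OF assms subsetD[OF paths_subset]])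

text \<open>\<open>Gamma_incl\<close> reads the endpoints off the path, whereas \<open>incl\<close>
  is given the index set. On \<open>paths X a b\<close> the two agree, so one family of inclusions
  serves all pairs \<open>a\<close>, \<open>b\<close>.\<close>

lemma Gamma_coproduct:
  assumes X: "vgraph X" and ab: "a \<in> verts X" "b \<in> verts X"
  shows "is_coproduct V (paths X a b) (path_tensor E X) (edge (Gamma_ob V E X) a b) (Gamma_incl V E X)"
proof -
  have "is_coproduct V (paths X a b) (path_tensor E X) (edge (Gamma_ob V E X) a b)
      (incl V (paths X a b) (path_tensor E X))"
    using paths_coproduct[OF X] ab by (simp add: Gamma_ob_def restrict2_in)
  then show ?thesis by (rule is_coproduct_cong) (auto simp: Gamma_incl_def paths_iff)
qed

lemma Gamma_vgraph: "vgraph X \<Longrightarrow> vgraph (Gamma_ob V E X)"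
  using coproduct_hom(1)[OF Gamma_coproduct] vgraph_small[of X] unfolding is_vgraph_def[of small V "Gamma_ob V E X"]
  by (auto simp: Gamma_ob_def extensional2_restrict2)

lemma Gamma_incl_hom:
  assumes "vgraph X" "xs \<in> paths X a b"
  shows "Gamma_incl V E X xs \<in> hom V (tob E (along (edge X) xs)) (edge (Gamma_ob V E X) a b)"
  using coproduct_hom(2)[OF Gamma_coproduct[OF assms(1) paths_ends[OF assms(2)]] assms(2)] by (simp add: path_tensor_def)

lemma map_gobj_paths: "f \<in> hom G X Y \<Longrightarrow> xs \<in> paths X a b \<Longrightarrow> map (gobj f) xs \<in> paths Y (gobj f a) (gobj f b)"
  using graph_homD(5) by (fastforce simp: paths_iff in_lists_conv_set hd_map last_map)

lemma Gamma_ar_hom: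
  assumes f: "f \<in> hom G X Y"
  shows "Gamma_ar V E f \<in> hom G (Gamma_ob V E X) (Gamma_ob V E Y)"
    and "gobj (Gamma_ar V E f) = gobj f"
    and "xs \<in> paths X a b \<Longrightarrow> ghom (Gamma_ar V E f) a b \<cdot> Gamma_incl V E X xs =
      Gamma_incl V E Y (map (gobj f) xs) \<cdot> tar E (along (ghom f) xs)"
proof -
  note X = graph_homD(1)[OF f] and Y = graph_homD(2)[OF f]
  have src: "gsrc f = X" "gtgt f = Y" using graph_homD[OF f] by auto
  let ?g = "\<lambda>xs. Gamma_incl V E Y (map (gobj f) xs) \<cdot> tar E (along (ghom f) xs)"
  have g: "?g xs \<in> hom V (path_tensor E X xs) (edge (Gamma_ob V E Y) (gobj f a) (gobj f b))"
    if xs: "xs \<in> paths X a b" for xs a b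
    using cmp_hom[OF E_hom[OF along_ghom[OF f]] Gamma_incl_hom[OF Y map_gobj_paths[OF f xs]]] xs
    by (auto simp: paths_iff path_tensor_def)
  note c = paths_coproduct[OF X]
  have d: "edge (Gamma_ob V E Y) (gobj f a) (gobj f b) \<in> Ob V" if "a \<in> verts X" "b \<in> verts X" for a b
    using that graph_homD(5)[OF f] edge_Ob[OF Gamma_vgraph[OF Y]] by simp
  have eq: "ghom (Gamma_ar V E f) a b = cotuple V (paths X a b) (path_tensor E X)
      (edge (Gamma_ob V E Y) (gobj f a) (gobj f b)) ?g" if "a \<in> verts X" "b \<in> verts X" for a b
    using that by (simp add: Gamma_ar_def src restrict2_in)
  show "gobj (Gamma_ar V E f) = gobj f" by (simp add: Gamma_ar_def)
  show "ghom (Gamma_ar V E f) a b \<cdot> Gamma_incl V E X xs = ?g xs" if "xs \<in> paths X a b"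
    using cotuple(2)[OF c[of a b] d g that] that paths_ends[OF that]
    by (auto simp: eq Gamma_incl_def paths_iff)
  show "Gamma_ar V E f \<in> hom G (Gamma_ob V E X) (Gamma_ob V E Y)"
  proof (rule graph_homI)
    show "ghom (Gamma_ar V E f) a b \<in> hom V (edge (Gamma_ob V E X) a b)
        (edge (Gamma_ob V E Y) (gobj (Gamma_ar V E f) a) (gobj (Gamma_ar V E f) b))"
      if "a \<in> verts (Gamma_ob V E X)" "b \<in> verts (Gamma_ob V E X)" for a b
      using cotuple(1)[OF c[of a b] d g] that
      by (simp add: eq) (simp add: Gamma_ar_def Gamma_ob_def restrict2_in)
    show "gobj (Gamma_ar V E f) \<in> extensional (verts (Gamma_ob V E X))"
      using f by (auto simp: Gamma_ar_def graph_hom_iff PiE_def)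
  qed (use X Y graph_homD(5)[OF f] in \<open>auto simp: Gamma_ar_def src extensional2_restrict2 intro: Gamma_vgraph\<close>)
qed

lemma Gamma_eta_hom:
  assumes X: "vgraph X"
  shows "Gamma_eta V E X \<in> hom G X (Gamma_ob V E X)"
    and "a \<in> verts X \<Longrightarrow> gobj (Gamma_eta V E X) a = a"
    and "a \<in> verts X \<Longrightarrow> b \<in> verts X \<Longrightarrow>
      ghom (Gamma_eta V E X) a b = Gamma_incl V E X [a, b] \<cdot> tunit E (edge X a b)"
proof -
  show "Gamma_eta V E X \<in> hom G X (Gamma_ob V E X)"
  proof (rule graph_homI)
    show "ghom (Gamma_eta V E X) a b \<in> hom V (edge X a b)
        (edge (Gamma_ob V E X) (gobj (Gamma_eta V E X) a) (gobj (Gamma_eta V E X) b))"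
      if ab: "a \<in> verts X" "b \<in> verts X" for a b
    proof -
      have p: "[a, b] \<in> paths X a b" using ab by (simp add: paths_iff)
      show ?thesis
        using cmp_hom[OF E_unit_hom[OF edge_Ob[OF X ab]]] Gamma_incl_hom[OF X p] ab
        by (simp add: Gamma_eta_def restrict2_in along_def)
    qed
  qed (use X in \<open>auto simp: Gamma_eta_def extensional2_restrict2 intro: Gamma_vgraph\<close>)
qed (simp_all add: Gamma_eta_def restrict2_in)

text \<open>This is the form of index set that \<open>tensor_coproducts\<close> produces, with the
  pairs of consecutive vertices of \<open>ys\<close> as its variables.\<close>

lemma path_families_zip:
  "path_families X ys = {ps. list_all2 (\<lambda>p q. p \<in> paths X (fst q) (snd q)) ps (zip (butlast ys) (tl ys))}"
  if "ys \<noteq> []"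
  using that by (auto simp: path_families_def list_all2_conv_all_nth nth_butlast nth_tl)

text \<open>The outer coproduct runs over the paths \<open>ys\<close>; distributivity in all
  variables splits each of its summands over the families lying above \<open>ys\<close>. Equations
  between maps out of the twofold construct can thus be tested on the pairs
  \<open>(ys, ps)\<close>.\<close>

lemma Gamma_Gamma_coproduct:
  assumes X: "vgraph X" and ab: "a \<in> verts X" "b \<in> verts X"
  shows "is_coproduct V (Sigma (paths X a b) (path_families X)) (\<lambda>(ys, ps). tob E (map (path_tensor E X) ps))
    (edge (Gamma_ob V E (Gamma_ob V E X)) a b)
    (\<lambda>(ys, ps). Gamma_incl V E (Gamma_ob V E X) ys \<cdot> tar E (map (Gamma_incl V E X) ps))"
proof (rule is_coproduct_Sigma)
  note GX = Gamma_vgraph[OF X]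
  have paths: "paths (Gamma_ob V E X) a b = paths X a b" by (simp add: paths_def)
  show "is_coproduct V (paths X a b) (path_tensor E (Gamma_ob V E X))
      (edge (Gamma_ob V E (Gamma_ob V E X)) a b) (Gamma_incl V E (Gamma_ob V E X))"
    using Gamma_coproduct[OF GX, of a b] ab by (simp add: paths)
  fix ys assume "ys \<in> paths X a b"
  then have ys: "ys \<in> lists (verts X)" "ys \<noteq> []" by (auto simp: paths_iff)
  have "is_coproduct V {ps. list_all2 (\<lambda>p q. p \<in> paths X (fst q) (snd q)) ps (zip (butlast ys) (tl ys))}
      (\<lambda>ps. tob E ([] @ map (path_tensor E X) ps))
      (tob E ([] @ map (\<lambda>q. edge (Gamma_ob V E X) (fst q) (snd q)) (zip (butlast ys) (tl ys))))
      (\<lambda>ps. tar E (map (ident V) [] @ map (Gamma_incl V E X) ps))"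
  proof (rule tensor_coproducts[where A = "verts X"])
    fix q assume "q \<in> set (zip (butlast ys) (tl ys))"
    then have "fst q \<in> set (butlast ys)" "snd q \<in> set (tl ys)"
      using set_zip_leftD[of "fst q" "snd q"] set_zip_rightD[of "fst q" "snd q"] by auto
    then have "fst q \<in> set ys" "snd q \<in> set ys"
      using in_set_butlastD list.set_sel(2)[OF ys(2)] by fast+
    then have "fst q \<in> verts X" "snd q \<in> verts X" using ys(1) by (auto simp: in_lists_conv_set)
    then show "is_coproduct V (paths X (fst q) (snd q)) (path_tensor E X)
        (edge (Gamma_ob V E X) (fst q) (snd q)) (Gamma_incl V E X)"
      by (rule Gamma_coproduct[OF X])
  qed (simp_all add: vgraph_small[OF X] paths_subset)
  then show "is_coproduct V (path_families X ys) (\<lambda>ps. tob E (map (path_tensor E X) ps))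
      (path_tensor E (Gamma_ob V E X) ys) (\<lambda>ps. tar E (map (Gamma_incl V E X) ps))"
    using ys(2) by (simp add: path_families_zip path_tensor_def along_def case_prod_unfold)
qed

text \<open>The description in \<open>Gamma_mu\<close> prescribes a map on the summands of a
  coproduct, so the \<open>THE\<close> there has exactly one candidate.\<close>

lemma Gamma_mu_hom:
  assumes X: "vgraph X"
  shows "Gamma_mu V E X \<in> hom G (Gamma_ob V E (Gamma_ob V E X)) (Gamma_ob V E X)"
    and "a \<in> verts X \<Longrightarrow> gobj (Gamma_mu V E X) a = a"
    and "ys \<in> paths X a b \<Longrightarrow> ps \<in> path_families X ys \<Longrightarrow>
      ghom (Gamma_mu V E X) a b \<cdot> (Gamma_incl V E (Gamma_ob V E X) ys \<cdot> tar E (map (Gamma_incl V E X) ps)) =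
      Gamma_incl V E X (a # concat (map tl ps)) \<cdot> tsub E (map (along (edge X)) ps)"
proof -
  have "ghom (Gamma_mu V E X) a b \<in> hom V (edge (Gamma_ob V E (Gamma_ob V E X)) a b) (edge (Gamma_ob V E X) a b) \<and>
      (\<forall>ys \<in> paths X a b. \<forall>ps \<in> path_families X ys.
        ghom (Gamma_mu V E X) a b \<cdot> (Gamma_incl V E (Gamma_ob V E X) ys \<cdot> tar E (map (Gamma_incl V E X) ps)) =
        Gamma_incl V E X (a # concat (map tl ps)) \<cdot> tsub E (map (along (edge X)) ps))"
    if ab: "a \<in> verts X" "b \<in> verts X" for a b
  proof -
    let ?g = "\<lambda>(ys :: 'u list, ps). Gamma_incl V E X (a # concat (map tl ps)) \<cdot> tsub E (map (along (edge X)) ps)"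
    have "?g p \<in> hom V (case p of (ys, ps) \<Rightarrow> tob E (map (path_tensor E X) ps)) (edge (Gamma_ob V E X) a b)"
      if pS: "p \<in> Sigma (paths X a b) (path_families X)" for p
    proof -
      obtain ys ps where p: "p = (ys, ps)" "ys \<in> paths X a b" "ps \<in> path_families X ys" using pS by blast
      note D = path_family[OF X p(2,3)]
      have t: "tsub E (map (along (edge X)) ps) \<in>
          hom V (tob E (map (path_tensor E X) ps)) (tob E (along (edge X) (a # concat (map tl ps))))"
        using E_sub_hom[OF D(9)] by (simp add: D(8) comp_def path_tensor_def[abs_def])
      show ?thesis
        using cmp_hom[OF t Gamma_incl_hom[OF X D(7)]] p(1) by simp
    qed
    then have "\<exists>!h. h \<in> hom V (edge (Gamma_ob V E (Gamma_ob V E X)) a b) (edge (Gamma_ob V E X) a b) \<and>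
        (\<forall>p \<in> Sigma (paths X a b) (path_families X). h \<cdot> (case p of (ys, ps) \<Rightarrow>
          Gamma_incl V E (Gamma_ob V E X) ys \<cdot> tar E (map (Gamma_incl V E X) ps)) = ?g p)"
      using ab by (intro coproduct_ex1[OF Gamma_Gamma_coproduct[OF X ab]] edge_Ob[OF Gamma_vgraph[OF X]]) simp_all
    then have "\<exists>!h. h \<in> hom V (edge (Gamma_ob V E (Gamma_ob V E X)) a b) (edge (Gamma_ob V E X) a b) \<and>
        (\<forall>ys \<in> paths X a b. \<forall>ps \<in> path_families X ys.
          h \<cdot> (Gamma_incl V E (Gamma_ob V E X) ys \<cdot> tar E (map (Gamma_incl V E X) ps)) =
          Gamma_incl V E X (a # concat (map tl ps)) \<cdot> tsub E (map (along (edge X)) ps))"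
      by simp
    from theI'[OF this] show ?thesis using ab by (simp add: Gamma_mu_def restrict2_in)
  qed
  note * = this
  show "ghom (Gamma_mu V E X) a b \<cdot> (Gamma_incl V E (Gamma_ob V E X) ys \<cdot> tar E (map (Gamma_incl V E X) ps)) =
      Gamma_incl V E X (a # concat (map tl ps)) \<cdot> tsub E (map (along (edge X)) ps)"
    if "ys \<in> paths X a b" "ps \<in> path_families X ys"
    using *[of a b] paths_ends[OF that(1)] that by simp
  show "Gamma_mu V E X \<in> hom G (Gamma_ob V E (Gamma_ob V E X)) (Gamma_ob V E X)"
  proof (rule graph_homI)
    show "ghom (Gamma_mu V E X) a b \<in> hom V (edge (Gamma_ob V E (Gamma_ob V E X)) a b)
        (edge (Gamma_ob V E X) (gobj (Gamma_mu V E X) a) (gobj (Gamma_mu V E X) b))"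
      if "a \<in> verts (Gamma_ob V E (Gamma_ob V E X))" "b \<in> verts (Gamma_ob V E (Gamma_ob V E X))" for a b
      using * that by (simp add: Gamma_mu_def)
  qed (use X in \<open>auto simp: Gamma_mu_def extensional2_restrict2 intro: Gamma_vgraph\<close>)
qed (simp add: Gamma_mu_def)

end

section \<open>Inverting isomorphisms of monads\<close>

text \<open>Functoriality of either monad is enough: it is applied to \<open>\<phi> X \<star> \<psi> X = 1\<close>, on whichever side of
  the naturality square of \<open>\<phi>\<close> it is available.\<close>

lemma (in coproduct_category) monads_over_Set_isomorphic_sym:
  assumes iso: "monads_over_Set_isomorphic small V S T"
    and is_fun: "is_functor G G (mob S) (mar S) \<or> is_functor G G (mob T) (mar T)"
    and S_Ob: "\<And>X. vgraph X \<Longrightarrow> vgraph (mob S X)" and T_Ob: "\<And>X. vgraph X \<Longrightarrow> vgraph (mob T X)"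
    and S_hom: "\<And>f X Y. f \<in> hom G X Y \<Longrightarrow> mar S f \<in> hom G (mob S X) (mob S Y)"
    and T_hom: "\<And>f X Y. f \<in> hom G X Y \<Longrightarrow> mar T f \<in> hom G (mob T X) (mob T Y)"
    and vS: "\<And>X. vgraph X \<Longrightarrow> verts (mob S X) = verts X"
    and vT: "\<And>X. vgraph X \<Longrightarrow> verts (mob T X) = verts X"
    and eta_S: "\<And>X. vgraph X \<Longrightarrow> eta S X \<in> hom G X (mob S X)"
    and mu_S: "\<And>X. vgraph X \<Longrightarrow> mu S X \<in> hom G (mob S (mob S X)) (mob S X)"
    and mu_T: "\<And>X. vgraph X \<Longrightarrow> mu T X \<in> hom G (mob T (mob T X)) (mob T X)"
  shows "monads_over_Set_isomorphic small V T S"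
proof -
  obtain \<phi> where nat: "is_nat_trans G G (mob S) (mar S) (mob T) (mar T) \<phi>"
    and \<phi>: "\<And>X. vgraph X \<Longrightarrow> is_iso G (\<phi> X) \<and> gobj (\<phi> X) = (\<lambda>a \<in> verts X. a) \<and>
      \<phi> X \<star> eta S X = eta T X \<and>
      \<phi> X \<star> mu S X = mu T X \<star> (mar T (\<phi> X) \<star> \<phi> (mob S X))"
    using iso by (auto simp: monads_over_Set_isomorphic_def Let_def)
  have \<phi>_hom: "\<phi> X \<in> hom G (mob S X) (mob T X)" if "vgraph X" for X
    using nat that by (simp add: is_nat_trans_def)
  have \<phi>_nat: "\<phi> Y \<star> mar S f = mar T f \<star> \<phi> X" if "f \<in> hom G X Y" for f X Y
    using nat homD[OF that] by (auto simp: is_nat_trans_def)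
  have "\<exists>k. k \<in> hom G (mob T X) (mob S X) \<and> k \<star> \<phi> X = ident G (mob S X) \<and> \<phi> X \<star> k = ident G (mob T X)"
    if "vgraph X" for X
    using G.is_isoE[OF _ \<phi>_hom[OF that]] \<phi>[OF that] by metis
  then obtain \<psi> where \<psi>: "\<psi> X \<in> hom G (mob T X) (mob S X)"
    "\<psi> X \<star> \<phi> X = ident G (mob S X)" "\<phi> X \<star> \<psi> X = ident G (mob T X)"
    if "vgraph X" for X by metis
  have gobj_\<psi>: "gobj (\<psi> X) = (\<lambda>a \<in> verts X. a)" if X: "vgraph X" for X
  proof (rule PiE_ext)
    have "gobj (\<psi> X) \<in> verts (mob T X) \<rightarrow>\<^sub>E verts (mob S X)" using \<psi>(1)[OF X] by (simp add: graph_hom_iff)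
    then show mem: "gobj (\<psi> X) \<in> verts X \<rightarrow>\<^sub>E verts X" by (simp add: vS[OF X] vT[OF X])
    show "gobj (\<psi> X) a = (\<lambda>a \<in> verts X. a) a" if a: "a \<in> verts X" for a
    proof -
      have "gobj (\<phi> X) (gobj (\<psi> X) a) = a"
        using ghom_G_cmp(1)[OF \<psi>(1)[OF X], of a "\<phi> X"] ghom_G_ident(1)[of a "mob T X"] \<psi>(3)[OF X] a
        by (simp add: vT[OF X])
      moreover have "gobj (\<psi> X) a \<in> verts X" using mem a by auto
      ultimately show ?thesis using \<phi>[OF X] a by simp
    qed
  qed simp
  show ?thesis
    unfolding monads_over_Set_isomorphic_def Let_def
  proof (intro exI conjI ballI)
    show "is_nat_trans G G (mob T) (mar T) (mob S) (mar S) \<psi>"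
      unfolding is_nat_trans_def
    proof (intro conjI ballI)
      show "\<psi> X \<in> hom G (mob T X) (mob S X)" if "X \<in> Ob G" for X using \<psi>(1) that by simp
      fix f assume "f \<in> Ar G"
      then obtain X Y where f: "f \<in> hom G X Y" "Dom G f = X" "Cod G f = Y" using G.Ar_hom by blast
      note X = graph_homD(1)[OF f(1)] and Y = graph_homD(2)[OF f(1)]
      note H = \<psi>(1)[OF X] \<psi>(1)[OF Y] \<phi>_hom[OF X] \<phi>_hom[OF Y] S_hom[OF f(1)] T_hom[OF f(1)]
      have "\<psi> Y \<star> mar T f = \<psi> Y \<star> (mar T f \<star> (\<phi> X \<star> \<psi> X))"
        using H[THEN homD] by (simp add: G.Ar_simps \<psi>(3)[OF X])
      also have "\<dots> = \<psi> Y \<star> ((mar T f \<star> \<phi> X) \<star> \<psi> X)"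
        using H[THEN homD] by (simp add: G.cmp_assoc_Ar)
      also have "\<dots> = mar S f \<star> \<psi> X"
        using H[THEN homD] by (simp add: \<phi>_nat[OF f(1), symmetric] G.Ar_simps G.cmp_chain[OF \<psi>(2)[OF Y]])
      finally show "\<psi> (Cod G f) \<star> mar T f = mar S f \<star> \<psi> (Dom G f)" by (simp add: f)
    qed
    fix X assume "X \<in> Ob G"
    then have X: "vgraph X" by simp
    note SX = S_Ob[OF X] and TX = T_Ob[OF X]
    show "is_iso G (\<psi> X)" using G.is_isoI[OF \<psi>(1)[OF X] \<phi>_hom[OF X] \<psi>(3,2)[OF X]] .
    show "gobj (\<psi> X) = (\<lambda>a \<in> verts X. a)" using gobj_\<psi>[OF X] .
    show "\<psi> X \<star> eta T X = eta S X"
      using \<phi>[OF X] homD[OF \<psi>(1)[OF X]] homD[OF \<phi>_hom[OF X]] homD[OF eta_S[OF X]]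
      by (metis G.cmp_assoc_Ar G.ident_left_Ar \<psi>(2)[OF X])
    have S\<psi>: "mar S (\<psi> X) \<in> hom G (mob S (mob T X)) (mob S (mob S X))"
      and T\<psi>: "mar T (\<psi> X) \<in> hom G (mob T (mob T X)) (mob T (mob S X))"
      and T\<phi>: "mar T (\<phi> X) \<in> hom G (mob T (mob S X)) (mob T (mob T X))"
      using S_hom T_hom \<psi>(1)[OF X] \<phi>_hom[OF X] by auto
    have S\<phi>: "mar S (\<phi> X) \<in> hom G (mob S (mob S X)) (mob S (mob T X))"
      using S_hom \<phi>_hom[OF X] by blast
    note H = \<psi>(1)[OF X] \<phi>_hom[OF X] \<phi>_hom[OF SX] \<phi>_hom[OF TX] \<psi>(1)[OF TX] S\<psi> S\<phi> T\<psi> T\<phi> mu_S[OF X] mu_T[OF X]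
    \<comment> \<open>A right inverse of \<open>mar T (\<phi> X) \<star> \<phi> (mob S X)\<close>,
      the arrow through which \<phi> compares the multiplications. Composing the multiplication law
      of \<phi> with it isolates \<open>mu T X\<close>.\<close>
    have inv: "mar T (\<phi> X) \<star> (\<phi> (mob S X) \<star> (mar S (\<psi> X) \<star> \<psi> (mob T X))) = ident G (mob T (mob T X))"
      using is_fun
    proof
      assume T: "is_functor G G (mob T) (mar T)"
      then have "mar T (\<phi> X \<star> \<psi> X) = mar T (\<phi> X) \<star> mar T (\<psi> X)"
        using H[THEN homD] by (simp add: is_functor_def)
      then have "mar T (\<phi> X) \<star> mar T (\<psi> X) = ident G (mob T (mob T X))"
        using T TX by (simp add: \<psi>(3)[OF X] is_functor_def)
      then show ?thesis
        using H[THEN homD] by (simp add: G.cmp_chain[OF \<phi>_nat[OF \<psi>(1)[OF X]]] G.Ar_simps \<psi>(3)[OF TX])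
    next
      assume S: "is_functor G G (mob S) (mar S)"
      then have "mar S (\<phi> X \<star> \<psi> X) = mar S (\<phi> X) \<star> mar S (\<psi> X)"
        using H[THEN homD] by (simp add: is_functor_def)
      then have "mar S (\<phi> X) \<star> mar S (\<psi> X) = ident G (mob S (mob T X))"
        using S TX by (simp add: \<psi>(3)[OF X] is_functor_def)
      then show ?thesis
        using H[THEN homD] by (simp add: G.cmp_chain[OF \<phi>_nat[OF \<phi>_hom[OF X], symmetric]] G.Ar_simps
            G.cmp_chain[of "mar S (\<phi> X)" "mar S (\<psi> X)"] \<psi>(3)[OF TX])
    qed
    \<comment> \<open>Proved after composing both sides with the invertible \<open>\<phi> X\<close>,
      where each becomes \<open>mu T X\<close>.\<close>
    show "\<psi> X \<star> mu T X = mu S X \<star> (mar S (\<psi> X) \<star> \<psi> (mob T X))"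
    proof (rule G.iso_cancel_left[OF _ \<phi>_hom[OF X]])
      show "is_iso G (\<phi> X)" using \<phi>[OF X] by simp
      show "\<psi> X \<star> mu T X \<in> hom G (mob T (mob T X)) (mob S X)"
        "mu S X \<star> (mar S (\<psi> X) \<star> \<psi> (mob T X)) \<in> hom G (mob T (mob T X)) (mob S X)"
        using H[THEN homD] by (auto intro!: homI simp: G.Ar_simps)
      have "\<phi> X \<star> (mu S X \<star> (mar S (\<psi> X) \<star> \<psi> (mob T X))) =
        (\<phi> X \<star> mu S X) \<star> (mar S (\<psi> X) \<star> \<psi> (mob T X))"
        using H[THEN homD] by (simp add: G.Ar_simps)
      also have "\<dots> = mu T X"
        using H[THEN homD] \<phi>[OF X] by (simp add: G.Ar_simps inv)
      also have "\<dots> = \<phi> X \<star> (\<psi> X \<star> mu T X)"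
        using H[THEN homD] by (simp add: G.cmp_chain[OF \<psi>(3)[OF X]] G.Ar_simps)
      finally show "\<phi> X \<star> (\<psi> X \<star> mu T X) =
        \<phi> X \<star> (mu S X \<star> (mar S (\<psi> X) \<star> \<psi> (mob T X)))" by simp
    qed
  qed
qed

section \<open>Transporting multitensors along isomorphisms\<close>

text \<open>For \<open>F\<close> only functoriality and the typing of unit and substitution are
  assumed. Its equational laws are conclusions, pulled through the invertible \<theta> from those of
  \<open>E\<close>.\<close>

locale multitensor_transport = category V for V :: "('o, 'm) cat" (structure) +
  fixes E F :: "('o, 'm) multitensor_data" and \<theta> :: "'o list \<Rightarrow> 'm"
  assumes E: "is_multitensor V E"
    and F: "is_functor (seq_cat V) V (tob F) (tar F)"
    and unit_hom: "\<And>X. X \<in> Ob V \<Longrightarrow> tunit F X \<in> hom V X (tob F [X])"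
    and sub_hom: "\<And>Xss. Xss \<in> lists (lists (Ob V)) \<Longrightarrow>
      tsub F Xss \<in> hom V (tob F (map (tob F) Xss)) (tob F (concat Xss))"
    and \<theta>_hom: "\<And>Xs. Xs \<in> lists (Ob V) \<Longrightarrow> \<theta> Xs \<in> hom V (tob E Xs) (tob F Xs)"
    and \<theta>_iso: "\<And>Xs. Xs \<in> lists (Ob V) \<Longrightarrow> is_iso V (\<theta> Xs)"
    and \<theta>_nat: "\<And>fs Xs Ys. fs \<in> hom (seq_cat V) Xs Ys \<Longrightarrow> \<theta> Ys \<cdot> tar E fs = tar F fs \<cdot> \<theta> Xs"
    and \<theta>_unit: "\<And>X. X \<in> Ob V \<Longrightarrow> \<theta> [X] \<cdot> tunit E X = tunit F X"
    and \<theta>_sub: "\<And>Xss. Xss \<in> lists (lists (Ob V)) \<Longrightarrow>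
      \<theta> (concat Xss) \<cdot> tsub E Xss = tsub F Xss \<cdot> (tar F (map \<theta> Xss) \<cdot> \<theta> (map (tob E) Xss))"
begin

lemmas E_Ob = tob_Ob[OF E] and E_hom = tar_hom[OF E] and E_cmp = tar_cmp[OF E]
  and E_unit_hom = tunit_hom[OF E] and E_unit_nat = tunit_nat[OF E]
  and E_sub_hom = tsub_hom[OF E] and E_sub_nat = tsub_nat[OF E]
lemmas F_Ob = seq_functorD(1)[OF F] and F_hom = seq_functorD(2)[OF F]
  and F_ident = seq_functorD(3)[OF F] and F_cmp = seq_functorD(4)[OF F]

lemma isomorphic: "multitensors_isomorphic V E F"
  unfolding multitensors_isomorphic_def is_nat_trans_def
proof (intro exI[of _ \<theta>] conjI ballI)
  show "\<theta> Xs \<in> hom V (tob E Xs) (tob F Xs)" if "Xs \<in> Ob (seq_cat V)" for Xs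
    using that \<theta>_hom by (simp add: seq_cat_def)
  show "\<theta> (Cod (seq_cat V) f) \<cdot> tar E f = tar F f \<cdot> \<theta> (Dom (seq_cat V) f)" if "f \<in> Ar (seq_cat V)" for f
    using \<theta>_nat[OF homI[OF that refl refl]] .
qed (use \<theta>_iso \<theta>_unit \<theta>_sub in auto)

lemma seq_hom_comp_map:
  assumes "\<And>x. x \<in> set xs \<Longrightarrow> f x \<in> hom V (a x) (b x)" "\<And>x. x \<in> set xs \<Longrightarrow> g x \<in> hom V (b x) (c x)"
  shows "tar F (map (\<lambda>x. g x \<cdot> f x) xs) = tar F (map g xs) \<cdot> tar F (map f xs)"
  using F_cmp[OF seq_hom_map[of xs f V a b] seq_hom_map[of xs g V b c]] assms by (simp add: map2_map_map)

lemma F_map_iso: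
  assumes "\<And>x. x \<in> set xs \<Longrightarrow> f x \<in> hom V (a x) (b x)" "\<And>x. x \<in> set xs \<Longrightarrow> is_iso V (f x)"
  shows "is_iso V (tar F (map f xs))"
proof -
  have "\<exists>g. g \<in> hom V (b x) (a x) \<and> g \<cdot> f x = ident V (a x) \<and> f x \<cdot> g = ident V (b x)" if "x \<in> set xs" for x
    using is_isoE[OF assms(2)[OF that] assms(1)[OF that]] by metis
  then obtain g where g: "g x \<in> hom V (b x) (a x)" "g x \<cdot> f x = ident V (a x)" "f x \<cdot> g x = ident V (b x)"
    if "x \<in> set xs" for x by metis
  have ab: "map a xs \<in> lists (Ob V)" "map b xs \<in> lists (Ob V)"
    using assms(1) hom_Ob by (auto simp: in_lists_conv_set)
  show ?thesis
  proof (rule is_isoI)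
    show "tar F (map f xs) \<in> hom V (tob F (map a xs)) (tob F (map b xs))"
      "tar F (map g xs) \<in> hom V (tob F (map b xs)) (tob F (map a xs))"
      using assms(1) g(1) by (auto intro!: F_hom seq_hom_map)
    have "map (\<lambda>x. g x \<cdot> f x) xs = map (ident V) (map a xs)" "map (\<lambda>x. f x \<cdot> g x) xs = map (ident V) (map b xs)"
      using g by auto
    then show "tar F (map g xs) \<cdot> tar F (map f xs) = ident V (tob F (map a xs))"
      "tar F (map f xs) \<cdot> tar F (map g xs) = ident V (tob F (map b xs))"
      using seq_hom_comp_map[of xs f a b g a] seq_hom_comp_map[of xs g b a f b] assms(1) g(1) ab
      by (auto simp: F_ident simp del: map_map)
  qed
qed

text \<open>The horizontal composite of \<theta> with itself, from twofold tensors of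
  \<open>E\<close> to those of \<open>F\<close>. It is invertible, so maps out of a twofold
  \<open>F\<close>-tensor may be compared after precomposing with it, and compatibility of \<theta>
  with substitution becomes a commuting square.\<close>

definition \<theta>2 :: "'o list list \<Rightarrow> 'm" where
  "\<theta>2 Xss = tar F (map \<theta> Xss) \<cdot> \<theta> (map (tob E) Xss)"

context
  fixes Xss assumes Xss: "Xss \<in> lists (lists (Ob V))"
begin

lemma in_Xss: "Xs \<in> set Xss \<Longrightarrow> Xs \<in> lists (Ob V)"
  using Xss by (auto simp: in_lists_conv_set)

lemma map_tob_Ob: "map (tob E) Xss \<in> lists (Ob V)" "map (tob F) Xss \<in> lists (Ob V)"
  using in_Xss E_Ob F_Ob by auto

lemma concat_Ob: "concat Xss \<in> lists (Ob V)"
  using in_Xss by (auto simp: in_lists_conv_set)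

lemma F_\<theta>_hom: "tar F (map \<theta> Xss) \<in> hom V (tob F (map (tob E) Xss)) (tob F (map (tob F) Xss))"
  using in_Xss \<theta>_hom by (intro F_hom seq_hom_map) auto

lemma \<theta>2_hom: "\<theta>2 Xss \<in> hom V (tob E (map (tob E) Xss)) (tob F (map (tob F) Xss))"
  unfolding \<theta>2_def using cmp_hom[OF \<theta>_hom[OF map_tob_Ob(1)] F_\<theta>_hom] .

lemma \<theta>2_iso: "is_iso V (\<theta>2 Xss)"
  unfolding \<theta>2_def using F_map_iso[of Xss \<theta> "tob E" "tob F"] in_Xss \<theta>_hom \<theta>_iso
  by (intro iso_cmp[OF _ \<theta>_hom[OF map_tob_Ob(1)] _ F_\<theta>_hom] \<theta>_iso map_tob_Ob) auto

lemma \<theta>2_sub: "tsub F Xss \<cdot> \<theta>2 Xss = \<theta> (concat Xss) \<cdot> tsub E Xss"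
  using \<theta>_sub[OF Xss] by (simp add: \<theta>2_def)

end

text \<open>The last claim is naturality of \<open>\<theta>2\<close>, obtained from naturality of
  \<theta> at both levels: in each inner sequence, and at the sequence of inner tensors.\<close>

lemma seq_seq_homD:
  assumes "fss \<in> hom (seq_cat (seq_cat V)) Xss Yss"
  shows "Xss \<in> lists (lists (Ob V))" "Yss \<in> lists (lists (Ob V))"
    and "concat fss \<in> hom (seq_cat V) (concat Xss) (concat Yss)"
    and "map (tar E) fss \<in> hom (seq_cat V) (map (tob E) Xss) (map (tob E) Yss)"
    and "map (tar F) fss \<in> hom (seq_cat V) (map (tob F) Xss) (map (tob F) Yss)"
    and "\<theta>2 Yss \<cdot> tar E (map (tar E) fss) = tar F (map (tar F) fss) \<cdot> \<theta>2 Xss"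
proof -
  have l: "length fss = length Xss" "length Yss = length Xss" using seq_homD[OF assms] by auto
  have h: "fss ! i \<in> hom (seq_cat V) (Xss ! i) (Yss ! i)" if "i < length Xss" for i
    using seq_homD(3)[OF assms that] .
  show Xss: "Xss \<in> lists (lists (Ob V))"
    by (rule lists_nthI) (rule seq_hom_Ob[OF h, THEN conjunct1])
  show Yss: "Yss \<in> lists (lists (Ob V))"
    by (rule lists_nthI) (simp only: l(2), rule seq_hom_Ob[OF h, THEN conjunct2])
  have fss: "fss \<in> lists (lists (Ar V))" "Xss = map (map (Dom V)) fss" "Yss = map (map (Cod V)) fss"
    using assms unfolding seq_hom_iff by (auto simp: seq_cat_def)
  then show "concat fss \<in> hom (seq_cat V) (concat Xss) (concat Yss)"
    unfolding seq_hom_iff by (auto simp: map_concat in_lists_conv_set)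
  show E1: "map (tar E) fss \<in> hom (seq_cat V) (map (tob E) Xss) (map (tob E) Yss)"
    and F1: "map (tar F) fss \<in> hom (seq_cat V) (map (tob F) Xss) (map (tob F) Yss)"
    using l h E_hom F_hom by (auto intro!: seq_homI)
  have "map2 (\<cdot>) (map \<theta> Yss) (map (tar E) fss) = map2 (\<cdot>) (map (tar F) fss) (map \<theta> Xss)"
    using l \<theta>_nat[OF h] by (intro nth_equalityI) auto
  moreover have "map \<theta> Xss \<in> hom (seq_cat V) (map (tob E) Xss) (map (tob F) Xss)"
    "map \<theta> Yss \<in> hom (seq_cat V) (map (tob E) Yss) (map (tob F) Yss)"
    using in_Xss[OF Xss] in_Xss[OF Yss] \<theta>_hom by (auto intro!: seq_hom_map)
  ultimately have sq: "tar F (map \<theta> Yss) \<cdot> tar F (map (tar E) fss) = tar F (map (tar F) fss) \<cdot> tar F (map \<theta> Xss)"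
    using F_cmp[OF E1] F_cmp[OF _ F1] by metis
  note H = F_\<theta>_hom[OF Xss] F_\<theta>_hom[OF Yss] F_hom[OF E1] F_hom[OF F1] E_hom[OF E1]
        \<theta>_hom[OF map_tob_Ob(1)[OF Xss]] \<theta>_hom[OF map_tob_Ob(1)[OF Yss]]
  show "\<theta>2 Yss \<cdot> tar E (map (tar E) fss) = tar F (map (tar F) fss) \<cdot> \<theta>2 Xss"
    unfolding \<theta>2_def using H[THEN homD] by (simp add: Ar_simps \<theta>_nat[OF E1] cmp_chain[OF sq])
qed

section \<open>Transfer of the multitensor laws from \<open>E\<close> to \<open>F\<close>\<close>

lemma unit_nat:
  assumes f: "f \<in> hom V X Y"
  shows "tunit F Y \<cdot> f = tar F [f] \<cdot> tunit F X"
proof -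
  have XY: "X \<in> Ob V" "Y \<in> Ob V" using hom_Ob[OF f] by auto
  have f1: "[f] \<in> hom (seq_cat V) [X] [Y]" using seq_hom_map[of "[()]" "\<lambda>_. f" V "\<lambda>_. X" "\<lambda>_. Y"] f by simp
  have l: "[X] \<in> lists (Ob V)" "[Y] \<in> lists (Ob V)" using XY by auto
  note H = f E_hom[OF f1] F_hom[OF f1] \<theta>_hom[OF l(1)] \<theta>_hom[OF l(2)]
        E_unit_hom[OF XY(1)] E_unit_hom[OF XY(2)]
  have "tunit F Y \<cdot> f = \<theta> [Y] \<cdot> (tunit E Y \<cdot> f)" using H[THEN homD] by (simp add: \<theta>_unit[OF XY(2), symmetric] Ar_simps)
  also have "\<dots> = (\<theta> [Y] \<cdot> tar E [f]) \<cdot> tunit E X" using H[THEN homD] by (simp add: E_unit_nat[OF f] Ar_simps)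
  also have "\<dots> = tar F [f] \<cdot> (\<theta> [X] \<cdot> tunit E X)" using H[THEN homD] by (simp add: \<theta>_nat[OF f1] Ar_simps)
  finally show ?thesis by (simp add: \<theta>_unit[OF XY(1)])
qed

text \<open>After precomposition with \<open>\<theta>2 Xss\<close> both sides factor through
  \<open>\<theta> (concat Yss)\<close>, which leaves the naturality square of
  \<open>tsub E\<close>.\<close>

lemma sub_nat:
  assumes fss: "fss \<in> hom (seq_cat (seq_cat V)) Xss Yss"
  shows "tsub F Yss \<cdot> tar F (map (tar F) fss) = tar F (concat fss) \<cdot> tsub F Xss"
proof (rule iso_cancel_right)
  let ?L = "tsub F Yss \<cdot> tar F (map (tar F) fss)"
  let ?R = "tar F (concat fss) \<cdot> tsub F Xss"
  note D = seq_seq_homD[OF fss]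
  note X = D(1) and Y = D(2)
  show "is_iso V (\<theta>2 Xss)" and h: "\<theta>2 Xss \<in> hom V (tob E (map (tob E) Xss)) (tob F (map (tob F) Xss))"
    using \<theta>2_iso \<theta>2_hom X by auto
  show "?L \<in> hom V (tob F (map (tob F) Xss)) (tob F (concat Yss))"
    "?R \<in> hom V (tob F (map (tob F) Xss)) (tob F (concat Yss))"
    using cmp_hom[OF F_hom[OF D(5)] sub_hom[OF Y]] cmp_hom[OF sub_hom[OF X] F_hom[OF D(3)]] .
  note H = h \<theta>2_hom[OF Y] sub_hom[OF X] sub_hom[OF Y] F_hom[OF D(5)] F_hom[OF D(3)]
        E_hom[OF D(3)] E_hom[OF D(4)] E_sub_hom[OF X] E_sub_hom[OF Y]
        \<theta>_hom[OF concat_Ob[OF X]] \<theta>_hom[OF concat_Ob[OF Y]]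
  have "?L \<cdot> \<theta>2 Xss = (tsub F Yss \<cdot> \<theta>2 Yss) \<cdot> tar E (map (tar E) fss)"
    using H[THEN homD] by (simp add: Ar_simps D(6))
  also have "\<dots> = \<theta> (concat Yss) \<cdot> (tsub E Yss \<cdot> tar E (map (tar E) fss))"
    using H[THEN homD] by (simp add: \<theta>2_sub[OF Y] Ar_simps)
  also have "\<dots> = (\<theta> (concat Yss) \<cdot> tar E (concat fss)) \<cdot> tsub E Xss"
    using H[THEN homD] by (simp add: E_sub_nat[OF fss] Ar_simps)
  also have "\<dots> = tar F (concat fss) \<cdot> (\<theta> (concat Xss) \<cdot> tsub E Xss)"
    using H[THEN homD] by (simp add: \<theta>_nat[OF D(3)] Ar_simps)
  also have "\<dots> = ?R \<cdot> \<theta>2 Xss"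
    using H[THEN homD] by (simp add: \<theta>2_sub[OF X, symmetric] Ar_simps)
  finally show "?L \<cdot> \<theta>2 Xss = ?R \<cdot> \<theta>2 Xss" .
qed

lemma sub_unit:
  assumes Xs: "Xs \<in> lists (Ob V)"
  shows "tsub F [Xs] \<cdot> tunit F (tob F Xs) = ident V (tob F Xs)"
    and "tsub F (map (\<lambda>X. [X]) Xs) \<cdot> tar F (map (tunit F) Xs) = ident V (tob F Xs)"
proof -
  have E_unit: "tsub E [Xs] \<cdot> tunit E (tob E Xs) = ident V (tob E Xs)"
    "tsub E (map (\<lambda>X. [X]) Xs) \<cdot> tar E (map (tunit E) Xs) = ident V (tob E Xs)"
    using E Xs by (auto simp: is_multitensor_def)
  have O: "tob E Xs \<in> Ob V" "tob F Xs \<in> Ob V" using Xs E_Ob F_Ob by auto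
  note \<theta>X = \<theta>_hom[OF Xs] \<theta>_iso[OF Xs]
  have inX: "X \<in> Ob V" if "X \<in> set Xs" for X using Xs that by (auto simp: in_lists_conv_set)
  show "tsub F [Xs] \<cdot> tunit F (tob F Xs) = ident V (tob F Xs)"
  proof (rule iso_cancel_right[OF \<theta>X(2,1)])
    have S: "[Xs] \<in> lists (lists (Ob V))" using Xs by simp
    have s: "tsub F [Xs] \<in> hom V (tob F [tob F Xs]) (tob F Xs)" using sub_hom[OF S] by simp
    have e: "tsub E [Xs] \<in> hom V (tob E [tob E Xs]) (tob E Xs)" using E_sub_hom[OF S] by simp
    have t: "\<theta>2 [Xs] \<in> hom V (tob E [tob E Xs]) (tob F [tob F Xs])" using \<theta>2_hom[OF S] by simp
    have l: "[tob E Xs] \<in> lists (Ob V)" using O by simp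
    have f: "tar F [\<theta> Xs] \<in> hom V (tob F [tob E Xs]) (tob F [tob F Xs])" using F_\<theta>_hom[OF S] by simp
    show "tsub F [Xs] \<cdot> tunit F (tob F Xs) \<in> hom V (tob F Xs) (tob F Xs)"
      using cmp_hom[OF unit_hom[OF O(2)] s] .
    show "ident V (tob F Xs) \<in> hom V (tob F Xs) (tob F Xs)" using ident_hom O by simp
    note H = \<theta>X(1) s e t f unit_hom[OF O(1)] unit_hom[OF O(2)] E_unit_hom[OF O(1)] \<theta>_hom[OF l]
    have "(tsub F [Xs] \<cdot> tunit F (tob F Xs)) \<cdot> \<theta> Xs = tsub F [Xs] \<cdot> (tar F [\<theta> Xs] \<cdot> (\<theta> [tob E Xs] \<cdot> tunit E (tob E Xs)))"
      using H[THEN homD] by (simp add: Ar_simps unit_nat[OF \<theta>X(1)] \<theta>_unit[OF O(1)])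
    also have "\<dots> = (tsub F [Xs] \<cdot> \<theta>2 [Xs]) \<cdot> tunit E (tob E Xs)"
      using H[THEN homD] by (simp add: Ar_simps \<theta>2_def)
    also have "\<dots> = ident V (tob F Xs) \<cdot> \<theta> Xs"
      using H[THEN homD] by (simp add: Ar_simps \<theta>2_sub[OF S] E_unit)
    finally show "(tsub F [Xs] \<cdot> tunit F (tob F Xs)) \<cdot> \<theta> Xs = ident V (tob F Xs) \<cdot> \<theta> Xs" .
  qed
  show "tsub F (map (\<lambda>X. [X]) Xs) \<cdot> tar F (map (tunit F) Xs) = ident V (tob F Xs)"
  proof (rule iso_cancel_right[OF \<theta>X(2,1)])
    let ?S = "map (\<lambda>X. [X]) Xs"
    have S: "?S \<in> lists (lists (Ob V))" using inX by auto
    have cS: "concat ?S = Xs" by simp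
    have uE: "map (tunit E) Xs \<in> hom (seq_cat V) Xs (map (tob E) ?S)"
      using seq_hom_map[of Xs "tunit E" V "\<lambda>X. X" "\<lambda>X. tob E [X]"] inX E_unit_hom by (simp add: comp_def)
    have uF: "map (tunit F) Xs \<in> hom (seq_cat V) Xs (map (tob F) ?S)"
      using seq_hom_map[of Xs "tunit F" V "\<lambda>X. X" "\<lambda>X. tob F [X]"] inX unit_hom by (simp add: comp_def)
    have s: "tsub F ?S \<in> hom V (tob F (map (tob F) ?S)) (tob F Xs)" using sub_hom[OF S] by simp
    have e: "tsub E ?S \<in> hom V (tob E (map (tob E) ?S)) (tob E Xs)" using E_sub_hom[OF S] by simp
    show "tsub F ?S \<cdot> tar F (map (tunit F) Xs) \<in> hom V (tob F Xs) (tob F Xs)"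
      using cmp_hom[OF F_hom[OF uF] s] .
    show "ident V (tob F Xs) \<in> hom V (tob F Xs) (tob F Xs)" using ident_hom O by simp
    \<comment> \<open>The unit of \<open>F\<close> is replaced in every variable by \<theta> after
      the unit of \<open>E\<close>; functoriality splits the tensor, and the factor with \<theta>
      becomes half of \<open>\<theta>2\<close>.\<close>
    have "tar F (map (tunit F) Xs) = tar F (map (\<lambda>X. \<theta> [X] \<cdot> tunit E X) Xs)"
      using \<theta>_unit inX by (intro arg_cong[of _ _ "tar F"]) simp
    also have "\<dots> = tar F (map (\<lambda>X. \<theta> [X]) Xs) \<cdot> tar F (map (tunit E) Xs)"
      using E_unit_hom \<theta>_hom inX
      by (intro seq_hom_comp_map[of _ _ "\<lambda>X. X" "\<lambda>X. tob E [X]" _ "\<lambda>X. tob F [X]"]) auto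
    finally have u: "tar F (map (tunit F) Xs) = tar F (map \<theta> ?S) \<cdot> tar F (map (tunit E) Xs)"
      by (simp add: comp_def)
    note H = \<theta>X(1) s e \<theta>2_hom[OF S] F_\<theta>_hom[OF S] F_hom[OF uE] E_hom[OF uE]
        \<theta>_hom[OF map_tob_Ob(1)[OF S]]
    have "(tsub F ?S \<cdot> tar F (map (tunit F) Xs)) \<cdot> \<theta> Xs = tsub F ?S \<cdot> (tar F (map \<theta> ?S) \<cdot> (tar F (map (tunit E) Xs) \<cdot> \<theta> Xs))"
      using H[THEN homD] by (simp add: u Ar_simps del: map_map)
    also have "\<dots> = (tsub F ?S \<cdot> \<theta>2 ?S) \<cdot> tar E (map (tunit E) Xs)"
      using H[THEN homD] by (simp add: \<theta>_nat[OF uE, symmetric] \<theta>2_def Ar_simps del: map_map)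
    also have "\<dots> = ident V (tob F Xs) \<cdot> \<theta> Xs"
      using H[THEN homD] by (simp add: \<theta>2_sub[OF S] Ar_simps E_unit cS del: map_map)
    finally show "(tsub F ?S \<cdot> tar F (map (tunit F) Xs)) \<cdot> \<theta> Xs = ident V (tob F Xs) \<cdot> \<theta> Xs" .
  qed
qed

text \<open>The two sides are compared after the invertible \<open>?O\<close> from the threefold
  tensor of \<open>E\<close> to that of \<open>F\<close>. It can be bracketed in two ways, one
  suited to substituting at the outer two levels first, the other to substituting at the inner
  two.\<close>

lemma sub_assoc:
  assumes Xsss: "Xsss \<in> lists (lists (lists (Ob V)))"
  shows "tsub F (concat Xsss) \<cdot> tsub F (map (map (tob F)) Xsss) =
    tsub F (map concat Xsss) \<cdot> tar F (map (tsub F) Xsss)"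
proof (rule iso_cancel_right)
  let ?EE = "\<lambda>Xss. tob E (map (tob E) Xss)" and ?FF = "\<lambda>Xss. tob F (map (tob F) Xss)"
  let ?L = "tsub F (concat Xsss) \<cdot> tsub F (map (map (tob F)) Xsss)"
  let ?R = "tsub F (map concat Xsss) \<cdot> tar F (map (tsub F) Xsss)"
  let ?E = "map (map (tob E)) Xsss"
  have in3: "Xss \<in> lists (lists (Ob V))" if "Xss \<in> set Xsss" for Xss
    using Xsss that by (auto simp: in_lists_conv_set)
  have c: "concat Xsss \<in> lists (lists (Ob V))" using in3 by (fastforce simp: in_lists_conv_set)
  have mc: "map concat Xsss \<in> lists (lists (Ob V))" by (rule lists_nthI) (simp only: length_map nth_map, rule concat_Ob[OF in3], simp)
  have mmE: "?E \<in> lists (lists (Ob V))"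
    and mmF: "map (map (tob F)) Xsss \<in> lists (lists (Ob V))"
    by (rule lists_nthI, simp only: length_map nth_map, rule map_tob_Ob[OF in3], simp)+
  have cmmE: "concat ?E = map (tob E) (concat Xsss)"
    and cmmF: "concat (map (map (tob F)) Xsss) = map (tob F) (concat Xsss)"
    and cmm\<theta>: "concat (map (map \<theta>) Xsss) = map \<theta> (concat Xsss)"
    by (simp_all add: map_concat)
  have ccc: "concat (map concat Xsss) = concat (concat Xsss)"
    by (induction Xsss) simp_all
  have EE: "map (tob E) ?E = map ?EE Xsss" and FF: "map (tob F) (map (map (tob F)) Xsss) = map ?FF Xsss"
    and Ec: "map (tob E) (map concat Xsss) = map (\<lambda>Xss. tob E (concat Xss)) Xsss"
    and Fc: "map (tob F) (map concat Xsss) = map (\<lambda>Xss. tob F (concat Xss)) Xsss" by simp_all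
  define \<Theta> where "\<Theta> = tar F (map \<theta>2 Xsss)"
  let ?O = "\<Theta> \<cdot> \<theta> (map ?EE Xsss)"
  have \<Theta>: "\<Theta> \<in> hom V (tob F (map ?EE Xsss)) (tob F (map ?FF Xsss))"
    unfolding \<Theta>_def using \<theta>2_hom[OF in3] by (intro F_hom seq_hom_map) auto
  have EEO: "map ?EE Xsss \<in> lists (Ob V)" using map_tob_Ob(1)[OF mmE] by (simp add: comp_def)
  have t: "\<theta> (map ?EE Xsss) \<in> hom V (tob E (map ?EE Xsss)) (tob F (map ?EE Xsss))" using \<theta>_hom[OF EEO] .
  show \<Omega>: "?O \<in> hom V (tob E (map ?EE Xsss)) (tob F (map ?FF Xsss))"
    using cmp_hom[OF t \<Theta>] .
  show "is_iso V ?O"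
  proof (rule iso_cmp[OF \<theta>_iso[OF EEO] t _ \<Theta>])
    show "is_iso V \<Theta>" unfolding \<Theta>_def
      using \<theta>2_hom[OF in3] \<theta>2_iso[OF in3] by (intro F_map_iso[of _ _ ?EE ?FF]) auto
  qed
  have sF: "map (tsub F) Xsss \<in> hom (seq_cat V) (map ?FF Xsss) (map (tob F) (map concat Xsss))"
    unfolding Fc using sub_hom[OF in3] by (intro seq_hom_map) auto
  have sE: "map (tsub E) Xsss \<in> hom (seq_cat V) (map ?EE Xsss) (map (tob E) (map concat Xsss))"
    unfolding Ec using E_sub_hom[OF in3] by (intro seq_hom_map) auto
  have s1: "tsub F (map (map (tob F)) Xsss) \<in> hom V (tob F (map ?FF Xsss)) (tob F (map (tob F) (concat Xsss)))"
    using sub_hom[OF mmF] unfolding FF cmmF .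
  have s1E: "tsub E ?E \<in> hom V (tob E (map ?EE Xsss)) (tob E (map (tob E) (concat Xsss)))"
    using E_sub_hom[OF mmE] unfolding EE cmmE .
  have s1': "tsub F ?E \<in> hom V (tob F (map (tob F) ?E)) (tob F (map (tob E) (concat Xsss)))"
    using sub_hom[OF mmE] unfolding cmmE .
  have s2: "tsub F (map concat Xsss) \<in> hom V (tob F (map (tob F) (map concat Xsss))) (tob F (concat (concat Xsss)))"
    using sub_hom[OF mc] unfolding ccc .
  have s2E: "tsub E (map concat Xsss) \<in> hom V (tob E (map (tob E) (map concat Xsss))) (tob E (concat (concat Xsss)))"
    using E_sub_hom[OF mc] unfolding ccc .
  show "?L \<in> hom V (tob F (map ?FF Xsss)) (tob F (concat (concat Xsss)))"
    using cmp_hom[OF s1 sub_hom[OF c]] .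
  show "?R \<in> hom V (tob F (map ?FF Xsss)) (tob F (concat (concat Xsss)))"
    using cmp_hom[OF F_hom[OF sF] s2] .
  define fss where "fss = map (map \<theta>) Xsss"
  have fss: "fss \<in> hom (seq_cat (seq_cat V)) ?E (map (map (tob F)) Xsss)"
    unfolding fss_def
  proof (rule seq_hom_map)
    fix Xss assume "Xss \<in> set Xsss"
    then show "map \<theta> Xss \<in> hom (seq_cat V) (map (tob E) Xss) (map (tob F) Xss)"
      using \<theta>_hom in_Xss[OF in3] by (intro seq_hom_map) auto
  qed
  note D = seq_seq_homD[OF fss]
  have cf: "tar F (concat fss) = tar F (map \<theta> (concat Xsss))" by (simp add: fss_def cmm\<theta>)
  have Ff: "tar F (map (tar F) fss) \<in> hom V (tob F (map (tob F) ?E)) (tob F (map ?FF Xsss))"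
    using F_hom[OF D(5)] unfolding FF .
  have tE: "\<theta>2 ?E \<in> hom V (tob E (map ?EE Xsss)) (tob F (map (tob F) ?E))"
    using \<theta>2_hom[OF mmE] unfolding EE .
  \<comment> \<open>First bracketing: \<open>\<theta>2\<close> on the outer two levels, then
    \<theta> on the innermost one. Naturality of \<open>tsub F\<close> then moves the innermost
    \<theta> past the outer substitution.\<close>
  have \<Omega>1: "?O = tar F (map (tar F) fss) \<cdot> \<theta>2 ?E"
  proof -
    have "\<Theta> = tar F (map (\<lambda>Xss. tar F (map \<theta> Xss) \<cdot> \<theta> (map (tob E) Xss)) Xsss)"
      by (simp add: \<Theta>_def \<theta>2_def[abs_def])
    also have "\<dots> = tar F (map (\<lambda>Xss. tar F (map \<theta> Xss)) Xsss) \<cdot> tar F (map (\<lambda>Xss. \<theta> (map (tob E) Xss)) Xsss)"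
      using \<theta>_hom[OF map_tob_Ob(1)[OF in3]] F_\<theta>_hom[OF in3]
      by (intro seq_hom_comp_map[of _ _ ?EE "\<lambda>Xss. tob F (map (tob E) Xss)" _ ?FF]) auto
    finally have "\<Theta> = tar F (map (tar F) fss) \<cdot> tar F (map \<theta> ?E)"
      by (simp add: fss_def comp_def)
    then show ?thesis
      using homD[OF Ff] homD[OF t] homD[OF F_\<theta>_hom[OF mmE]] by (simp add: \<theta>2_def Ar_simps EE del: map_map)
  qed
  \<comment> \<open>Second bracketing: inside each entry of \<open>Xsss\<close>,
    \<open>\<theta>2\<close> followed by \<open>tsub F\<close> is exchanged for
    \<open>tsub E\<close> followed by \<theta>; naturality of \<theta> then brings the substitutions
    of \<open>E\<close> to the front.\<close>
  have \<Omega>2: "tar F (map (tsub F) Xsss) \<cdot> ?O = \<theta>2 (map concat Xsss) \<cdot> tar E (map (tsub E) Xsss)"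
  proof -
    have "tar F (map (tsub F) Xsss) \<cdot> \<Theta> = tar F (map (\<lambda>Xss. tsub F Xss \<cdot> \<theta>2 Xss) Xsss)"
      unfolding \<Theta>_def using \<theta>2_hom[OF in3] sub_hom[OF in3]
      by (intro seq_hom_comp_map[of _ _ ?EE ?FF _ "\<lambda>Xss. tob F (concat Xss)", symmetric]) auto
    also have "\<dots> = tar F (map (\<lambda>Xss. \<theta> (concat Xss) \<cdot> tsub E Xss) Xsss)"
      using \<theta>2_sub[OF in3] by (intro arg_cong[of _ _ "tar F"]) simp
    also have "\<dots> = tar F (map (\<lambda>Xss. \<theta> (concat Xss)) Xsss) \<cdot> tar F (map (tsub E) Xsss)"
      using \<theta>_hom[OF concat_Ob[OF in3]] E_sub_hom[OF in3]
      by (intro seq_hom_comp_map[of _ _ ?EE "\<lambda>Xss. tob E (concat Xss)" _ "\<lambda>Xss. tob F (concat Xss)"]) auto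
    finally have *: "tar F (map (tsub F) Xsss) \<cdot> \<Theta> = tar F (map \<theta> (map concat Xsss)) \<cdot> tar F (map (tsub E) Xsss)"
      by (simp add: comp_def)
    note H = F_hom[OF sF] \<Theta> t F_\<theta>_hom[OF mc] F_hom[OF sE] E_hom[OF sE]
        \<theta>_hom[OF map_tob_Ob(1)[OF mc]]
    show ?thesis
      using H[THEN homD] by (simp add: cmp_chain[OF *] Ar_simps \<theta>_nat[OF sE, symmetric] \<theta>2_def del: map_map)
  qed
  have E_assoc: "tsub E (concat Xsss) \<cdot> tsub E ?E = tsub E (map concat Xsss) \<cdot> tar E (map (tsub E) Xsss)"
    using E Xsss by (simp add: is_multitensor_def)
  note H = \<Omega> s1 s1E s1' s2 s2E sub_hom[OF c] E_sub_hom[OF c] F_hom[OF sF] E_hom[OF sE] Ff tE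
        F_\<theta>_hom[OF c] \<theta>2_hom[OF mc] \<theta>2_hom[OF c] \<theta>_hom[OF map_tob_Ob(1)[OF c]]
        \<theta>_hom[OF concat_Ob[OF c]]
  have "?L \<cdot> ?O =
      tsub F (concat Xsss) \<cdot> ((tsub F (map (map (tob F)) Xsss) \<cdot> tar F (map (tar F) fss)) \<cdot> \<theta>2 ?E)"
    using H[THEN homD] unfolding \<Omega>1 by (simp add: Ar_simps del: map_map)
  also have "\<dots> = tsub F (concat Xsss) \<cdot> (tar F (map \<theta> (concat Xsss)) \<cdot> (tsub F ?E \<cdot> \<theta>2 ?E))"
    using H[THEN homD] by (simp add: sub_nat[OF fss] cf Ar_simps del: map_map)
  also have "\<dots> = (tsub F (concat Xsss) \<cdot> \<theta>2 (concat Xsss)) \<cdot> tsub E ?E"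
    using H[THEN homD] by (simp add: \<theta>2_sub[OF mmE] cmmE \<theta>2_def[of "concat Xsss"] Ar_simps del: map_map)
  also have "\<dots> = \<theta> (concat (concat Xsss)) \<cdot> (tsub E (map concat Xsss) \<cdot> tar E (map (tsub E) Xsss))"
    using H[THEN homD] by (simp add: \<theta>2_sub[OF c] E_assoc Ar_simps del: map_map)
  also have "\<dots> = (tsub F (map concat Xsss) \<cdot> \<theta>2 (map concat Xsss)) \<cdot> tar E (map (tsub E) Xsss)"
    using H[THEN homD] by (simp add: \<theta>2_sub[OF mc] ccc Ar_simps del: map_map)
  also have "\<dots> = ?R \<cdot> ?O"
    using H[THEN homD] by (simp add: \<Omega>2[symmetric] Ar_simps del: map_map)
  finally show "?L \<cdot> ?O =
    ?R \<cdot> ?O" .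
qed

lemma multitensor: "is_multitensor V F"
  unfolding is_multitensor_def
proof (intro conjI ballI)
  show "is_functor (seq_cat V) V (tob F) (tar F)" by (rule F)
  show "is_nat_trans V V (\<lambda>X. X) (\<lambda>f. f) (\<lambda>X. tob F [X]) (\<lambda>f. tar F [f]) (tunit F)"
    using unit_hom unit_nat[OF Ar_hom] by (simp add: is_nat_trans_def)
  show "is_nat_trans (seq_cat (seq_cat V)) V (\<lambda>Xss. tob F (map (tob F) Xss)) (\<lambda>fss. tar F (map (tar F) fss))
      (\<lambda>Xss. tob F (concat Xss)) (\<lambda>fss. tar F (concat fss)) (tsub F)"
    unfolding is_nat_trans_def
  proof (intro conjI ballI)
    show "tsub F Xss \<in> hom V (tob F (map (tob F) Xss)) (tob F (concat Xss))" if "Xss \<in> Ob (seq_cat (seq_cat V))" for Xss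
      using that sub_hom by (simp add: seq_cat_def)
    show "tsub F (Cod (seq_cat (seq_cat V)) fss) \<cdot> tar F (map (tar F) fss) =
        tar F (concat fss) \<cdot> tsub F (Dom (seq_cat (seq_cat V)) fss)" if "fss \<in> Ar (seq_cat (seq_cat V))" for fss
      using sub_nat[OF homI[OF that refl refl]] .
  qed
qed (use sub_unit sub_assoc in auto)

text \<open>Naturality of \<theta> at the arrow with \<open>\<iota> i\<close> in one variable and
  identities elsewhere makes the cocone of \<open>F\<close> an isomorphic copy of that of
  \<open>E\<close>.\<close>

lemma distributive:
  fixes small :: "'u set \<Rightarrow> bool"
  assumes "is_distributive_multitensor small V E"
  shows "is_distributive_multitensor small V F"
  unfolding is_distributive_multitensor_def
proof (intro conjI ballI allI impI multitensor)
  fix Xs Ys and I :: "'u set" and Z c \<iota>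
  assume X: "Xs \<in> lists (Ob V)" and Y: "Ys \<in> lists (Ob V)" and I: "small I \<and> is_coproduct V I Z c \<iota>"
  have h: "c \<in> Ob V" "\<iota> i \<in> hom V (Z i) c" "Z i \<in> Ob V" if "i \<in> I" for i
    using that coproduct_hom conjunct2[OF I] by auto
  have c: "c \<in> Ob V" using coproduct_hom(1)[OF conjunct2[OF I]] .
  have O: "Xs @ d # Ys \<in> lists (Ob V)" if "d \<in> Ob V" for d using that X Y by auto
  have f: "map (ident V) Xs @ \<iota> i # map (ident V) Ys \<in> hom (seq_cat V) (Xs @ Z i # Ys) (Xs @ c # Ys)" if "i \<in> I" for i
    using h that X Y by (intro seq_hom_append seq_hom_Cons seq_hom_ident) auto
  show "is_coproduct V I (\<lambda>i. tob F (Xs @ Z i # Ys)) (tob F (Xs @ c # Ys))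
      (\<lambda>i. tar F (map (ident V) Xs @ \<iota> i # map (ident V) Ys))"
  proof (rule is_coproduct_iso[where k = "\<lambda>i. \<theta> (Xs @ Z i # Ys)"])
    show "is_coproduct V I (\<lambda>i. tob E (Xs @ Z i # Ys)) (tob E (Xs @ c # Ys))
      (\<lambda>i. tar E (map (ident V) Xs @ \<iota> i # map (ident V) Ys))"
      using assms X Y I by (simp add: is_distributive_multitensor_def)
    show "is_iso V (\<theta> (Xs @ c # Ys))" "\<theta> (Xs @ c # Ys) \<in> hom V (tob E (Xs @ c # Ys)) (tob F (Xs @ c # Ys))"
      using \<theta>_iso[OF O[OF c]] \<theta>_hom[OF O[OF c]] .
    fix i assume i: "i \<in> I"
    show "is_iso V (\<theta> (Xs @ Z i # Ys))" "\<theta> (Xs @ Z i # Ys) \<in> hom V (tob E (Xs @ Z i # Ys)) (tob F (Xs @ Z i # Ys))"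
      using \<theta>_iso[OF O[OF h(3)[OF i]]] \<theta>_hom[OF O[OF h(3)[OF i]]] .
    show "tar F (map (ident V) Xs @ \<iota> i # map (ident V) Ys) \<in> hom V (tob F (Xs @ Z i # Ys)) (tob F (Xs @ c # Ys))"
      using F_hom[OF f[OF i]] .
    show "tar F (map (ident V) Xs @ \<iota> i # map (ident V) Ys) \<cdot> \<theta> (Xs @ Z i # Ys) =
        \<theta> (Xs @ c # Ys) \<cdot> tar E (map (ident V) Xs @ \<iota> i # map (ident V) Ys)"
      using \<theta>_nat[OF f[OF i]] by simp
  qed
qed

end

section \<open>Comparing monads and multitensors\<close>

lemma (in category) coproduct_comparison_iso:
  assumes c: "is_coproduct C I Z c \<iota>" and c': "is_coproduct C I Z c' \<iota>'"
    and h: "h \<in> hom C c c'" "\<And>i. i \<in> I \<Longrightarrow> h \<cdot> \<iota> i = \<iota>' i"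
  shows "is_iso C h"
proof -
  obtain k where k: "k \<in> hom C c' c" "\<And>i. i \<in> I \<Longrightarrow> k \<cdot> \<iota>' i = \<iota> i"
    using coproduct_ex[OF c' coproduct_hom(1)[OF c], of \<iota>] coproduct_hom(2)[OF c] by auto
  show ?thesis
  proof (rule is_isoI[OF h(1) k(1)])
    show "k \<cdot> h = ident C c"
    proof (rule coproduct_eqI[OF c cmp_hom[OF h(1) k(1)] ident_hom[OF coproduct_hom(1)[OF c]]])
      fix i assume i: "i \<in> I"
      show "(k \<cdot> h) \<cdot> \<iota> i = ident C c \<cdot> \<iota> i"
        using cmp_assoc[OF coproduct_hom(2)[OF c i] h(1) k(1)] h(2)[OF i] k(2)[OF i]
          ident_left[OF coproduct_hom(2)[OF c i]] by simp
    qed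
    show "h \<cdot> k = ident C c'"
    proof (rule coproduct_eqI[OF c' cmp_hom[OF k(1) h(1)] ident_hom[OF coproduct_hom(1)[OF c']]])
      fix i assume i: "i \<in> I"
      show "(h \<cdot> k) \<cdot> \<iota>' i = ident C c' \<cdot> \<iota>' i"
        using cmp_assoc[OF coproduct_hom(2)[OF c' i] k(1) h(1)] h(2)[OF i] k(2)[OF i]
          ident_left[OF coproduct_hom(2)[OF c' i]] by simp
    qed
  qed
qed

context distributive_multitensor
begin

text \<open>Only the path \<open>0, 1, \<dots>, n\<close> contributes: any other path from \<open>0\<close> to \<open>n\<close> has a step with
  initial hom, and a tensor with an initial factor is initial.\<close>

lemma Gamma_incl_seq_path_iso:
  assumes Zs: "Zs \<in> lists (Ob V)"
  shows "is_iso V (Gamma_incl V E (sg Zs) (map vertex [0..<Suc (length Zs)]))"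
proof -
  let ?p = "map vertex [0..<Suc (length Zs)] :: 'u list"
  have Z: "vgraph (sg Zs)" using Zs by (rule seq_graph_vgraph)
  have len: "length ?p = Suc (length Zs)" "?p \<noteq> []" and nth: "i \<le> length Zs \<Longrightarrow> ?p ! i = vertex i" for i
    by (simp_all del: upt_Suc)
  have p: "?p \<in> paths (sg Zs) (vertex 0) (vertex (length Zs))"
    using nth by (auto simp: paths_iff hd_conv_nth last_conv_nth simp del: upt_Suc intro!: lists_nthI)
  have "is_coproduct V (paths (sg Zs) (vertex 0) (vertex (length Zs))) (path_tensor E (sg Zs))
      (edge (Gamma_ob V E (sg Zs)) (vertex 0) (vertex (length Zs))) (Gamma_incl V E (sg Zs))"
    by (intro Gamma_coproduct[OF Z]) simp_all
  then show ?thesis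
  proof (rule coproduct_incl_iso[OF _ p])
    fix xs :: "'u list" assume xs: "xs \<in> paths (sg Zs) (vertex 0) (vertex (length Zs))" and ne: "xs \<noteq> ?p"
    have xs': "xs \<in> lists (verts (sg Zs))" "xs \<noteq> []" "xs ! 0 = vertex 0" "xs ! (length xs - 1) = vertex (length Zs)"
      using xs by (auto simp: paths_iff hd_conv_nth last_conv_nth)
    \<comment> \<open>If every step raised the index by exactly one, then starting from
      \<open>vertex 0\<close> one would have \<open>xs ! i = vertex i\<close> throughout, and the
      last vertex would fix the length, so \<open>xs\<close> would be \<open>?p\<close>.\<close>
    have "\<exists>i < length xs - 1. \<exists>j k. xs ! i = vertex j \<and> xs ! Suc i = vertex k \<and> j \<le> length Zs \<and> k \<le> length Zs \<and> k \<noteq> Suc j"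
    proof (rule ccontr)
      assume no: "\<not> ?thesis"
      have step: "xs ! i = vertex i" if "i < length xs" for i
        using that
      proof (induction i)
        case (Suc i)
        then obtain k where k: "xs ! Suc i = vertex k" "k \<le> length Zs"
          using lists_nth[OF xs'(1) Suc.prems] by (metis seq_graph_vertsE)
        have "xs ! i \<in> verts (sg Zs)" using lists_nth[OF xs'(1), of i] Suc.prems by simp
        then have "i \<le> length Zs" using Suc by simp
        then have "k = Suc i" using no Suc k by (metis Suc_lessD Suc_less_eq Suc_pred' length_greater_0_conv less_diff_conv Suc_eq_plus1 xs'(2))
        then show ?case using k by simp
      qed (simp add: xs')
      have "length xs - 1 = length Zs" using step[of "length xs - 1"] xs'(2,4) by simp
      then have l: "length xs = Suc (length Zs)" using xs'(2) by (cases xs) auto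
      then have "xs = ?p" using step nth len(1) by (intro nth_equalityI) auto
      then show False using ne by simp
    qed
    then obtain i j k where i: "i < length xs - 1" "xs ! i = vertex j" "xs ! Suc i = vertex k"
      "j \<le> length Zs" "k \<le> length Zs" "k \<noteq> Suc j" by blast
    then have "along (edge (sg Zs)) xs ! i = initial V" by (simp add: edge_seq_graph)
    then show "is_initial V (path_tensor E (sg Zs) xs)"
      unfolding path_tensor_def using i(1) initial
      by (intro tensor_initial[of _ i] along_edge_Ob[OF Z xs'(1)]) simp_all
  qed
qed

end

text \<open>With Gamma as its source, \<psi> is determined by its composites with the inclusions of
  summands, and these are what the computations below evaluate.\<close>

locale Gamma_presentation = graph_monad V small T + distributive_multitensor V small E
  for V :: "('o, 'm) cat" (structure) and small :: "'u set \<Rightarrow> bool"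
    and T :: "(('u, 'o) vgraph, ('u, 'o, 'm) gmap) monad_data" and E :: "('o, 'm) multitensor_data" +
  fixes \<psi> :: "('u, 'o) vgraph \<Rightarrow> ('u, 'o, 'm) gmap"
  assumes \<psi>_hom: "\<And>X. vgraph X \<Longrightarrow> \<psi> X \<in> hom G (Gamma_ob V E X) (mob T X)"
    and \<psi>_obj: "\<And>X. vgraph X \<Longrightarrow> gobj (\<psi> X) = (\<lambda>a \<in> verts X. a)"
    and \<psi>_iso: "\<And>X. vgraph X \<Longrightarrow> is_iso G (\<psi> X)"
    and \<psi>_nat: "\<And>f X Y. f \<in> hom G X Y \<Longrightarrow> \<psi> Y \<star> Gamma_ar V E f = mar T f \<star> \<psi> X"
    and \<psi>_eta: "\<And>X. vgraph X \<Longrightarrow> \<psi> X \<star> Gamma_eta V E X = eta T X"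
    and \<psi>_mu: "\<And>X. vgraph X \<Longrightarrow> \<psi> X \<star> Gamma_mu V E X =
      mu T X \<star> (mar T (\<psi> X) \<star> \<psi> (Gamma_ob V E X))"
begin

section \<open>The laws of the comparison map read off on single homs\<close>

abbreviation \<psi>h :: "('u, 'o) vgraph \<Rightarrow> 'u \<Rightarrow> 'u \<Rightarrow> 'm" where "\<psi>h X \<equiv> ghom (\<psi> X)"

lemma gobj_\<psi> [simp]: "vgraph X \<Longrightarrow> a \<in> verts X \<Longrightarrow> gobj (\<psi> X) a = a"
  by (simp add: \<psi>_obj)

lemma \<psi>h_hom:
  assumes "vgraph X" "a \<in> verts X" "b \<in> verts X"
  shows "\<psi>h X a b \<in> hom V (edge (Gamma_ob V E X) a b) (edge (mob T X) a b)"
  using graph_homD(6)[OF \<psi>_hom[OF assms(1)], of a b] assms by simp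

lemma \<psi>h_iso:
  assumes "vgraph X" "a \<in> verts X" "b \<in> verts X"
  shows "is_iso V (\<psi>h X a b)"
  using graph_iso_over_Set_iff[OF \<psi>_hom[OF assms(1)]] \<psi>_iso[OF assms(1)] assms
  by (simp add: \<psi>_obj verts_mob)

lemma \<psi>h_nat:
  assumes f: "f \<in> hom G X Y" and ab: "a \<in> verts X" "b \<in> verts X"
  shows "\<psi>h Y (gobj f a) (gobj f b) \<cdot> ghom (Gamma_ar V E f) a b = ghom (mar T f) a b \<cdot> \<psi>h X a b"
proof -
  note X = graph_homD(1)[OF f]
  have "ghom (\<psi> Y \<star> Gamma_ar V E f) a b = ghom (mar T f \<star> \<psi> X) a b" using \<psi>_nat[OF f] by simp
  then show ?thesis
    using ab X by (simp add: ghom_G_cmp(2)[OF Gamma_ar_hom(1)[OF f]] ghom_G_cmp(2)[OF \<psi>_hom[OF X]] Gamma_ar_hom(2)[OF f])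
qed

lemma \<psi>h_eta:
  assumes X: "vgraph X" and ab: "a \<in> verts X" "b \<in> verts X"
  shows "\<psi>h X a b \<cdot> (Gamma_incl V E X [a, b] \<cdot> tunit E (edge X a b)) = ghom (eta T X) a b"
proof -
  have "ghom (\<psi> X \<star> Gamma_eta V E X) a b = ghom (eta T X) a b" using \<psi>_eta[OF X] by simp
  then show ?thesis
    using ab X by (simp add: ghom_G_cmp(2)[OF Gamma_eta_hom(1)[OF X]] Gamma_eta_hom(2,3)[OF X])
qed

lemma \<psi>h_mu:
  assumes X: "vgraph X" and ab: "a \<in> verts X" "b \<in> verts X"
  shows "\<psi>h X a b \<cdot> ghom (Gamma_mu V E X) a b =
    ghom (mu T X) a b \<cdot> (ghom (mar T (\<psi> X)) a b \<cdot> \<psi>h (Gamma_ob V E X) a b)"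
proof -
  note GX = Gamma_vgraph[OF X]
  note T\<psi> = mar_hom[OF \<psi>_hom[OF X]]
  have "ghom (\<psi> X \<star> Gamma_mu V E X) a b =
    ghom (mu T X \<star> (mar T (\<psi> X) \<star> \<psi> (Gamma_ob V E X))) a b" using \<psi>_mu[OF X] by simp
  then show ?thesis
    using ab X GX by (simp add: ghom_G_cmp(2)[OF Gamma_mu_hom(1)[OF X]] Gamma_mu_hom(2)[OF X]
        ghom_G_cmp[OF G.cmp_hom[OF \<psi>_hom[OF GX] T\<psi>(1)]] ghom_G_cmp[OF \<psi>_hom[OF GX]] T\<psi>(2))
qed

section \<open>The comparison of \<open>E\<close> with the induced multitensor\<close>

definition \<theta> :: "'o list \<Rightarrow> 'm" where
  "\<theta> Zs = \<psi>h (sg Zs) (vertex 0) (vertex (length Zs)) \<cdot> Gamma_incl V E (sg Zs) (seq_path Zs)"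

lemma \<theta>_hom: "Zs \<in> lists (Ob V) \<Longrightarrow> \<theta> Zs \<in> hom V (tob E Zs) (bar_ob V T Zs)"
  using cmp_hom[OF Gamma_incl_hom[OF seq_graph_vgraph seq_path_in] \<psi>h_hom[OF seq_graph_vgraph]]
  by (simp add: \<theta>_def bar_ob_def)

lemma \<theta>_iso: "Zs \<in> lists (Ob V) \<Longrightarrow> is_iso V (\<theta> Zs)"
  using Gamma_incl_seq_path_iso[of Zs] seq_graph_vgraph unfolding \<theta>_def seq_path_def[symmetric]
  by (intro iso_cmp[OF _ Gamma_incl_hom[OF seq_graph_vgraph seq_path_in] _ \<psi>h_hom[OF seq_graph_vgraph]] \<psi>h_iso)
    simp_all

text \<open>Naturality of \<psi> at the path map of \<open>xs\<close>. That map sends the standard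
  path to \<open>xs\<close> and has identities along it, so under Gamma the summand at the standard
  path goes by an identity to the summand at \<open>xs\<close>.\<close>

lemma \<psi>h_incl:
  assumes X: "vgraph X" and xs: "xs \<in> paths X a b"
  shows "\<psi>h X a b \<cdot> Gamma_incl V E X xs = path_comp X xs \<cdot> \<theta> (along (edge X) xs)"
proof -
  have xs': "xs \<in> lists (verts X)" "xs \<noteq> []" "hd xs = a" "last xs = b" using xs by (auto simp: paths_iff)
  note ab = paths_ends[OF xs]
  define Zs where "Zs = along (edge X) xs"
  have Zs: "Zs \<in> lists (Ob V)" using along_edge_Ob[OF X xs'(1)] by (simp add: Zs_def)
  note Z = seq_graph_vgraph[OF Zs]
  have "length Zs = length xs - 1" by (simp add: Zs_def)
  moreover have "i \<le> length xs - 1 \<longleftrightarrow> i < length xs" for i using xs'(2) by (cases xs) auto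
  ultimately have len: "length Zs = length xs - 1" "i \<le> length Zs \<longleftrightarrow> i < length xs" for i by simp_all
  define f where "f = path_map V X xs"
  have f: "f \<in> hom G (sg Zs) X" using path_map_hom[OF X xs'(1,2)] by (simp add: f_def Zs_def)
  have v: "vertex 0 \<in> verts (sg Zs)" "vertex (length Zs) \<in> verts (sg Zs)" by simp_all
  have f_obj: "gobj f (vertex i) = xs ! i" if "i \<le> length Zs" for i
    using that xs'(2) len(2) by (simp add: f_def path_map_simps)
  then have f_ends: "gobj f (vertex 0) = a" "gobj f (vertex (length Zs)) = b"
    using xs' len(1) by (auto simp: hd_conv_nth last_conv_nth)
  have mp: "map (gobj f) (seq_path Zs) = xs"
    using f_obj len xs'(2) by (intro nth_equalityI) auto
  have al: "along (ghom f) (seq_path Zs) = map (ident V) Zs"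
    using len by (intro nth_equalityI) (auto simp: f_def path_map_simps Zs_def)
  have G: "ghom (Gamma_ar V E f) (vertex 0) (vertex (length Zs)) \<cdot> Gamma_incl V E (sg Zs) (seq_path Zs) = Gamma_incl V E X xs"
    using Gamma_ar_hom(3)[OF f seq_path_in] ident_right[OF Gamma_incl_hom[OF X xs]]
    by (simp add: mp al E_ident[OF Zs]) (simp add: Zs_def)
  have Gf: "ghom (Gamma_ar V E f) (vertex 0) (vertex (length Zs)) \<in>
      hom V (edge (Gamma_ob V E (sg Zs)) (vertex 0) (vertex (length Zs))) (edge (Gamma_ob V E X) a b)"
    using graph_homD(6)[OF Gamma_ar_hom(1)[OF f], of "vertex 0" "vertex (length Zs)"] f_ends
    by (simp add: Gamma_ar_hom(2)[OF f])
  have Tf: "ghom (mar T f) (vertex 0) (vertex (length Zs)) \<in>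
      hom V (edge (mob T (sg Zs)) (vertex 0) (vertex (length Zs))) (edge (mob T X) a b)"
    using ghom_mar_hom[OF f v] f_ends by simp
  note H = Gf Tf \<psi>h_hom[OF X ab] \<psi>h_hom[OF Z v] Gamma_incl_hom[OF Z seq_path_in]
  have "\<psi>h X a b \<cdot> Gamma_incl V E X xs =
    (\<psi>h X a b \<cdot> ghom (Gamma_ar V E f) (vertex 0) (vertex (length Zs))) \<cdot> Gamma_incl V E (sg Zs) (seq_path Zs)"
    using H[THEN homD] by (simp add: cmp_assoc_Ar G)
  also have "\<dots> = ghom (mar T f) (vertex 0) (vertex (length Zs)) \<cdot> \<theta> Zs"
    using H[THEN homD] \<psi>h_nat[OF f v] f_ends by (simp add: cmp_assoc_Ar \<theta>_def)
  finally show ?thesis by (simp add: path_comp_def f_def len(1)) (simp add: Zs_def)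
qed

text \<open>Naturality of \<psi> at the graph map given by \<open>fs\<close>, which sends standard
  path to standard path and acts on that summand by \<open>tar E fs\<close>.\<close>

lemma \<theta>_nat:
  assumes fs: "fs \<in> hom (seq_cat V) Xs Ys"
  shows "\<theta> Ys \<cdot> tar E fs = bar_ar V T fs \<cdot> \<theta> Xs"
proof -
  have O: "Xs \<in> lists (Ob V)" "Ys \<in> lists (Ob V)" using seq_hom_Ob[OF fs] by auto
  note X = seq_graph_vgraph[OF O(1)] and Y = seq_graph_vgraph[OF O(2)]
  note l = seq_homD(1,2)[OF fs]
  define f where "f = seq_arrow Xs Ys fs"
  have f: "f \<in> hom G (sg Xs) (sg Ys)" using seq_arrow_hom[OF fs] by (simp add: f_def)
  have f_obj: "gobj f (vertex i) = vertex i" if "i \<le> length Xs" for i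
    using that by (simp add: f_def seq_map_simps)
  let ?v = "vertex 0" and ?w = "vertex (length Xs)"
  have v: "?v \<in> verts (sg Xs)" "?w \<in> verts (sg Xs)" "?v \<in> verts (sg Ys)" "?w \<in> verts (sg Ys)" using l by simp_all
  have mp: "map (gobj f) (seq_path Xs) = seq_path Ys" using f_obj l by (intro nth_equalityI) auto
  have al: "along (ghom f) (seq_path Xs) = fs"
    using l by (intro nth_equalityI) (auto simp: f_def seq_map_simps)
  have py: "seq_path Ys \<in> paths (sg Ys) ?v ?w" using seq_path_in[of Ys] l by simp
  have G: "ghom (Gamma_ar V E f) ?v ?w \<cdot> Gamma_incl V E (sg Xs) (seq_path Xs) = Gamma_incl V E (sg Ys) (seq_path Ys) \<cdot> tar E fs"
    using Gamma_ar_hom(3)[OF f seq_path_in] by (simp add: mp al)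
  have Gf: "ghom (Gamma_ar V E f) ?v ?w \<in> hom V (edge (Gamma_ob V E (sg Xs)) ?v ?w) (edge (Gamma_ob V E (sg Ys)) ?v ?w)"
    using graph_homD(6)[OF Gamma_ar_hom(1)[OF f], of ?v ?w] f_obj by (simp add: Gamma_ar_hom(2)[OF f])
  have Tf: "ghom (mar T f) ?v ?w \<in> hom V (edge (mob T (sg Xs)) ?v ?w) (edge (mob T (sg Ys)) ?v ?w)"
    using ghom_mar_hom[OF f v(1,2)] f_obj by simp
  note H = Gf Tf \<psi>h_hom[OF X v(1,2)] \<psi>h_hom[OF Y v(3,4)] Gamma_incl_hom[OF X seq_path_in]
        Gamma_incl_hom[OF Y py[unfolded along_seq_path]] E_hom[OF fs]
  have "\<theta> Ys \<cdot> tar E fs = (\<psi>h (sg Ys) ?v ?w \<cdot> ghom (Gamma_ar V E f) ?v ?w) \<cdot> Gamma_incl V E (sg Xs) (seq_path Xs)"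
    using H[THEN homD] l by (simp add: \<theta>_def cmp_assoc_Ar G)
  also have "\<dots> = ghom (mar T f) ?v ?w \<cdot> \<theta> Xs"
    using H[THEN homD] \<psi>h_nat[OF f v(1,2)] f_obj by (simp add: cmp_assoc_Ar \<theta>_def)
  finally show ?thesis by (simp add: bar_ar_eq[OF fs] f_def)
qed

lemma \<theta>_unit:
  assumes X: "X \<in> Ob V"
  shows "\<theta> [X] \<cdot> tunit E X = bar_unit V T X"
proof -
  have l: "[X] \<in> lists (Ob V)" using X by simp
  note Z = seq_graph_vgraph[OF l]
  have v: "vertex 0 \<in> verts (sg [X])" "vertex (Suc 0) \<in> verts (sg [X])" by simp_all
  have p: "seq_path [X] = [vertex 0, vertex (Suc 0)]" by (simp add: seq_path_def)
  have e: "edge (sg [X]) (vertex 0) (vertex (Suc 0)) = X" using edge_seq_graph_Suc[of 0 "[X]"] by simp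
  have i: "Gamma_incl V E (sg [X]) (seq_path [X]) \<in> hom V (tob E [X]) (edge (Gamma_ob V E (sg [X])) (vertex 0) (vertex (Suc 0)))"
    using Gamma_incl_hom[OF Z seq_path_in] by simp
  show ?thesis
    using \<psi>h_eta[OF Z v] homD[OF \<psi>h_hom[OF Z v]] homD[OF i] homD[OF E_unit_hom[OF X]]
    by (simp add: e \<theta>_def bar_unit_def p cmp_assoc_Ar)
qed

text \<open>Compatibility of \<psi> with the multiplications, restricted to the summand
  \<open>(ys, ps)\<close>. Evaluated in an arbitrary graph it leaves a path component in front of
  both sides, which cannot be cancelled in general; \<open>\<theta>_sub\<close> chooses the graph so
  that it is an identity.\<close>

lemma \<theta>_path_sub:
  assumes X: "vgraph X" and ys: "ys \<in> paths X a b" and ps: "ps \<in> path_families X ys"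
  defines "Zss \<equiv> map (along (edge X)) ps"
  shows "path_comp X (a # concat (map tl ps)) \<cdot> (\<theta> (concat Zss) \<cdot> tsub E Zss) =
    path_comp X (a # concat (map tl ps)) \<cdot>
      (bar_sub small V T Zss \<cdot> (bar_ar V T (map \<theta> Zss) \<cdot> \<theta> (map (tob E) Zss)))"
proof -
  note D = path_family[OF X ys ps]
  note ys' = D(1-4) and len = D(5) and psi = D(6)
  note ab = paths_ends[OF ys]
  define xs where "xs = a # concat (map tl ps)"
  note xs = D(7)[folded xs_def] and along_xs = D(8)[of "edge X", folded xs_def Zss_def] and Zss = D(9)[folded Zss_def]
  have Zp: "along (edge X) p \<in> lists (Ob V)" if "p \<in> set ps" for p
    using along_edge_Ob[OF X conjunct1[OF path_families_paths[OF ps that]]] .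
  have tE: "map (tob E) Zss \<in> lists (Ob V)" by (rule lists_nthI) (simp add: Zss_def Zp E_Ob)
  define X1 where "X1 = Gamma_ob V E X"
  have X1: "vgraph X1" and X2: "vgraph (mob T X)"
    using Gamma_vgraph[OF X] mob_vgraph[OF X] by (auto simp: X1_def)
  have ys1: "ys \<in> paths X1 a b" and ys2: "ys \<in> paths (mob T X) a b"
    using ys verts_mob[OF X] by (auto simp: X1_def paths_def)
  have ab1: "a \<in> verts X1" "b \<in> verts X1" using ab by (auto simp: X1_def)
  let ?is = "map (Gamma_incl V E X) ps" and ?cs = "map (path_comp X) ps" and ?fs = "along (\<psi>h X) ys"
  have ins: "?is \<in> hom (seq_cat V) (map (tob E) Zss) (along (edge X1) ys)"
    using len psi by (intro seq_homI) (auto simp: Zss_def X1_def intro!: Gamma_incl_hom[OF X])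
  have cs: "?cs \<in> hom (seq_cat V) (map (bar_ob V T) Zss) (along (edge (mob T X)) ys)"
    using len psi by (intro seq_homI) (auto simp: Zss_def intro!: path_comp_hom[OF X])
  have mp: "map (gobj (\<psi> X)) ys = ys"
    using ys'(1) X by (intro map_idI) (auto simp: in_lists_conv_set)
  have fs: "?fs \<in> hom (seq_cat V) (along (edge X1) ys) (along (edge (mob T X)) ys)"
    using along_ghom[OF \<psi>_hom[OF X], of ys] ys'(1) by (simp add: X1_def mp)
  have \<theta>s: "map \<theta> Zss \<in> hom (seq_cat V) (map (tob E) Zss) (map (bar_ob V T) Zss)"
    using Zp \<theta>_hom by (intro seq_hom_map) (auto simp: Zss_def)
  \<comment> \<open>This is \<open>\<psi>h_incl\<close> for each member of \<open>ps\<close>;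
    functoriality of \<open>bar_ar\<close> turns it into the square \<open>sq\<close>.\<close>
  have "map2 (\<cdot>) ?fs ?is = map2 (\<cdot>) ?cs (map \<theta> Zss)"
    using len psi \<psi>h_incl[OF X psi] by (intro nth_equalityI) (auto simp: Zss_def)
  then have sq: "bar_ar V T ?fs \<cdot> bar_ar V T ?is = bar_ar V T ?cs \<cdot> bar_ar V T (map \<theta> Zss)"
    using seq_functorD(4)[OF bar_functor ins fs] seq_functorD(4)[OF bar_functor \<theta>s cs] by simp
  have sE: "tsub E Zss \<in> hom V (tob E (map (tob E) Zss)) (tob E (concat Zss))" using E_sub_hom[OF Zss] .
  have inc: "Gamma_incl V E X xs \<in> hom V (tob E (concat Zss)) (edge X1 a b)"
    using Gamma_incl_hom[OF X xs] by (simp add: along_xs X1_def)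
  have pc: "path_comp X xs \<in> hom V (bar_ob V T (concat Zss)) (edge (mob T X) a b)"
    using path_comp_hom[OF X xs] by (simp add: along_xs)
  have cZ: "concat Zss \<in> lists (Ob V)" using seq_hom_Ob[OF seq_hom_ident] along_edge_Ob[OF X, of xs] xs
    by (simp add: along_xs paths_iff)
  have inc1: "Gamma_incl V E X1 ys \<in> hom V (tob E (along (edge X1) ys)) (edge (Gamma_ob V E X1) a b)"
    using Gamma_incl_hom[OF X1 ys1] .
  have yO: "along (edge X1) ys \<in> lists (Ob V)" using seq_hom_Ob[OF fs] by simp
  have m\<mu>: "ghom (Gamma_mu V E X) a b \<in> hom V (edge (Gamma_ob V E X1) a b) (edge X1 a b)"
    using graph_homD(6)[OF Gamma_mu_hom(1)[OF X], of a b] Gamma_mu_hom(2)[OF X] ab by (simp add: X1_def)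
  have T\<psi>: "ghom (mar T (\<psi> X)) a b \<in> hom V (edge (mob T X1) a b) (edge (mob T (mob T X)) a b)"
    using ghom_mar_hom[OF \<psi>_hom[OF X], of a b] ab X by (simp add: X1_def)
  have T\<mu>: "ghom (mu T X) a b \<in> hom V (edge (mob T (mob T X)) a b) (edge (mob T X) a b)"
    using graph_homD(6)[OF mu_hom(1)[OF X], of a b] mu_hom(2)[OF X] ab by (simp add: verts_mob X X2)
  note H = sE inc pc \<theta>_hom[OF cZ] inc1 \<psi>h_hom[OF X ab, folded X1_def] \<psi>h_hom[OF X1 ab1] m\<mu>
        T\<psi> T\<mu> E_hom[OF ins] bar_ar_hom[OF ins] bar_ar_hom[OF cs] bar_ar_hom[OF fs]
        bar_ar_hom[OF \<theta>s] path_comp_hom[OF X1 ys1] path_comp_hom[OF X2 ys2] \<theta>_hom[OF yO]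
        \<theta>_hom[OF tE] bar_sub_hom[OF Zss]
  \<comment> \<open>The ingredients of the chain: 1 and 4 evaluate \<psi> on a summand, for
    \<open>X\<close> and for \<open>Gamma_ob V E X\<close>; 2 evaluates the multiplication of Gamma;
    3 is compatibility of \<psi> with the multiplications; 5 and 6 are the behaviour of path
    components under graph maps and under \<open>mu\<close>.\<close>
  have 1: "\<psi>h X a b \<cdot> Gamma_incl V E X xs = path_comp X xs \<cdot> \<theta> (concat Zss)"
    using \<psi>h_incl[OF X xs] by (simp add: along_xs)
  have 2: "ghom (Gamma_mu V E X) a b \<cdot> (Gamma_incl V E X1 ys \<cdot> tar E ?is) = Gamma_incl V E X xs \<cdot> tsub E Zss"
    using Gamma_mu_hom(3)[OF X ys ps] by (simp add: X1_def xs_def Zss_def)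
  have 3: "\<psi>h X a b \<cdot> ghom (Gamma_mu V E X) a b = ghom (mu T X) a b \<cdot> (ghom (mar T (\<psi> X)) a b \<cdot> \<psi>h X1 a b)"
    using \<psi>h_mu[OF X ab] by (simp add: X1_def)
  have 4: "\<psi>h X1 a b \<cdot> Gamma_incl V E X1 ys = path_comp X1 ys \<cdot> \<theta> (along (edge X1) ys)"
    using \<psi>h_incl[OF X1 ys1] .
  have 5: "ghom (mar T (\<psi> X)) a b \<cdot> path_comp X1 ys = path_comp (mob T X) ys \<cdot> bar_ar V T ?fs"
    using path_comp_nat[OF \<psi>_hom[OF X], of ys a b] ys1 by (simp add: mp X1_def)
  have 6: "ghom (mu T X) a b \<cdot> (path_comp (mob T X) ys \<cdot> bar_ar V T ?cs) = path_comp X xs \<cdot> bar_sub small V T Zss"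
    using mu_path_comp[OF X ys ps] by (simp add: xs_def Zss_def)
  have "path_comp X xs \<cdot> (\<theta> (concat Zss) \<cdot> tsub E Zss) = \<psi>h X a b \<cdot> (Gamma_incl V E X xs \<cdot> tsub E Zss)"
    using H[THEN homD] by (simp add: cmp_assoc_Ar cmp_Ar cmp_chain[OF 1])
  also have "\<dots> = (\<psi>h X a b \<cdot> ghom (Gamma_mu V E X) a b) \<cdot> (Gamma_incl V E X1 ys \<cdot> tar E ?is)"
    using H[THEN homD] by (simp add: cmp_assoc_Ar cmp_Ar 2)
  also have "\<dots> = ghom (mu T X) a b \<cdot> (ghom (mar T (\<psi> X)) a b \<cdot> ((\<psi>h X1 a b \<cdot> Gamma_incl V E X1 ys) \<cdot> tar E ?is))"
    using H[THEN homD] by (simp add: cmp_assoc_Ar cmp_Ar 3)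
  also have "\<dots> = ghom (mu T X) a b \<cdot> ((ghom (mar T (\<psi> X)) a b \<cdot> path_comp X1 ys) \<cdot> (\<theta> (along (edge X1) ys) \<cdot> tar E ?is))"
    using H[THEN homD] by (simp add: cmp_assoc_Ar cmp_Ar 4)
  also have "\<dots> = ghom (mu T X) a b \<cdot> (path_comp (mob T X) ys \<cdot> ((bar_ar V T ?fs \<cdot> bar_ar V T ?is) \<cdot> \<theta> (map (tob E) Zss)))"
    using H[THEN homD] by (simp add: cmp_assoc_Ar cmp_Ar 5 \<theta>_nat[OF ins])
  also have "\<dots> = (ghom (mu T X) a b \<cdot> (path_comp (mob T X) ys \<cdot> bar_ar V T ?cs)) \<cdot> (bar_ar V T (map \<theta> Zss) \<cdot> \<theta> (map (tob E) Zss))"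
    using H[THEN homD] by (simp add: cmp_assoc_Ar cmp_Ar sq del: map_map)
  also have "\<dots> = path_comp X xs \<cdot> (bar_sub small V T Zss \<cdot> (bar_ar V T (map \<theta> Zss) \<cdot> \<theta> (map (tob E) Zss)))"
    using H[THEN homD] by (simp add: cmp_assoc_Ar cmp_Ar 6 del: map_map)
  finally show ?thesis by (simp add: xs_def)
qed

text \<open>In the sequence graph of \<open>concat Zss\<close>, let \<open>ys\<close> run through
  the boundaries between blocks and let \<open>ps\<close> consist of the blocks themselves. Their
  concatenation is the standard path, whose component is an identity, so the prefixed equation
  becomes the desired one.\<close>

lemma \<theta>_sub:
  assumes Zss: "Zss \<in> lists (lists (Ob V))"
  shows "\<theta> (concat Zss) \<cdot> tsub E Zss =
    bar_sub small V T Zss \<cdot> (bar_ar V T (map \<theta> Zss) \<cdot> \<theta> (map (tob E) Zss))"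
proof -
  have cZ: "concat Zss \<in> lists (Ob V)" using concat_Ob[OF Zss] .
  note X = seq_graph_vgraph[OF cZ]
  let ?X = "sg (concat Zss)"
  define ys :: "'u list" where "ys = map (\<lambda>i. vertex (offset Zss i)) [0..<Suc (length Zss)]"
  \<comment> \<open>Each block contains both of its boundary vertices, hence the \<open>Suc\<close>
    in the upper bound; an empty \<open>Zss ! i\<close> gives a path with a single vertex.\<close>
  define ps :: "'u list list" where "ps = map (\<lambda>i. map vertex [offset Zss i..<Suc (offset Zss (Suc i))]) [0..<length Zss]"
  have ys_nth: "ys ! i = vertex (offset Zss i)" if "i \<le> length Zss" for i
    using that by (simp add: ys_def del: upt_Suc)
  have ys_len: "length ys = Suc (length Zss)" by (simp add: ys_def)
  then have ys_ne: "ys \<noteq> []" by auto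
  have ys: "ys \<in> paths ?X (vertex 0) (vertex (length (concat Zss)))"
    using ys_ne ys_len ys_nth offset_le
    by (auto simp: paths_iff hd_conv_nth last_conv_nth offset_length intro!: lists_nthI)
  have ps_nth: "ps ! i = map vertex [offset Zss i..<Suc (offset Zss (Suc i))]" if "i < length Zss" for i
    using that by (simp add: ps_def del: upt_Suc)
  have ps: "ps \<in> path_families ?X ys"
    unfolding path_families_def
  proof (intro CollectI conjI allI impI)
    show "Suc (length ps) = length ys" by (simp add: ps_def ys_len)
    fix i assume "i < length ps"
    then have i: "i < length Zss" by (simp add: ps_def)
    have "offset Zss i \<le> offset Zss (Suc i)" by (rule offset_mono) simp
    then show "ps ! i \<in> paths ?X (ys ! i) (ys ! Suc i)"
      using i order_trans[OF _ offset_le[of Zss "Suc i"]]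
      by (auto simp: ps_nth ys_nth paths_iff hd_map last_map simp del: upt_Suc) 
  qed
  have along: "map (along (edge ?X)) ps = Zss"
  proof (rule nth_equalityI)
    show "length (map (along (edge ?X)) ps) = length Zss" by (simp add: ps_def)
    fix i assume "i < length (map (along (edge ?X)) ps)"
    then have i: "i < length Zss" by (simp add: ps_def)
    have "along (edge ?X) (ps ! i) = Zss ! i"
    proof (rule nth_equalityI)
      show l: "length (along (edge ?X) (ps ! i)) = length (Zss ! i)" using i by (simp add: ps_nth offset_Suc)
      fix j assume "j < length (along (edge ?X) (ps ! i))"
      then have j: "j < length (Zss ! i)" using l by simp
      then show "along (edge ?X) (ps ! i) ! j = Zss ! i ! j"
        using i offset_add_le[of i Zss "Suc j"] concat_nth_offset[OF i j]
        by (simp add: ps_nth offset_Suc edge_seq_graph del: upt_Suc)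
    qed
    then show "map (along (edge ?X)) ps ! i = Zss ! i"
      using \<open>i < length (map (along (edge ?X)) ps)\<close> by simp
  qed
  \<comment> \<open>Without their first vertices, the first \<open>k\<close> blocks list the
    vertices from 1 to \<open>offset Zss k\<close>. It is stated for all \<open>k\<close> so that
    induction applies.\<close>
  have "concat (map tl (map (\<lambda>i. map vertex [offset Zss i..<Suc (offset Zss (Suc i))]) [0..<k])) =
      (map vertex [Suc 0..<Suc (offset Zss k)] :: 'u list)" for k
  proof (induction k)
    case (Suc k)
    have le: "offset Zss k \<le> offset Zss (Suc k)" by (rule offset_mono) simp
    then have "tl (map vertex [offset Zss k..<Suc (offset Zss (Suc k))]) =
        (map vertex [Suc (offset Zss k)..<Suc (offset Zss (Suc k))] :: 'u list)"
      by (simp add: map_tl[symmetric] tl_upt del: upt_Suc)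
    moreover have "[Suc 0..<Suc (offset Zss (Suc k))] = [Suc 0..<Suc (offset Zss k)] @ [Suc (offset Zss k)..<Suc (offset Zss (Suc k))]"
      using le upt_add_eq_append[of "Suc 0" "Suc (offset Zss k)" "offset Zss (Suc k) - offset Zss k"] by simp
    ultimately show ?case using Suc.IH by (simp del: upt_Suc map_map) (simp)
  qed simp
  then have xs: "vertex 0 # concat (map tl ps) = (seq_path (concat Zss) :: 'u list)"
    unfolding ps_def seq_path_def by (simp add: offset_length upt_conv_Cons del: upt_Suc map_map)
  have tE: "map (tob E) Zss \<in> lists (Ob V)"
    by (rule lists_nthI) (simp add: E_Ob[OF lists_nth[OF Zss]])
  have \<theta>s: "map \<theta> Zss \<in> hom (seq_cat V) (map (tob E) Zss) (map (bar_ob V T) Zss)"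
    using \<theta>_hom lists_nth[OF Zss] by (intro seq_homI) auto
  have "\<theta> (concat Zss) \<cdot> tsub E Zss \<in> hom V (tob E (map (tob E) Zss)) (bar_ob V T (concat Zss))"
    using cmp_hom[OF E_sub_hom[OF Zss] \<theta>_hom[OF cZ]] .
  moreover have "bar_sub small V T Zss \<cdot> (bar_ar V T (map \<theta> Zss) \<cdot> \<theta> (map (tob E) Zss)) \<in>
      hom V (tob E (map (tob E) Zss)) (bar_ob V T (concat Zss))"
    using cmp_hom[OF cmp_hom[OF \<theta>_hom[OF tE] bar_ar_hom[OF \<theta>s]] bar_sub_hom[OF Zss]] .
  ultimately show ?thesis
    using \<theta>_path_sub[OF X ys ps] by (simp add: along xs path_comp_seq_path[OF cZ] ident_left)
qed

lemma bar_transport: "multitensor_transport V E (bar small V T) \<theta>"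
proof
  have u: "bar_unit V T X \<in> hom V X (bar_ob V T [X])" if X: "X \<in> Ob V" for X
  proof -
    have l: "[X] \<in> lists (Ob V)" using X by simp
    show ?thesis using cmp_hom[OF E_unit_hom[OF X] \<theta>_hom[OF l]] by (simp add: \<theta>_unit[OF X])
  qed
  show "tunit (bar small V T) X \<in> hom V X (tob (bar small V T) [X])" if "X \<in> Ob V" for X
    using u[OF that] by (simp add: bar_def)
qed (simp_all add: bar_def multitensor bar_functor bar_sub_hom \<theta>_hom \<theta>_iso \<theta>_nat \<theta>_unit \<theta>_sub)

lemma path_like: "is_path_like small V T"
  unfolding is_path_like_def
proof (intro allI impI ballI)
  fix X a b assume X: "vgraph X" and ab: "a \<in> verts X" "b \<in> verts X"
  have Zs: "along (edge X) xs \<in> lists (Ob V)" if "xs \<in> paths X a b" for xs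
    using that along_edge_Ob[OF X] by (simp add: paths_iff)
  have c: "is_coproduct V (paths X a b) (\<lambda>xs. bar_ob V T (along (edge X) xs))
      (coprod V (paths X a b) (\<lambda>xs. bar_ob V T (along (edge X) xs)))
      (incl V (paths X a b) (\<lambda>xs. bar_ob V T (along (edge X) xs)))"
    by (rule is_coproduct_chosen[OF vgraph_small[OF X] paths_subset]) (rule bar_ob_Ob[OF Zs])
  have c': "is_coproduct V (paths X a b) (\<lambda>xs. bar_ob V T (along (edge X) xs)) (edge (mob T X) a b) (path_comp X)"
  proof (rule is_coproduct_iso[OF Gamma_coproduct[OF X ab] \<psi>h_iso[OF X ab] \<psi>h_hom[OF X ab]])
    fix xs assume xs: "xs \<in> paths X a b"
    show "is_iso V (\<theta> (along (edge X) xs))" "\<theta> (along (edge X) xs) \<in> hom V (path_tensor E X xs) (bar_ob V T (along (edge X) xs))"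
      using \<theta>_iso[OF Zs[OF xs]] \<theta>_hom[OF Zs[OF xs]] by (simp_all add: path_tensor_def)
    show "path_comp X xs \<in> hom V (bar_ob V T (along (edge X) xs)) (edge (mob T X) a b)"
      using path_comp_hom[OF X xs] .
    show "path_comp X xs \<cdot> \<theta> (along (edge X) xs) = \<psi>h X a b \<cdot> Gamma_incl V E X xs"
      using \<psi>h_incl[OF X xs] by simp
  qed
  \<comment> \<open>So \<open>pi_map\<close> is the comparison between two coproducts of one family:
    the chosen one and the hom of \<open>mob T X\<close>.\<close>
  have pi: "pi_map V T X a b = cotuple V (paths X a b) (\<lambda>xs. bar_ob V T (along (edge X) xs)) (edge (mob T X) a b) (path_comp X)"
    by (simp add: pi_map_def path_comp_def[abs_def])
  show "is_iso V (pi_map V T X a b)"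
    unfolding pi using cotuple[OF c coproduct_hom(1,2)[OF c']] by (rule coproduct_comparison_iso[OF c c'])
qed

end

lemma (in graph_monad) Gamma_isomorphic_imp:
  assumes "is_distributive_multitensor small V E" "monads_over_Set_isomorphic small V T (Gamma V E)"
  shows "is_distributive_monad small V T" "is_path_like small V T"
    "multitensors_isomorphic V E (bar small V T)"
proof -
  interpret E: distributive_multitensor V small E by unfold_locales (rule assms(1))
  have T: "is_functor G G (mob T) (mar T)" using monad by (simp add: is_monad_over_Set_def is_monad_def)
  \<comment> \<open>The given isomorphism starts at \<open>T\<close>; it is inverted by means of
    functoriality of its source.\<close>
  have "monads_over_Set_isomorphic small V (Gamma V E) T"
    by (rule monads_over_Set_isomorphic_sym[OF assms(2) disjI1[OF T]])
      (simp_all add: Gamma_def E.Gamma_vgraph E.Gamma_ar_hom mob_vgraph mar_hom verts_mob eta_hom mu_hom E.Gamma_mu_hom)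
  then obtain \<psi> where nat: "is_nat_trans G G (Gamma_ob V E) (Gamma_ar V E) (mob T) (mar T) \<psi>"
    and \<psi>: "\<And>X. vgraph X \<Longrightarrow> is_iso G (\<psi> X) \<and> gobj (\<psi> X) = (\<lambda>a \<in> verts X. a) \<and>
      \<psi> X \<star> Gamma_eta V E X = eta T X \<and>
      \<psi> X \<star> Gamma_mu V E X = mu T X \<star> (mar T (\<psi> X) \<star> \<psi> (Gamma_ob V E X))"
    by (auto simp: monads_over_Set_isomorphic_def Let_def Gamma_def)
  interpret Gamma_presentation V small T E \<psi>
  proof
    show "\<psi> X \<in> hom G (Gamma_ob V E X) (mob T X)" if "vgraph X" for X
      using nat that by (simp add: is_nat_trans_def)
    show "\<psi> Y \<star> Gamma_ar V E f = mar T f \<star> \<psi> X" if "f \<in> hom G X Y" for f X Y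
      using nat homD[OF that] by (auto simp: is_nat_trans_def)
  qed (use \<psi> in auto)
  interpret B: multitensor_transport V E "bar small V T" \<theta> by (rule bar_transport)
  show "is_distributive_monad small V T"
    unfolding is_distributive_monad_def by (rule B.distributive[OF assms(1)])
  show "is_path_like small V T" by (rule path_like)
  show "multitensors_isomorphic V E (bar small V T)" by (rule B.isomorphic)
qed

lemma (in graph_monad) isomorphic_Gamma_bar:
  assumes dist: "is_distributive_monad small V T" and path: "is_path_like small V T"
  shows "monads_over_Set_isomorphic small V T (Gamma V (bar small V T))"
proof -
  interpret B: distributive_multitensor V small "bar small V T"
    using dist by unfold_locales (simp add: is_distributive_monad_def)
  let ?B = "bar small V T"
  let ?\<Gamma> = "Gamma_ob V ?B"
  have T: "is_functor G G (mob T) (mar T)" using monad by (simp add: is_monad_over_Set_def is_monad_def)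
  have bar_simps: "tob ?B = bar_ob V T" "tar ?B = bar_ar V T" "tunit ?B = bar_unit V T" "tsub ?B = bar_sub small V T"
    by (simp_all add: bar_def)
  \<comment> \<open>\<open>pi_map\<close> is given hom by hom. With the identity on objects these
    maps form one graph map, and path-likeness is precisely its invertibility.\<close>
  define \<pi> where "\<pi> X = \<lparr>gsrc = ?\<Gamma> X, gtgt = mob T X, gobj = (\<lambda>a \<in> verts X. a),
    ghom = restrict2 (verts X) (pi_map V T X)\<rparr>" for X
  have pi: "pi_map V T X a b \<in> hom V (edge (?\<Gamma> X) a b) (edge (mob T X) a b)"
    "\<And>xs. xs \<in> paths X a b \<Longrightarrow> pi_map V T X a b \<cdot> Gamma_incl V ?B X xs = path_comp X xs"
    if X: "vgraph X" and ab: "a \<in> verts X" "b \<in> verts X" for X a b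
  proof -
    have eq: "pi_map V T X a b = cotuple V (paths X a b) (path_tensor ?B X) (edge (mob T X) a b) (path_comp X)"
      by (simp add: pi_map_def path_comp_def[abs_def] path_tensor_def[abs_def] bar_simps)
    have TX: "edge (mob T X) a b \<in> Ob V" using ab by (intro edge_Ob mob_vgraph X) (simp_all add: verts_mob X)
    have pc: "path_comp X xs \<in> hom V (path_tensor ?B X xs) (edge (mob T X) a b)" if "xs \<in> paths X a b" for xs
      using path_comp_hom[OF X that] by (simp add: path_tensor_def bar_simps)
    note c = cotuple[OF B.paths_coproduct[OF X] TX pc]
    show "pi_map V T X a b \<in> hom V (edge (?\<Gamma> X) a b) (edge (mob T X) a b)"
      using c(1) ab by (simp add: eq Gamma_ob_def restrict2_in)
    show "pi_map V T X a b \<cdot> Gamma_incl V ?B X xs = path_comp X xs" if xs: "xs \<in> paths X a b" for xs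
      using c(2)[OF _ xs] xs by (simp add: eq Gamma_incl_def paths_iff)
  qed
  have \<pi>_hom: "\<pi> X \<in> hom G (?\<Gamma> X) (mob T X)" if X: "vgraph X" for X
    using X B.Gamma_vgraph mob_vgraph verts_mob pi(1)
    by (intro graph_homI) (simp_all add: \<pi>_def restrict2_in extensional2_restrict2)
  have \<pi>_obj: "gobj (\<pi> X) = (\<lambda>a \<in> verts X. a)" for X by (simp add: \<pi>_def)
  have \<pi>_ghom: "ghom (\<pi> X) a b = pi_map V T X a b" if "a \<in> verts X" "b \<in> verts X" for X a b
    using that by (simp add: \<pi>_def restrict2_in)
  have \<pi>_nat: "\<pi> Y \<star> Gamma_ar V ?B f = mar T f \<star> \<pi> X" if f: "f \<in> hom G X Y" for f X Y
  proof -
    note X = graph_homD(1)[OF f] and Y = graph_homD(2)[OF f]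
    note Gf = B.Gamma_ar_hom[OF f] and Tf = mar_hom[OF f]
    note L = G.cmp_hom[OF Gf(1) \<pi>_hom[OF Y]] and R = G.cmp_hom[OF \<pi>_hom[OF X] Tf(1)]
    show ?thesis
    proof (rule gmap_eqI[OF L R])
      fix a assume "a \<in> verts (?\<Gamma> X)"
      then show "gobj (\<pi> Y \<star> Gamma_ar V ?B f) a = gobj (mar T f \<star> \<pi> X) a"
        using graph_homD(5)[OF f, of a] by (simp add: ghom_G_cmp(1)[OF Gf(1)] ghom_G_cmp(1)[OF \<pi>_hom[OF X]] Gf(2) Tf(2) \<pi>_obj)
    next
      fix a b assume "a \<in> verts (?\<Gamma> X)" "b \<in> verts (?\<Gamma> X)"
      then have ab: "a \<in> verts X" "b \<in> verts X" by simp_all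
      have fab: "gobj f a \<in> verts Y" "gobj f b \<in> verts Y" using graph_homD(5)[OF f] ab by auto
      let ?L = "pi_map V T Y (gobj f a) (gobj f b) \<cdot> ghom (Gamma_ar V ?B f) a b"
      let ?R = "ghom (mar T f) a b \<cdot> pi_map V T X a b"
      have l: "ghom (\<pi> Y \<star> Gamma_ar V ?B f) a b = ?L"
        using ab fab by (simp add: ghom_G_cmp(2)[OF Gf(1)] Gf(2) \<pi>_ghom)
      have r: "ghom (mar T f \<star> \<pi> X) a b = ?R"
        using ab by (simp add: ghom_G_cmp(2)[OF \<pi>_hom[OF X]] \<pi>_ghom \<pi>_obj)
      have gf: "ghom (Gamma_ar V ?B f) a b \<in> hom V (edge (?\<Gamma> X) a b) (edge (?\<Gamma> Y) (gobj f a) (gobj f b))"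
        using graph_homD(6)[OF Gf(1), of a b] ab by (simp add: Gf(2))
      note tf = ghom_mar_hom[OF f ab] and piX = pi[OF X ab] and piY = pi[OF Y fab]
      show "ghom (\<pi> Y \<star> Gamma_ar V ?B f) a b = ghom (mar T f \<star> \<pi> X) a b"
        unfolding l r
      \<comment> \<open>Tested on the summand at \<open>xs\<close>, naturality of \<pi> reduces to
        \<open>path_comp_nat\<close>.\<close>
      proof (rule coproduct_eqI[OF B.Gamma_coproduct[OF X ab] cmp_hom[OF gf piY(1)] cmp_hom[OF piX(1) tf]])
        fix xs assume xs: "xs \<in> paths X a b"
        then have xs': "xs \<in> lists (verts X)" by (simp add: paths_iff)
        note fxs = B.map_gobj_paths[OF f xs]
        note bf = along_ghom[OF f xs']
        note H = gf tf piX(1) piY(1) B.Gamma_incl_hom[OF X xs] B.Gamma_incl_hom[OF Y fxs] bar_ar_hom[OF bf]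
        have "?L \<cdot> Gamma_incl V ?B X xs =
          pi_map V T Y (gobj f a) (gobj f b) \<cdot> (Gamma_incl V ?B Y (map (gobj f) xs) \<cdot> bar_ar V T (along (ghom f) xs))"
          using H[THEN homD] by (simp add: cmp_assoc_Ar Gf(3)[OF xs] bar_simps)
        also have "\<dots> = ghom (mar T f) a b \<cdot> path_comp X xs"
          using H[THEN homD] by (simp add: cmp_chain[OF piY(2)[OF fxs]] path_comp_nat[OF f xs] bar_simps)
        also have "\<dots> = ?R \<cdot> Gamma_incl V ?B X xs"
          using H[THEN homD] by (simp add: cmp_assoc_Ar piX(2)[OF xs])
        finally show "?L \<cdot> Gamma_incl V ?B X xs =
          ?R \<cdot> Gamma_incl V ?B X xs" .
      qed
    qed
  qed
  have "monads_over_Set_isomorphic small V (Gamma V ?B) T"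
    unfolding monads_over_Set_isomorphic_def Let_def
  proof (intro exI[of _ \<pi>] conjI ballI)
    show "is_nat_trans G G (mob (Gamma V ?B)) (mar (Gamma V ?B)) (mob T) (mar T) \<pi>"
      unfolding is_nat_trans_def using \<pi>_hom \<pi>_nat[OF G.Ar_hom] by (simp add: Gamma_def)
    fix X assume "X \<in> Ob G"
    then have X: "vgraph X" by simp
    note GX = B.Gamma_vgraph[OF X] and TX = mob_vgraph[OF X]
    show "gobj (\<pi> X) = (\<lambda>a \<in> verts X. a)" by (rule \<pi>_obj)
    show "is_iso G (\<pi> X)"
      using graph_iso_over_Set_iff[OF \<pi>_hom[OF X]] path X
      by (simp add: \<pi>_obj verts_mob \<pi>_ghom is_path_like_def)
    have eta: "Gamma_eta V ?B X \<in> hom G X (?\<Gamma> X)" "\<And>a. a \<in> verts X \<Longrightarrow> gobj (Gamma_eta V ?B X) a = a"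
      using B.Gamma_eta_hom[OF X] by auto
    have "\<pi> X \<star> Gamma_eta V ?B X = eta T X"
    proof (rule gmap_eqI[OF G.cmp_hom[OF eta(1) \<pi>_hom[OF X]] eta_hom(1)[OF X]])
      show "gobj (\<pi> X \<star> Gamma_eta V ?B X) a = gobj (eta T X) a" if "a \<in> verts X" for a
        using that by (simp add: ghom_G_cmp(1)[OF eta(1)] eta(2) \<pi>_obj eta_hom(2)[OF X])
      fix a b assume ab: "a \<in> verts X" "b \<in> verts X"
      have p: "[a, b] \<in> paths X a b" using ab by (simp add: paths_iff)
      have al: "along (edge X) [a, b] = [edge X a b]" by (simp add: along_def)
      note H = pi(1)[OF X ab] B.Gamma_incl_hom[OF X p] B.E_unit_hom[OF edge_Ob[OF X ab]]
      show "ghom (\<pi> X \<star> Gamma_eta V ?B X) a b = ghom (eta T X) a b"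
        using ab H[THEN homD] by (simp add: ghom_G_cmp(2)[OF eta(1)] eta(2) \<pi>_ghom B.Gamma_eta_hom(3)[OF X]
            cmp_chain[OF pi(2)[OF X ab p]] eta_path_comp[OF X ab] bar_simps al)
    qed
    then show "\<pi> X \<star> eta (Gamma V ?B) X = eta T X" by (simp add: Gamma_def)
    note mu = B.Gamma_mu_hom[OF X] and T\<pi> = mar_hom[OF \<pi>_hom[OF X]] and mT = mu_hom[OF X]
    note R = G.cmp_hom[OF \<pi>_hom[OF GX] T\<pi>(1)]
    have "\<pi> X \<star> Gamma_mu V ?B X = mu T X \<star> (mar T (\<pi> X) \<star> \<pi> (?\<Gamma> X))"
    proof (rule gmap_eqI[OF G.cmp_hom[OF mu(1) \<pi>_hom[OF X]] G.cmp_hom[OF R mT(1)]])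
      show "gobj (\<pi> X \<star> Gamma_mu V ?B X) a = gobj (mu T X \<star> (mar T (\<pi> X) \<star> \<pi> (?\<Gamma> X))) a"
        if "a \<in> verts (?\<Gamma> (?\<Gamma> X))" for a
        using that by (simp add: ghom_G_cmp(1)[OF mu(1)] ghom_G_cmp(1)[OF R] ghom_G_cmp(1)[OF \<pi>_hom[OF GX]] mu(2) mT(2) T\<pi>(2) \<pi>_obj)
      fix a b assume "a \<in> verts (?\<Gamma> (?\<Gamma> X))" "b \<in> verts (?\<Gamma> (?\<Gamma> X))"
      then have ab: "a \<in> verts X" "b \<in> verts X" by simp_all
      then have ab1: "a \<in> verts (?\<Gamma> X)" "b \<in> verts (?\<Gamma> X)" by simp_all
      let ?L = "pi_map V T X a b \<cdot> ghom (Gamma_mu V ?B X) a b"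
      let ?R = "ghom (mu T X) a b \<cdot> (ghom (mar T (\<pi> X)) a b \<cdot> pi_map V T (?\<Gamma> X) a b)"
      have l: "ghom (\<pi> X \<star> Gamma_mu V ?B X) a b = ?L"
        using ab by (simp add: ghom_G_cmp(2)[OF mu(1)] mu(2) \<pi>_ghom)
      have r: "ghom (mu T X \<star> (mar T (\<pi> X) \<star> \<pi> (?\<Gamma> X))) a b =
          ?R"
        using ab by (simp add: ghom_G_cmp[OF R] ghom_G_cmp[OF \<pi>_hom[OF GX]] T\<pi>(2) \<pi>_ghom \<pi>_obj)
      have g\<mu>: "ghom (Gamma_mu V ?B X) a b \<in> hom V (edge (?\<Gamma> (?\<Gamma> X)) a b) (edge (?\<Gamma> X) a b)"
        using graph_homD(6)[OF mu(1), of a b] ab mu(2) by simp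
      have t\<pi>: "ghom (mar T (\<pi> X)) a b \<in> hom V (edge (mob T (?\<Gamma> X)) a b) (edge (mob T (mob T X)) a b)"
        using ghom_mar_hom[OF \<pi>_hom[OF X], of a b] ab by (simp add: \<pi>_obj)
      have t\<mu>: "ghom (mu T X) a b \<in> hom V (edge (mob T (mob T X)) a b) (edge (mob T X) a b)"
        using graph_homD(6)[OF mT(1), of a b] mT(2) ab by (simp add: verts_mob X TX)
      note pX = pi[OF X ab] and pG = pi[OF GX ab1]
      show "ghom (\<pi> X \<star> Gamma_mu V ?B X) a b = ghom (mu T X \<star> (mar T (\<pi> X) \<star> \<pi> (?\<Gamma> X))) a b"
        unfolding l r
      \<comment> \<open>The multiplication law is tested on the summands \<open>(ys, ps)\<close>,
        where \<open>mu_path_comp\<close> supplies the required relation between \<open>mu\<close>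
        and path components.\<close>
      proof (rule coproduct_eqI[OF B.Gamma_Gamma_coproduct[OF X ab] cmp_hom[OF g\<mu> pX(1)] cmp_hom[OF cmp_hom[OF pG(1) t\<pi>] t\<mu>]])
        fix q assume q: "q \<in> Sigma (paths X a b) (path_families X)"
        obtain ys ps where q_eq: "q = (ys, ps)" and ys: "ys \<in> paths X a b" and ps: "ps \<in> path_families X ys"
          using q by blast
        note D = path_family[OF X ys ps]
        note ys' = D(1-4) and len = D(5) and psi = D(6)
        have nth: "ys ! i \<in> verts X" if "i < length ys" for i using lists_nth[OF ys'(1) that] .
        define xs where "xs = a # concat (map tl ps)"
        define Zss where "Zss = map (along (edge X)) ps"
        note xs = D(7)[folded xs_def] and along_xs = D(8)[of "edge X", folded xs_def Zss_def] and Zss = D(9)[folded Zss_def]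
        have ys1: "ys \<in> paths (?\<Gamma> X) a b" and ys2: "ys \<in> paths (mob T X) a b"
          using ys verts_mob[OF X] by (auto simp: paths_def)
        let ?i = "Gamma_incl V ?B (?\<Gamma> X) ys"
        let ?is = "map (Gamma_incl V ?B X) ps" and ?cs = "map (path_comp X) ps" and ?fs = "along (ghom (\<pi> X)) ys"
        have ins: "?is \<in> hom (seq_cat V) (map (bar_ob V T) Zss) (along (edge (?\<Gamma> X)) ys)"
          using len psi B.Gamma_incl_hom[OF X psi] by (intro seq_homI) (auto simp: Zss_def bar_simps)
        have cs: "?cs \<in> hom (seq_cat V) (map (bar_ob V T) Zss) (along (edge (mob T X)) ys)"
          using len psi by (intro seq_homI) (auto simp: Zss_def intro!: path_comp_hom[OF X])
        have mp: "map (gobj (\<pi> X)) ys = ys"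
          using ys'(1) by (intro map_idI) (auto simp: in_lists_conv_set \<pi>_obj)
        have fs: "?fs \<in> hom (seq_cat V) (along (edge (?\<Gamma> X)) ys) (along (edge (mob T X)) ys)"
          using along_ghom[OF \<pi>_hom[OF X], of ys] ys'(1) by (simp add: mp)
        \<comment> \<open>On each step of \<open>ys\<close> the map \<pi> after the inclusion at a
          path is the component at that path, the defining property of
          \<open>pi_map\<close>.\<close>
        have "map2 (\<cdot>) ?fs ?is = ?cs"
          using len psi nth by (intro nth_equalityI) (auto simp: \<pi>_ghom intro!: pi(2)[OF X])
        then have sq: "bar_ar V T ?fs \<cdot> bar_ar V T ?is = bar_ar V T ?cs"
          using seq_functorD(4)[OF bar_functor ins fs] by simp
        have inc: "Gamma_incl V ?B X xs \<in> hom V (bar_ob V T (concat Zss)) (edge (?\<Gamma> X) a b)"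
          using B.Gamma_incl_hom[OF X xs] by (simp add: along_xs bar_simps)
        have inc1: "?i \<in> hom V (bar_ob V T (along (edge (?\<Gamma> X)) ys)) (edge (?\<Gamma> (?\<Gamma> X)) a b)"
          using B.Gamma_incl_hom[OF GX ys1] by (simp add: bar_simps)
        note H = inc inc1 g\<mu> t\<pi> t\<mu> pX(1) pG(1) bar_sub_hom[OF Zss] bar_ar_hom[OF ins] bar_ar_hom[OF cs]
        bar_ar_hom[OF fs] path_comp_hom[OF GX ys1] path_comp_hom[OF TX ys2]
        have 1: "ghom (Gamma_mu V ?B X) a b \<cdot> (?i \<cdot> bar_ar V T ?is) =
            Gamma_incl V ?B X xs \<cdot> bar_sub small V T Zss"
          using mu(3)[OF ys ps] by (simp add: xs_def Zss_def bar_simps)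
        have 2: "ghom (mar T (\<pi> X)) a b \<cdot> path_comp (?\<Gamma> X) ys = path_comp (mob T X) ys \<cdot> bar_ar V T ?fs"
          using path_comp_nat[OF \<pi>_hom[OF X] ys1] by (simp add: mp)
        have "?L \<cdot> (?i \<cdot> bar_ar V T ?is) =
          pi_map V T X a b \<cdot> (Gamma_incl V ?B X xs \<cdot> bar_sub small V T Zss)"
          using H[THEN homD] by (simp add: cmp_assoc_Ar cmp_Ar 1)
        also have "\<dots> = path_comp X xs \<cdot> bar_sub small V T Zss"
          using H[THEN homD] by (simp add: cmp_chain[OF pX(2)[OF xs]])
        also have "\<dots> = ghom (mu T X) a b \<cdot> (path_comp (mob T X) ys \<cdot> bar_ar V T ?cs)"
          using mu_path_comp[OF X ys ps] by (simp add: xs_def Zss_def)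
        also have "\<dots> = ghom (mu T X) a b \<cdot> ((ghom (mar T (\<pi> X)) a b \<cdot> path_comp (?\<Gamma> X) ys) \<cdot> bar_ar V T ?is)"
          using H[THEN homD] by (simp add: cmp_assoc_Ar cmp_Ar 2 sq)
        also have "\<dots> = ?R \<cdot>
            (?i \<cdot> bar_ar V T ?is)"
          using H[THEN homD] by (simp add: cmp_assoc_Ar cmp_Ar cmp_chain[OF pG(2)[OF ys1]])
        finally show "?L \<cdot>
            (case q of (ys, ps) \<Rightarrow> Gamma_incl V ?B (?\<Gamma> X) ys \<cdot> tar ?B (map (Gamma_incl V ?B X) ps)) =
          ?R \<cdot>
            (case q of (ys, ps) \<Rightarrow> Gamma_incl V ?B (?\<Gamma> X) ys \<cdot> tar ?B (map (Gamma_incl V ?B X) ps))"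
          by (simp add: q_eq bar_simps)
      qed
    qed
    then show "\<pi> X \<star> mu (Gamma V ?B) X = mu T X \<star> (mar T (\<pi> X) \<star> \<pi> (mob (Gamma V ?B) X))"
      by (simp add: Gamma_def)
  qed
  \<comment> \<open>Here \<open>T\<close> is the target of the isomorphism to be inverted, so its
    functoriality provides the other alternative in the inversion lemma.\<close>
  then show ?thesis
    by (rule monads_over_Set_isomorphic_sym)
      (simp_all add: T Gamma_def B.Gamma_vgraph B.Gamma_ar_hom mob_vgraph mar_hom verts_mob B.Gamma_eta_hom mu_hom
        B.Gamma_mu_hom)
qed

theorem theorem4p2p4:
  fixes V :: "('o, 'm) cat"
    and small :: "'u set \<Rightarrow> bool"
    and T :: "(('u, 'o) vgraph, ('u, 'o, 'm) gmap) monad_data"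
  assumes "category V"
    and "smallness small"
    and "has_coproducts small V"
    and "is_monad_over_Set small V T"
  shows "((\<exists>E. is_distributive_multitensor small V E \<and>
               monads_over_Set_isomorphic small V T (Gamma V E)) \<longleftrightarrow>
          is_distributive_monad small V T \<and> is_path_like small V T) \<and>
         (\<forall>E. is_distributive_multitensor small V E \<and>
              monads_over_Set_isomorphic small V T (Gamma V E) \<longrightarrow>
              multitensors_isomorphic V E (bar small V T))"
proof -
  interpret graph_monad V small T
    using assms by (simp add: graph_monad_def graph_monad_axioms_def coproduct_category_def coproduct_category_axioms_def)
  show ?thesis
  proof (intro conjI iffI allI impI)
    assume "\<exists>E. is_distributive_multitensor small V E \<and> monads_over_Set_isomorphic small V T (Gamma V E)"
    then obtain E where "is_distributive_multitensor small V E" "monads_over_Set_isomorphic small V T (Gamma V E)"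
      by blast
    from Gamma_isomorphic_imp(1,2)[OF this]
    show "is_distributive_monad small V T" "is_path_like small V T" .
  next
    assume "is_distributive_monad small V T \<and> is_path_like small V T"
    \<comment> \<open>The witness is \<open>bar small V T\<close>, a distributive multitensor by the
      definition of a distributive monad.\<close>
    then show "\<exists>E. is_distributive_multitensor small V E \<and> monads_over_Set_isomorphic small V T (Gamma V E)"
      using isomorphic_Gamma_bar by (intro exI[of _ "bar small V T"]) (simp add: is_distributive_monad_def)
  next
    fix E
    assume "is_distributive_multitensor small V E \<and> monads_over_Set_isomorphic small V T (Gamma V E)"
    then show "multitensors_isomorphic V E (bar small V T)" using Gamma_isomorphic_imp(3) by blast
  qed
qed

end
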